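(* Let $H$ be a real Hilbert space and let $A$ be a self-adjoint linear operator on $H$ with dense domain $D(A)$ such that $$\nu:=\inf\{\langle Au,u\rangle: u\in D(A),\ |u|=1\}>0 .$$ Let $p\in[0,1]$, $(u_0,u_1)\in D(A)\times D(A^{1/2})$, and $\varepsilon_0>0$. Let $c:[0,+\infty)\to(0,+\infty)$ and $c_\varepsilon:[0,+\infty)\to(0,+\infty)$, $\varepsilon\in(0,\varepsilon_0)$, be functions of class $C^1$ for which there are constants $\mu>0$, $M_1,\dots,M_5$ such that, for all $t\ge 0$ and all $\varepsilon\in(0,\varepsilon_0)$, $$\mu\le c(t)\le M_1,\quad |c'(t)|\le M_2,\quad \mu\le c_\varepsilon(t)\le M_3,\quad |c_\varepsilon'(t)|\le\frac{M_4}{(1+t)^p},\quad |c_\varepsilon(t)-c(t)|\le M_5\,\varepsilon .$$ Let $u$, $u_\varepsilon$, $r_\varepsilon$, $\rho_\varepsilon$ be as defined in the context, and set $$\Gamma_{r,\varepsilon}(t):=|\rho_\varepsilon(t)|^2+|A^{1/2}\rho_\varepsilon(t)|^2+\varepsilon|r_\varepsilon'(t)|^2,$$ $$\Gamma_{c,\varepsilon}(t):=|\rho_\varepsilon(t)|^2+|A^{1/2}\rho_\varepsilon(t)|^2+|A\rho_\varepsilon(t)|^2+|r_\varepsilon'(t)|^2+\varepsilon|A^{1/2}r_\varepsilon'(t)|^2.$$ (1) If in addition $(u_0,u_1)\in D(A^{3/2})\times D(A^{1/2})$, then the following decay-error estimates hold. - If $p=0$: for every $\beta<2\mu\nu$ there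 exist $\varepsilon_1\in(0,\varepsilon_0]$ and $C$ such that $\Gamma_{r,\varepsilon}(t)\le C\varepsilon^2e^{-\beta t}$ for all $t\ge 0$ and all $\varepsilon\in(0,\varepsilon_1)$. - If $p\in(0,1)$: for every $\beta>0$ there exist $\varepsilon_1\in(0,\varepsilon_0]$ and $C$ such that $\Gamma_{r,\varepsilon}(t)\le C\varepsilon^2e^{-\beta(1+t)^{1-p}}$ for all $t\ge 0$ and all $\varepsilon\in(0,\varepsilon_1)$. - If $p=1$: for every $\beta>0$ there exist $\varepsilon_1\in(0,\varepsilon_0]$ and $C$ such that $\Gamma_{r,\varepsilon}(t)\le \dfrac{C\varepsilon^2}{(1+t)^\beta}$ for all $t\ge 0$ and all $\varepsilon\in(0,\varepsilon_1)$. (2) If in addition $(u_0,u_1)\in D(A^2)\times D(A)$, then the same decay-error estimates (in each of the three cases for $p$, with the same quantifiers) hold with $\Gamma_{c,\varepsilon}(t)$ instead of $\Gamma_{r,\varepsilon}(t)$. (The constants $C$ and $\varepsilon_1$ may depend on $\beta$; $C$ does not depend on $\varepsilon$ or $t$.)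
   Context: $|x|$ and $\langle x,y\rangle$ denote the norm and scalar product of $H$. The operator $A$ may be unbounded; its powers $A^\alpha$ ($\alpha\ge 0$) are defined by the spectral theorem on domains $D(A^\alpha)$, endowed with the graph norm. $u\in C^1([0,+\infty);H)\cap C^0([0,+\infty);D(A))$ is the unique global solution of $$\frac{1}{(1+t)^p}u'(t)+c(t)Au(t)=0\quad(t\ge 0),\qquad u(0)=u_0.$$ For $\varepsilon\in(0,\varepsilon_0)$, $u_\varepsilon\in C^2([0,+\infty);H)\cap C^1([0,+\infty);D(A^{1/2}))\cap C^0([0,+\infty);D(A))$ is the unique global solution of $$\varepsilon u_\varepsilon''(t)+\frac{1}{(1+t)^p}u_\varepsilon'(t)+c_\varepsilon(t)Au_\varepsilon(t)=0\quad(t\ge 0),\qquad u_\varepsilon(0)=u_0,\quad u_\varepsilon'(0)=u_1.$$ The corrector $\theta_\varepsilon:[0,+\infty)\to H$ is the solution of $$\varepsilon\theta_\varepsilon''(t)+\frac{1}{(1+t)^p}\theta_\varepsilon'(t)=0\quad(t\ge 0),\qquad \theta_\varepsilon(0)=0,\qquad \theta_\varepsilon'(0)=u_1+c(0)Au_0 .$$ The remainders $r_\varepsilon$ and $\rho_\varepsilon$ are defined by $u_\varepsilon(t)=u(t)+\theta_\varepsilon(t)+r_\varepsilon(t)=u(t)+\rho_\varepsilon(t)$ for all $t\ge 0$. *)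

theory Defs
  imports "HOL-Analysis.Analysis"
begin

section \<open>Self-adjoint operators\<close>

text \<open>
  An unbounded operator is a pair of a domain \<open>D\<close> and a total function \<open>A\<close>; only the values of
  \<open>A\<close> on \<open>D\<close> matter. A real Hilbert space is a type of sort \<open>{real_inner, complete_space}\<close>.
\<close>

definition adjoint_domain :: "'h::real_inner set \<Rightarrow> ('h \<Rightarrow> 'h) \<Rightarrow> 'h set" where
  "adjoint_domain D A = {y. \<exists>z. \<forall>x\<in>D. inner (A x) y = inner x z}"

definition self_adjoint_operator :: "'h::real_inner set \<Rightarrow> ('h \<Rightarrow> 'h) \<Rightarrow> bool" where
  "self_adjoint_operator D A \<longleftrightarrow>
     subspace D \<and> closure D = UNIV \<and>
     (\<forall>x\<in>D. \<forall>y\<in>D. A (x + y) = A x + A y) \<and>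
     (\<forall>a. \<forall>x\<in>D. A (a *\<^sub>R x) = a *\<^sub>R A x) \<and>
     adjoint_domain D A = D \<and>
     (\<forall>x\<in>D. \<forall>y\<in>D. inner (A x) y = inner x (A y))"

text \<open>
  The infimum is taken in the extended reals: a real-valued \<open>Inf\<close> would be unspecified for forms
  that are unbounded below, and on the zero space.
\<close>

definition form_infimum :: "'h::real_inner set \<Rightarrow> ('h \<Rightarrow> 'h) \<Rightarrow> ereal" where
  "form_infimum D A = (INF x\<in>{x \<in> D. norm x = 1}. ereal (inner (A x) x))"


section \<open>Spectral resolution and powers\<close>

definition orthogonal_projection :: "('h::real_inner \<Rightarrow> 'h) \<Rightarrow> bool" where
  "orthogonal_projection P \<longleftrightarrow>
     bounded_linear P \<and> (\<forall>x. P (P x) = P x) \<and> (\<forall>x y. inner (P x) y = inner x (P y))"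

definition resolution_of_identity :: "(real \<Rightarrow> 'h::real_inner \<Rightarrow> 'h) \<Rightarrow> bool" where
  "resolution_of_identity E \<longleftrightarrow>
     (\<forall>s. orthogonal_projection (E s)) \<and>
     (\<forall>s t x. s \<le> t \<longrightarrow> E s (E t x) = E s x) \<and>
     (\<forall>s x. ((\<lambda>t. E t x) \<longlongrightarrow> E s x) (at_right s)) \<and>
     (\<forall>x. ((\<lambda>t. E t x) \<longlongrightarrow> 0) at_bot) \<and>
     (\<forall>x. ((\<lambda>t. E t x) \<longlongrightarrow> x) at_top)"

text \<open>The Stieltjes measure \<open>d\<langle>E\<^sub>s x, x\<rangle>\<close>.\<close>

definition spectral_measure :: "(real \<Rightarrow> 'h::real_inner \<Rightarrow> 'h) \<Rightarrow> 'h \<Rightarrow> real measure" where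
  "spectral_measure E x = interval_measure (\<lambda>s. inner (E s x) x)"

definition spectral_domain :: "(real \<Rightarrow> 'h::real_inner \<Rightarrow> 'h) \<Rightarrow> (real \<Rightarrow> real) \<Rightarrow> 'h set" where
  "spectral_domain E f = {x. integrable (spectral_measure E x) (\<lambda>s. (f s)\<^sup>2)}"

text \<open>
  The integral of \<open>f\<close> against \<open>d\<langle>E\<^sub>s x, z\<rangle>\<close>, by polarization; it is only used for \<open>x\<close> and \<open>z\<close> in
  \<open>spectral_domain E f\<close>. This is a subspace and the measures are finite, so that both
  integrals converge there.
\<close>

definition spectral_form ::
    "(real \<Rightarrow> 'h::real_inner \<Rightarrow> 'h) \<Rightarrow> (real \<Rightarrow> real) \<Rightarrow> 'h \<Rightarrow> 'h \<Rightarrow> real" where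
  "spectral_form E f x z =
     ((LINT s|spectral_measure E (x + z). f s) - (LINT s|spectral_measure E (x - z). f s)) / 4"

text \<open>
  \<open>y = \<integral> f(s) dE\<^sub>s x\<close> in the weak sense. Testing with \<open>z\<close> in the domain is enough to
  determine \<open>y\<close>, because the domain is dense.
\<close>

definition has_spectral_integral ::
    "(real \<Rightarrow> 'h::real_inner \<Rightarrow> 'h) \<Rightarrow> (real \<Rightarrow> real) \<Rightarrow> 'h \<Rightarrow> 'h \<Rightarrow> bool" where
  "has_spectral_integral E f x y \<longleftrightarrow>
     x \<in> spectral_domain E f \<and> (\<forall>z\<in>spectral_domain E f. inner y z = spectral_form E f x z)"

text \<open>\<open>A = \<integral> s dE\<^sub>s\<close>, including equality of the domains.\<close>

definition is_spectral_resolution ::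
    "'h::real_inner set \<Rightarrow> ('h \<Rightarrow> 'h) \<Rightarrow> (real \<Rightarrow> 'h \<Rightarrow> 'h) \<Rightarrow> bool" where
  "is_spectral_resolution D A E \<longleftrightarrow>
     resolution_of_identity E \<and>
     D = spectral_domain E (\<lambda>s. s) \<and>
     (\<forall>x\<in>D. has_spectral_integral E (\<lambda>s. s) x (A x))"

text \<open>By the spectral theorem a self-adjoint operator has exactly one spectral resolution.\<close>

definition spectral_resolution ::
    "'h::real_inner set \<Rightarrow> ('h \<Rightarrow> 'h) \<Rightarrow> real \<Rightarrow> 'h \<Rightarrow> 'h" where
  "spectral_resolution D A = (SOME E. is_spectral_resolution D A E)"

text \<open>
  The powers \<open>A\<^sup>\<alpha> = \<integral> s\<^sup>\<alpha> dE\<^sub>s\<close> of an operator whose form has a positive infimum. Its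
  spectrum lies in the positive half-line, so the values of \<open>s powr \<alpha>\<close> for \<open>s \<le> 0\<close> play no role.
  The first conjunct in the domain holds for every self-adjoint operator; it makes the domain
  empty when there is no spectral resolution for \<open>SOME\<close> to pick.
\<close>

definition power_domain :: "'h::real_inner set \<Rightarrow> ('h \<Rightarrow> 'h) \<Rightarrow> real \<Rightarrow> 'h set" where
  "power_domain D A \<alpha> =
     {x. is_spectral_resolution D A (spectral_resolution D A) \<and>
         x \<in> spectral_domain (spectral_resolution D A) (\<lambda>s. s powr \<alpha>)}"

definition power_operator :: "'h::real_inner set \<Rightarrow> ('h \<Rightarrow> 'h) \<Rightarrow> real \<Rightarrow> 'h \<Rightarrow> 'h" where
  "power_operator D A \<alpha> x =
     (THE y. has_spectral_integral (spectral_resolution D A) (\<lambda>s. s powr \<alpha>) x y)"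


section \<open>Regularity on the half-line\<close>

text \<open>Derivatives are one-sided at \<open>0\<close>; values at negative times are irrelevant.\<close>

definition C1_half_line :: "(real \<Rightarrow> 'a::real_normed_vector) \<Rightarrow> (real \<Rightarrow> 'a) \<Rightarrow> bool" where
  "C1_half_line f f' \<longleftrightarrow>
     (\<forall>t\<ge>0. (f has_vector_derivative f' t) (at t within {0..})) \<and> continuous_on {0..} f'"

text \<open>
  For functions with values in a domain \<open>D\<close> of an operator \<open>B\<close>, the graph norm of \<open>x\<close> is the
  product norm of \<open>(x, B x)\<close>, so regularity with values in \<open>D\<close> is regularity of the lift of the
  function to the graph of \<open>B\<close>.
\<close>

definition C0_into_domain :: "'h::real_normed_vector set \<Rightarrow> ('h \<Rightarrow> 'h) \<Rightarrow> (real \<Rightarrow> 'h) \<Rightarrow> bool" where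
  "C0_into_domain D B f \<longleftrightarrow>
     (\<forall>t\<ge>0. f t \<in> D) \<and> continuous_on {0..} (\<lambda>t. (f t, B (f t)))"

definition C1_into_domain ::
    "'h::real_normed_vector set \<Rightarrow> ('h \<Rightarrow> 'h) \<Rightarrow> (real \<Rightarrow> 'h) \<Rightarrow> (real \<Rightarrow> 'h) \<Rightarrow> bool" where
  "C1_into_domain D B f f' \<longleftrightarrow>
     (\<forall>t\<ge>0. f t \<in> D \<and> f' t \<in> D) \<and>
     C1_half_line (\<lambda>t. (f t, B (f t))) (\<lambda>t. (f' t, B (f' t)))"


section \<open>The two problems and the corrector\<close>

definition parabolic_solution ::
    "'h::real_inner set \<Rightarrow> ('h \<Rightarrow> 'h) \<Rightarrow> real \<Rightarrow> (real \<Rightarrow> real) \<Rightarrow> 'h \<Rightarrow> (real \<Rightarrow> 'h) \<Rightarrow> bool" where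
  "parabolic_solution D A p c u0 u \<longleftrightarrow>
     (\<exists>u'. C1_half_line u u' \<and> C0_into_domain D A u \<and>
       (\<forall>t\<ge>0. (1 / (1 + t) powr p) *\<^sub>R u' t + c t *\<^sub>R A (u t) = 0) \<and>
       u 0 = u0)"

definition hyperbolic_solution ::
    "'h::real_inner set \<Rightarrow> ('h \<Rightarrow> 'h) \<Rightarrow> real \<Rightarrow> real \<Rightarrow> (real \<Rightarrow> real) \<Rightarrow> 'h \<Rightarrow> 'h \<Rightarrow>
      (real \<Rightarrow> 'h) \<Rightarrow> bool" where
  "hyperbolic_solution D A p \<epsilon> c u0 u1 u \<longleftrightarrow>
     (\<exists>u' u''. C1_half_line u u' \<and> C1_half_line u' u'' \<and>
       C1_into_domain (power_domain D A (1/2)) (power_operator D A (1/2)) u u' \<and>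
       C0_into_domain D A u \<and>
       (\<forall>t\<ge>0. \<epsilon> *\<^sub>R u'' t + (1 / (1 + t) powr p) *\<^sub>R u' t + c t *\<^sub>R A (u t) = 0) \<and>
       u 0 = u0 \<and> u' 0 = u1)"

definition corrector :: "real \<Rightarrow> real \<Rightarrow> 'h::real_normed_vector \<Rightarrow> (real \<Rightarrow> 'h) \<Rightarrow> bool" where
  "corrector p \<epsilon> w \<theta> \<longleftrightarrow>
     (\<exists>\<theta>' \<theta>''. C1_half_line \<theta> \<theta>' \<and> C1_half_line \<theta>' \<theta>'' \<and>
       (\<forall>t\<ge>0. \<epsilon> *\<^sub>R \<theta>'' t + (1 / (1 + t) powr p) *\<^sub>R \<theta>' t = 0) \<and>
       \<theta> 0 = 0 \<and> \<theta>' 0 = w)"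


section \<open>Error functionals and decay-error estimates\<close>

abbreviation half_line_deriv :: "(real \<Rightarrow> 'a::real_normed_vector) \<Rightarrow> real \<Rightarrow> 'a" where
  "half_line_deriv f t \<equiv> vector_derivative f (at t within {0..})"

definition Gamma_r ::
    "'h::real_inner set \<Rightarrow> ('h \<Rightarrow> 'h) \<Rightarrow> real \<Rightarrow> (real \<Rightarrow> 'h) \<Rightarrow> (real \<Rightarrow> 'h) \<Rightarrow> real \<Rightarrow> real" where
  "Gamma_r D A \<epsilon> \<rho> r t =
     (norm (\<rho> t))\<^sup>2 + (norm (power_operator D A (1/2) (\<rho> t)))\<^sup>2
     + \<epsilon> * (norm (half_line_deriv r t))\<^sup>2"

definition Gamma_c ::
    "'h::real_inner set \<Rightarrow> ('h \<Rightarrow> 'h) \<Rightarrow> real \<Rightarrow> (real \<Rightarrow> 'h) \<Rightarrow> (real \<Rightarrow> 'h) \<Rightarrow> real \<Rightarrow> real" where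
  "Gamma_c D A \<epsilon> \<rho> r t =
     (norm (\<rho> t))\<^sup>2 + (norm (power_operator D A (1/2) (\<rho> t)))\<^sup>2 + (norm (A (\<rho> t)))\<^sup>2
     + (norm (half_line_deriv r t))\<^sup>2
     + \<epsilon> * (norm (power_operator D A (1/2) (half_line_deriv r t)))\<^sup>2"

text \<open>\<open>\<kappa>\<close> is the threshold for the rate in the case \<open>p = 0\<close>; the functional is \<open>\<Gamma> \<epsilon> t\<close>.\<close>

definition decay_error_estimates :: "real \<Rightarrow> ereal \<Rightarrow> real \<Rightarrow> (real \<Rightarrow> real \<Rightarrow> real) \<Rightarrow> bool" where
  "decay_error_estimates p \<kappa> \<epsilon>0 \<Gamma> \<longleftrightarrow>
     (p = 0 \<longrightarrow>
       (\<forall>\<beta>::real. ereal \<beta> < \<kappa> \<longrightarrow> (\<exists>\<epsilon>1 C. 0 < \<epsilon>1 \<and> \<epsilon>1 \<le> \<epsilon>0 \<and>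
         (\<forall>\<epsilon> t. 0 < \<epsilon> \<longrightarrow> \<epsilon> < \<epsilon>1 \<longrightarrow> 0 \<le> t \<longrightarrow> \<Gamma> \<epsilon> t \<le> C * \<epsilon>\<^sup>2 * exp (- \<beta> * t))))) \<and>
     (0 < p \<and> p < 1 \<longrightarrow>
       (\<forall>\<beta>>0. \<exists>\<epsilon>1 C. 0 < \<epsilon>1 \<and> \<epsilon>1 \<le> \<epsilon>0 \<and>
         (\<forall>\<epsilon> t. 0 < \<epsilon> \<longrightarrow> \<epsilon> < \<epsilon>1 \<longrightarrow> 0 \<le> t \<longrightarrow>
           \<Gamma> \<epsilon> t \<le> C * \<epsilon>\<^sup>2 * exp (- \<beta> * (1 + t) powr (1 - p))))) \<and>
     (p = 1 \<longrightarrow>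
       (\<forall>\<beta>>0. \<exists>\<epsilon>1 C. 0 < \<epsilon>1 \<and> \<epsilon>1 \<le> \<epsilon>0 \<and>
         (\<forall>\<epsilon> t. 0 < \<epsilon> \<longrightarrow> \<epsilon> < \<epsilon>1 \<longrightarrow> 0 \<le> t \<longrightarrow> \<Gamma> \<epsilon> t \<le> C * \<epsilon>\<^sup>2 / (1 + t) powr \<beta>)))"

end

theory Submission
  imports Defs
begin

text \<open>
  Write \<open>b(t) = (1 + t) powr (- p)\<close> and \<open>B(t)\<close> for its primitive; in all three cases the claim is decay like
  \<open>exp (- \<beta> B(t))\<close>. With \<open>c\<^sub>\<epsilon>\<close> the coefficient of the hyperbolic problem, the remainders satisfy
  \<open>\<epsilon> r'' + b r' + c\<^sub>\<epsilon> A \<rho> = - (c\<^sub>\<epsilon> - c) A u - \<epsilon> u''\<close> with zero initial data. Testing with \<open>r'\<close> and with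
  a large multiple of \<open>b \<rho>\<close> makes a weighted energy decay up to two errors: the right-hand side, which
  is \<open>\<epsilon>\<^sup>2\<close> times the dissipation of \<open>|A\<^sup>3\<^sup>/\<^sup>2 u|\<^sup>2\<close> along the parabolic flow, and the boundary layer
  \<open>\<rho>' - r' = \<theta>'\<close>, which has size \<open>exp (- B(t) / \<epsilon>)\<close> and hence mass \<open>O(\<epsilon>)\<close>. Compressing everything with
  the spectral projections \<open>E n\<close> of \<open>A\<close> turns \<open>A\<close> into a bounded operator, so that \<open>u''\<close> makes sense, and
  the constants do not depend on \<open>n\<close>.
\<close>

section \<open>Differential inequalities on the half-line\<close>

text \<open>The shape of the functionals dictates the energy. The kinetic part has \<open>r'\<close>
  and not \<open>\<rho>'\<close>, because \<open>\<theta>'\<close> has size one at time 0 and would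
  destroy the order \<epsilon>^2; the potential part has \<open>\<rho>\<close>, because
  \<open>A \<theta>\<close> need not make sense for the given data. The weight exp (\<beta> B) is
  paid for by the parabolic dissipation and by the damping of \<open>\<rho>\<close>. Both tolerate a
  relative growth of at most q (1 + t)^p with q < 2 \<mu> \<nu>, and this alone produces the
  threshold for \<beta>. The second functional needs no new energy: the equations do not mention the
  inner product, so the same estimate holds for the form <A x, y>. Only |r'|^2 without the factor
  \<epsilon> is treated apart, by reading the equation as a first order equation for
  \<open>r'\<close> with relaxation time \<epsilon> (1 + t)^p. Compressed quantities return to the
  original ones through quadratic bounds: those uniform in n survive E n x --> x, and for the square
  root of A the Fatou lemma for spectral measures gives both the bound and membership in the
  domain.\<close>

lemma nonincreasing_half_line:
  fixes f :: "real \<Rightarrow> real"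
  assumes f: "\<And>t. 0 \<le> t \<Longrightarrow> (f has_real_derivative f' t) (at t within {0..})"
    and f': "\<And>t. 0 \<le> t \<Longrightarrow> f' t \<le> 0" and t: "0 \<le> t"
  shows "f t \<le> f 0"
proof (cases "t = 0")
  case False
  with t have t: "0 < t" by simp
  have "\<exists>x\<in>{0<..<t}. f t - f 0 = (*) (f' x) (t - 0)"
  proof (rule mvt_simple[OF t])
    fix x :: real assume "0 \<le> x" "x \<le> t"
    then show "(f has_derivative (*) (f' x)) (at x within {0..t})"
      using f[of x] by (auto simp: has_field_derivative_def intro: has_derivative_subset)
  qed
  then obtain x where x: "0 < x" "f t - f 0 = f' x * t" by auto
  have "f' x * t \<le> 0" using f'[of x] x(1) t by (simp add: mult_nonpos_nonneg)
  then show ?thesis using x(2) by simp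
qed simp

text \<open>\<open>exp (- S t)\<close> is the integrating factor. The rate enters through a
  primitive \<open>S\<close> chosen by the caller and may be negative, as in the velocity estimate,
  where \<open>f\<close> starts nonpositive.\<close>

lemma gronwall_half_line:
  fixes f S :: "real \<Rightarrow> real"
  assumes f: "\<And>t. 0 \<le> t \<Longrightarrow> (f has_real_derivative f' t) (at t within {0..})"
    and S: "\<And>t. 0 \<le> t \<Longrightarrow> (S has_real_derivative S' t) (at t within {0..})"
    and le: "\<And>t. 0 \<le> t \<Longrightarrow> f' t \<le> S' t * f t" and t: "0 \<le> t"
  shows "f t \<le> f 0 * exp (S t - S 0)"
proof -
  have "f t * exp (- S t) \<le> f 0 * exp (- S 0)"
  proof (rule nonincreasing_half_line[OF _ _ t, where f = "\<lambda>t. f t * exp (- S t)"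
        and f' = "\<lambda>t. (f' t - S' t * f t) * exp (- S t)"])
    fix s :: real assume s: "0 \<le> s"
    show "((\<lambda>t. f t * exp (- S t)) has_real_derivative (f' s - S' s * f s) * exp (- S s))
        (at s within {0..})"
      by (rule derivative_eq_intros f S s refl | simp add: algebra_simps)+
    show "(f' s - S' s * f s) * exp (- S s) \<le> 0"
      using le[OF s] by (simp add: mult_nonpos_nonneg)
  qed
  then have "f t * exp (- S t) * exp (S t) \<le> f 0 * exp (- S 0) * exp (S t)"
    by (rule mult_right_mono) simp
  then show ?thesis by (simp add: exp_diff exp_minus field_simps)
qed

section \<open>The primitive of the damping coefficient, compared with ln (1 + t) and with t\<close>

definition damping_primitive :: "real \<Rightarrow> real \<Rightarrow> real" where
  "damping_primitive p t =
     (if p = 1 then ln (1 + t) else ((1 + t) powr (1 - p) - 1) / (1 - p))"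

lemma damping_primitive_0 [simp]: "damping_primitive p 0 = 0"
  by (simp add: damping_primitive_def)

lemma powr_half_line_deriv:
  assumes "0 \<le> t"
  shows "((\<lambda>t. (1 + t) powr a) has_real_derivative a * (1 + t) powr (a - 1)) (at t within X)"
proof -
  have "((\<lambda>t. (1 + t) powr a) has_real_derivative a * (1 + t) powr (a - 1) * 1) (at t within X)"
    by (rule DERIV_chain2[OF has_real_derivative_powr]) (use assms in \<open>auto intro!: derivative_eq_intros\<close>)
  then show ?thesis by simp
qed

lemma damping_primitive_deriv:
  assumes "0 \<le> t"
  shows "(damping_primitive p has_real_derivative (1 + t) powr (- p)) (at t within X)"
proof (cases "p = 1")
  case True
  have "((\<lambda>t. ln (1 + t)) has_real_derivative inverse (1 + t)) (at t within X)"
    using assms by (auto intro!: derivative_eq_intros simp: field_simps)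
  moreover have "damping_primitive p = (\<lambda>t. ln (1 + t))"
    using True by (auto simp: damping_primitive_def)
  ultimately show ?thesis using True assms by (simp add: powr_minus)
next
  case False
  have "((\<lambda>t. ((1 + t) powr (1 - p) - 1) / (1 - p)) has_real_derivative
      ((1 - p) * (1 + t) powr (1 - p - 1) - 0) / (1 - p)) (at t within X)"
    by (intro DERIV_cdivide DERIV_diff powr_half_line_deriv DERIV_const assms)
  moreover have "damping_primitive p = (\<lambda>t. ((1 + t) powr (1 - p) - 1) / (1 - p))"
    using False by (auto simp: damping_primitive_def)
  ultimately show ?thesis using False by simp
qed

text \<open>This is 1 + x \<le> exp x at x = (1 - p) ln (1 + t). It makes p = 1 the worst case: for
  every p the layer exp (- B / \<epsilon>) is at most (1 + t)^(- 1 / \<epsilon>), whose integral is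
  explicit.\<close>

lemma damping_primitive_ge_ln:
  assumes "p \<le> 1" "0 \<le> t"
  shows "ln (1 + t) \<le> damping_primitive p t"
proof (cases "p = 1")
  case False
  have "1 + (1 - p) * ln (1 + t) \<le> exp ((1 - p) * ln (1 + t))" by (rule exp_ge_add_one_self)
  also have "\<dots> = (1 + t) powr (1 - p)" using assms by (simp add: powr_def)
  finally show ?thesis using False assms by (simp add: damping_primitive_def field_simps)
qed (simp add: damping_primitive_def)

lemma damping_primitive_le:
  assumes "0 \<le> p" "0 \<le> t"
  shows "damping_primitive p t \<le> t"
proof -
  have "damping_primitive p t - t \<le> damping_primitive p 0 - 0"
  proof (rule nonincreasing_half_line[OF _ _ assms(2), where f' = "\<lambda>t. (1 + t) powr (- p) - 1"])
    fix s :: real assume s: "0 \<le> s"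
    show "((\<lambda>t. damping_primitive p t - t) has_real_derivative (1 + s) powr (- p) - 1) (at s within {0..})"
      by (auto intro!: derivative_eq_intros damping_primitive_deriv s)
    show "(1 + s) powr (- p) - 1 \<le> 0"
      using powr_mono[of "-p" 0 "1 + s"] assms s by simp
  qed
  then show ?thesis by simp
qed

lemma damping_primitive_nonneg:
  assumes "p \<le> 1" "0 \<le> t"
  shows "0 \<le> damping_primitive p t"
  using order_trans[OF ln_ge_zero damping_primitive_ge_ln[OF assms]] assms by simp

section \<open>Energy estimates for bounded operators\<close>

text \<open>\<open>I\<close> stands for the inner product but is only a bounded semidefinite form on
  a normed space. This leaves room for \<open>I (B x) y\<close> in its place, so that one abstract
  estimate serves both orders of regularity.\<close>

locale energy_form =
  fixes I :: "'h::real_normed_vector \<Rightarrow> 'h \<Rightarrow> real" and B :: "'h \<Rightarrow> 'h" and \<nu> :: real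
  assumes bilinear: "bounded_bilinear I"
    and I_commute: "I x y = I y x"
    and I_nonneg: "0 \<le> I x x"
    and linear: "bounded_linear B"
    and I_sym: "I (B x) y = I x (B y)"
    and \<nu>_pos: "0 < \<nu>"
    and coercive: "\<nu> * I x x \<le> I (B x) x"
begin

lemmas I_simps = bounded_bilinear.add_left[OF bilinear] bounded_bilinear.add_right[OF bilinear]
  bounded_bilinear.diff_left[OF bilinear] bounded_bilinear.diff_right[OF bilinear]
  bounded_bilinear.minus_left[OF bilinear] bounded_bilinear.minus_right[OF bilinear]
  bounded_bilinear.scaleR_left[OF bilinear] bounded_bilinear.scaleR_right[OF bilinear]

lemmas B_simps = linear_simps[OF linear]

lemma B_nonneg: "0 \<le> I (B x) x"
  using coercive[of x] I_nonneg[of x] \<nu>_pos by (meson mult_nonneg_nonneg less_imp_le order_trans)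

lemma I_young:
  assumes "0 < \<tau>"
  shows "\<bar>I x y\<bar> \<le> (\<tau> * I x x + I y y / \<tau>) / 2"
proof -
  have e: "I (\<tau> *\<^sub>R x + a *\<^sub>R y) (\<tau> *\<^sub>R x + a *\<^sub>R y) = \<tau>\<^sup>2 * I x x + 2 * a * \<tau> * I x y + a\<^sup>2 * I y y" for a
    using I_commute[of y x] by (simp add: I_simps power2_eq_square algebra_simps)
  have "0 \<le> \<tau>\<^sup>2 * I x x + 2 * \<tau> * I x y + I y y" "0 \<le> \<tau>\<^sup>2 * I x x - 2 * \<tau> * I x y + I y y"
    using e[of 1] e[of "-1"] I_nonneg[of "\<tau> *\<^sub>R x + 1 *\<^sub>R y"] I_nonneg[of "\<tau> *\<^sub>R x + (-1) *\<^sub>R y"]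
    by simp_all
  then have "0 \<le> (\<tau>\<^sup>2 * I x x + 2 * \<tau> * I x y + I y y) / (2 * \<tau>)" "0 \<le> (\<tau>\<^sup>2 * I x x - 2 * \<tau> * I x y + I y y) / (2 * \<tau>)"
    using assms by simp_all
  then show ?thesis using assms by (simp add: abs_le_iff field_simps power2_eq_square)
qed

lemma I_add_le: "I (x + y) (x + y) \<le> 2 * I x x + 2 * I y y"
proof -
  have "I x y \<le> (I x x + I y y) / 2" using I_young[of 1 x y] by simp
  then show ?thesis using I_commute[of y x] by (simp add: I_simps)
qed

text \<open>Spectrally s (s - \<nu>) \<ge> 0. Here the square of B x - \<nu> x is expanded and
  coercivity is applied once to its last term. It is the coercivity of the derived form.\<close>

lemma B_norm_ge: "\<nu> * I (B x) x \<le> I (B x) (B x)"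
proof -
  have "0 \<le> I (B x - \<nu> *\<^sub>R x) (B x - \<nu> *\<^sub>R x)" by (rule I_nonneg)
  also have "\<dots> = I (B x) (B x) - 2 * \<nu> * I (B x) x + \<nu> * (\<nu> * I x x)"
    using I_commute[of x "B x"] by (simp add: I_simps algebra_simps)
  also have "\<dots> \<le> I (B x) (B x) - 2 * \<nu> * I (B x) x + \<nu> * I (B x) x"
    using coercive[of x] \<nu>_pos by (intro add_left_mono mult_left_mono) auto
  finally show ?thesis by (simp add: algebra_simps)
qed

lemma I_le_B: "I x x \<le> I (B x) x / \<nu>"
  using coercive[of x] \<nu>_pos by (simp add: field_simps)

lemma I_le_BB: "I x x \<le> I (B x) (B x) / \<nu>\<^sup>2"
proof -
  have "I x x \<le> I (B x) x / \<nu>" by (rule I_le_B)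
  also have "\<dots> \<le> (I (B x) (B x) / \<nu>) / \<nu>"
    using B_norm_ge[of x] \<nu>_pos by (intro divide_right_mono) (auto simp: field_simps)
  finally show ?thesis by (simp add: power2_eq_square)
qed

text \<open>
  Passing to this form takes the place of applying \<open>A\<^sup>1\<^sup>/\<^sup>2\<close> to the equations.
\<close>

lemma derived_form: "energy_form (\<lambda>x y. I (B x) y) B \<nu>"
proof
  show "\<exists>K. \<forall>a b. norm (I (B a) b) \<le> norm a * norm b * K"
    using bounded_bilinear.bounded[OF bounded_bilinear.comp1[OF bilinear linear]] .
  show "\<And>x y. I (B x) y = I (B y) x" using I_sym I_commute by metis
  show "\<And>x y. I (B (B x)) y = I (B x) (B y)" using I_sym by simp
  show "\<And>x. \<nu> * I (B x) x \<le> I (B (B x)) x" using B_norm_ge I_sym by simp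
qed (use \<nu>_pos B_nonneg bounded_linear.bounded[OF linear] in \<open>auto simp: I_simps B_simps\<close>)

lemma B_young:
  assumes "0 < \<tau>"
  shows "\<bar>I (B x) y\<bar> \<le> (\<tau> * I (B x) x + I (B y) y / \<tau>) / 2"
  using energy_form.I_young[OF derived_form assms] .

end


text \<open>
  Here \<open>U\<close>, \<open>v\<close>, \<open>s\<close>, \<open>w\<close> stand for the compressions of \<open>u\<close>, \<open>\<rho>\<^sub>\<epsilon>\<close>, \<open>r\<^sub>\<epsilon>'\<close>, \<open>\<theta>\<^sub>\<epsilon>'(0)\<close>, and \<open>k\<close> for
  \<open>c\<^sub>\<epsilon>\<close>; the last summand of \<open>s_eq\<close> is \<open>\<epsilon> U''\<close> computed from the parabolic equation.
\<close>

locale band_problem = energy_form I B \<nu>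
  for I :: "'h::real_normed_vector \<Rightarrow> 'h \<Rightarrow> real" and B \<nu> +
  fixes p \<mu> M1 M2 M3 M4 M5 \<epsilon> :: real and c c' k k' :: "real \<Rightarrow> real"
    and U v s s' :: "real \<Rightarrow> 'h" and w :: 'h
  assumes p: "0 \<le> p" "p \<le> 1" and \<epsilon>_pos: "0 < \<epsilon>" and \<mu>_pos: "0 < \<mu>"
    and c_deriv: "0 \<le> t \<Longrightarrow> (c has_real_derivative c' t) (at t within {0..})"
    and c_bounds: "0 \<le> t \<Longrightarrow> \<mu> \<le> c t \<and> c t \<le> M1"
    and c'_bound: "0 \<le> t \<Longrightarrow> \<bar>c' t\<bar> \<le> M2"
    and k_deriv: "0 \<le> t \<Longrightarrow> (k has_real_derivative k' t) (at t within {0..})"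
    and k_bounds: "0 \<le> t \<Longrightarrow> \<mu> \<le> k t \<and> k t \<le> M3"
    and k'_bound: "0 \<le> t \<Longrightarrow> \<bar>k' t\<bar> \<le> M4 * (1 + t) powr (- p)"
    and k_c: "0 \<le> t \<Longrightarrow> \<bar>k t - c t\<bar> \<le> M5 * \<epsilon>"
    and U_deriv: "0 \<le> t \<Longrightarrow>
      (U has_vector_derivative - ((1 + t) powr p * c t) *\<^sub>R B (U t)) (at t within {0..})"
    and v_deriv: "0 \<le> t \<Longrightarrow>
      (v has_vector_derivative s t + exp (- damping_primitive p t / \<epsilon>) *\<^sub>R w) (at t within {0..})"
    and s_deriv: "0 \<le> t \<Longrightarrow> (s has_vector_derivative s' t) (at t within {0..})"
    and s_eq: "0 \<le> t \<Longrightarrow> \<epsilon> *\<^sub>R s' t =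
      - ((1 + t) powr (- p) *\<^sub>R s t) - k t *\<^sub>R B (v t) - (k t - c t) *\<^sub>R B (U t)
      - \<epsilon> *\<^sub>R (((1 + t) powr p * c t)\<^sup>2 *\<^sub>R B (B (U t))
              - (p * (1 + t) powr (p - 1) * c t + (1 + t) powr p * c' t) *\<^sub>R B (U t))"
    and v_0: "v 0 = 0" and s_0: "s 0 = 0"
begin

text \<open>All of \<open>s_eq\<close> that involves neither \<open>s\<close> nor \<open>v\<close>:
  the mismatch of the two coefficients and the inertia of the parabolic solution, both of order
  \<epsilon>.\<close>

definition "g t = - (k t - c t) *\<^sub>R B (U t)
      - \<epsilon> *\<^sub>R (((1 + t) powr p * c t)\<^sup>2 *\<^sub>R B (B (U t))
              - (p * (1 + t) powr (p - 1) * c t + (1 + t) powr p * c' t) *\<^sub>R B (U t))"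

lemma s_eq_g:
  assumes "0 \<le> t"
  shows "\<epsilon> * I (s' t) x = - ((1 + t) powr (- p)) * I (s t) x - k t * I (B (v t)) x + I (g t) x"
proof -
  have "\<epsilon> *\<^sub>R s' t = - ((1 + t) powr (- p) *\<^sub>R s t) - k t *\<^sub>R B (v t) + g t"
    using s_eq[OF assms] by (simp add: g_def algebra_simps)
  then have "I (\<epsilon> *\<^sub>R s' t) x = I (- ((1 + t) powr (- p) *\<^sub>R s t) - k t *\<^sub>R B (v t) + g t) x"
    by simp
  then show ?thesis by (simp add: I_simps)
qed

text \<open>The three summands belong to the mismatch k - c, to the coefficient of B (B U) and to
  that of B U in the second derivative; 1 / \<nu>^2 is the price of replacing |B U|^2 by |B (B
  U)|^2, and the factors 2 and 4 come from one and two uses of \<open>I_add_le\<close>.\<close>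

definition "forcing_const = 2 * M5\<^sup>2 / \<nu>\<^sup>2 + 4 * M1 ^ 4 + 4 * (M1 + M2)\<^sup>2 / \<nu>\<^sup>2"

text \<open>The forcing is measured by B (B U) alone because that is what the parabolic energy
  \<open>Y\<close> dissipates. The power 4 p comes from the squared coefficient ((1 + t)^p c)^2;
  lower powers are raised to it by (1 + t)^p \<ge> 1.\<close>

lemma g_bound:
  assumes t: "0 \<le> t"
  shows "I (g t) (g t) \<le> \<epsilon>\<^sup>2 * forcing_const * (1 + t) powr (4 * p) * I (B (B (U t))) (B (B (U t)))"
proof -
  define R where "R = (1 + t) powr p"
  define Y where "Y = I (B (B (U t))) (B (B (U t)))"
  define a where "a = p * (1 + t) powr (p - 1) * c t + R * c' t"
  define X where "X = I (B (U t)) (B (U t))"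
  have R1: "1 \<le> R" unfolding R_def using t p by (simp add: ge_one_powr_ge_zero)
  have R4: "(1 + t) powr (4 * p) = R ^ 4" unfolding R_def using t
    by (simp add: powr_power mult.commute)
  have Y0: "0 \<le> Y" "0 \<le> X" unfolding X_def Y_def by (rule I_nonneg)+
  have XY: "X \<le> Y / \<nu>\<^sup>2" unfolding X_def Y_def by (rule I_le_BB)
  have M: "0 \<le> M1" "0 \<le> M2" using c_bounds[OF t] c'_bound[OF t] \<mu>_pos by auto
  have "p * (1 + t) powr (p - 1) \<le> 1 * (1 + t) powr p"
    using p t by (intro mult_mono powr_mono) auto
  then have pR: "p * (1 + t) powr (p - 1) \<le> R" "0 \<le> p * (1 + t) powr (p - 1)"
    using p t unfolding R_def by auto
  have "\<bar>a\<bar> \<le> \<bar>p * (1 + t) powr (p - 1) * c t\<bar> + \<bar>R * c' t\<bar>" unfolding a_def by (rule abs_triangle_ineq)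
  also have "\<dots> = (p * (1 + t) powr (p - 1)) * c t + R * \<bar>c' t\<bar>"
    using pR(2) R1 p c_bounds[OF t] \<mu>_pos by (simp add: abs_mult)
  also have "\<dots> \<le> R * M1 + R * M2"
    using pR R1 c_bounds[OF t] c'_bound[OF t] \<mu>_pos by (intro add_mono mult_mono) auto
  finally have "\<bar>a\<bar> \<le> R * (M1 + M2)" by (simp add: algebra_simps)
  then have a2: "a\<^sup>2 \<le> R\<^sup>2 * (M1 + M2)\<^sup>2"
    using power_mono[of "\<bar>a\<bar>" "R * (M1 + M2)" 2] by (simp add: power_mult_distrib)
  have c4: "(R * c t) ^ 4 \<le> R ^ 4 * M1 ^ 4"
    using power_mono[of "R * c t" "R * M1" 4] c_bounds[OF t] \<mu>_pos R1 by (simp add: power_mult_distrib)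
  have k2: "(k t - c t)\<^sup>2 \<le> M5\<^sup>2 * \<epsilon>\<^sup>2"
    using power_mono[of "\<bar>k t - c t\<bar>" "M5 * \<epsilon>" 2] k_c[OF t] by (simp add: power_mult_distrib)
  define h where "h = (R * c t)\<^sup>2 *\<^sub>R B (B (U t)) + (- a) *\<^sub>R B (U t)"
  have "I h h \<le> 2 * ((R * c t) ^ 4 * Y) + 2 * (a\<^sup>2 * X)"
    unfolding h_def by (rule order_trans[OF I_add_le])
      (simp add: I_simps X_def Y_def power2_eq_square power4_eq_xxxx algebra_simps)
  also have "\<dots> \<le> 2 * (R ^ 4 * M1 ^ 4 * Y) + 2 * (R\<^sup>2 * (M1 + M2)\<^sup>2 * (Y / \<nu>\<^sup>2))"
    using c4 a2 Y0 XY by (intro add_mono mult_left_mono mult_mono) auto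
  also have "\<dots> \<le> 2 * (R ^ 4 * M1 ^ 4 * Y) + 2 * (R ^ 4 * (M1 + M2)\<^sup>2 * (Y / \<nu>\<^sup>2))"
    using R1 Y0 power_increasing[of 2 4 R] by (intro add_mono mult_left_mono mult_right_mono) auto
  finally have h2: "I h h \<le> 2 * (R ^ 4 * M1 ^ 4 * Y) + 2 * (R ^ 4 * (M1 + M2)\<^sup>2 * (Y / \<nu>\<^sup>2))" .
  have "h = (R * c t)\<^sup>2 *\<^sub>R B (B (U t)) - a *\<^sub>R B (U t)"
    unfolding h_def scaleR_minus_left by simp
  then have "I (g t) (g t) = I ((- (k t - c t)) *\<^sub>R B (U t) + (- \<epsilon>) *\<^sub>R h) ((- (k t - c t)) *\<^sub>R B (U t) + (- \<epsilon>) *\<^sub>R h)"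
    by (simp add: g_def a_def R_def)
  also have "\<dots> \<le> 2 * I ((- (k t - c t)) *\<^sub>R B (U t)) ((- (k t - c t)) *\<^sub>R B (U t)) + 2 * I ((- \<epsilon>) *\<^sub>R h) ((- \<epsilon>) *\<^sub>R h)"
    by (rule I_add_le)
  also have "\<dots> = 2 * ((k t - c t)\<^sup>2 * X) + 2 * (\<epsilon>\<^sup>2 * I h h)"
    unfolding X_def bounded_bilinear.scaleR_left[OF bilinear] bounded_bilinear.scaleR_right[OF bilinear]
    by (simp add: power2_eq_square algebra_simps)
  also have "\<dots> \<le> 2 * (M5\<^sup>2 * \<epsilon>\<^sup>2 * (R ^ 4 * (Y / \<nu>\<^sup>2)))
      + 2 * (\<epsilon>\<^sup>2 * (2 * (R ^ 4 * M1 ^ 4 * Y) + 2 * (R ^ 4 * (M1 + M2)\<^sup>2 * (Y / \<nu>\<^sup>2))))"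
  proof (intro add_mono mult_left_mono h2 mult_mono k2)
    have "1 * (Y / \<nu>\<^sup>2) \<le> R ^ 4 * (Y / \<nu>\<^sup>2)"
      using R1 Y0 by (intro mult_right_mono) auto
    then show "X \<le> R ^ 4 * (Y / \<nu>\<^sup>2)" using XY by simp
  qed (use Y0 in auto)
  also have "\<dots> = \<epsilon>\<^sup>2 * forcing_const * R ^ 4 * Y"
    using \<nu>_pos by (simp add: forcing_const_def field_simps)
  finally show ?thesis by (simp add: R4 Y_def)
qed

lemma forcing_const_nonneg: "0 \<le> forcing_const"
  by (simp add: forcing_const_def)

text \<open>For the inner product this is the squared norm of A^(3/2) U, which explains the
  assumption on \<open>u0\<close>; for the derived form it is |A^2 U|^2.\<close>

definition "Y t = I (B (B (U t))) (B (U t))"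

lemma B_vector_derivative:
  "(f has_vector_derivative f') F \<Longrightarrow> ((\<lambda>t. B (f t)) has_vector_derivative B f') F"
  by (rule bounded_linear.has_vector_derivative[OF linear])

lemma I_deriv:
  assumes "(f has_vector_derivative f') (at t within X)" "(h has_vector_derivative h') (at t within X)"
  shows "((\<lambda>t. I (f t) (h t)) has_real_derivative I (f t) h' + I f' (h t)) (at t within X)"
  using bounded_bilinear.has_vector_derivative[OF bilinear assms]
  by (simp add: has_real_derivative_iff_has_vector_derivative)

lemma Y_deriv:
  assumes t: "0 \<le> t"
  shows "(Y has_real_derivative - 2 * (1 + t) powr p * c t * I (B (B (U t))) (B (B (U t)))) (at t within {0..})"
  unfolding Y_def
  apply (rule DERIV_cong)
   apply (rule I_deriv B_vector_derivative U_deriv t)+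
  using I_commute[of "B (B (B (U t)))" "B (U t)"] I_sym[of "B (B (U t))" "B (U t)"]
  by (simp add: I_simps B_simps)

lemma Y_nonneg: "0 \<le> Y t" unfolding Y_def by (rule B_nonneg)

lemma Y_le: "Y t \<le> I (B (B (U t))) (B (B (U t))) / \<nu>"
  unfolding Y_def using B_norm_ge[of "B (U t)"] \<nu>_pos by (simp add: field_simps)

text \<open>Differentiating the weight costs q (1 + t)^p V Y, hence at most q / \<nu> times the
  dissipated quantity, while the flow supplies 2 \<mu>. A positive rest requires q < 2 \<mu>
  \<nu>.\<close>

lemma weighted_Y_deriv:
  assumes t: "0 \<le> t" and V: "(V has_real_derivative V') (at t within {0..})"
    and V0: "0 \<le> V t" "V' \<le> q * (1 + t) powr p * V t" and q: "0 \<le> q"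
  obtains D where "((\<lambda>t. V t * Y t) has_real_derivative D) (at t within {0..})"
    "D \<le> - (2 * \<mu> - q / \<nu>) * (V t * (1 + t) powr p * I (B (B (U t))) (B (B (U t))))"
proof
  let ?Q = "I (B (B (U t))) (B (B (U t)))" and ?R = "(1 + t) powr p"
  show "((\<lambda>t. V t * Y t) has_real_derivative V' * Y t + - 2 * ?R * c t * ?Q * V t) (at t within {0..})"
    by (rule DERIV_mult[OF V Y_deriv[OF t]])
  have "V' * Y t \<le> (q * ?R * V t) * (?Q / \<nu>)"
    using V0 q Y_nonneg Y_le[of t]
    by (intro order_trans[OF mult_right_mono[OF V0(2)] mult_left_mono]) auto
  moreover have "2 * ?R * \<mu> * ?Q * V t \<le> 2 * ?R * c t * ?Q * V t"
    using c_bounds[OF t] V0 I_nonneg by (intro mult_right_mono mult_left_mono) auto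
  ultimately show "V' * Y t + - 2 * ?R * c t * ?Q * V t
      \<le> - (2 * \<mu> - q / \<nu>) * (V t * ?R * ?Q)"
    by (simp add: algebra_simps)
qed


text \<open>The first two terms come from testing with \<open>s\<close>, the bracket from testing
  with b v. Differentiating the cross term yields the missing dissipation - b k <B v, v>, together
  with the damping term - b^2 <s, v>; the summand b^2 |v|^2 / 2 is there to cancel the
  latter.\<close>

definition "energy \<kappa> t = \<epsilon> * I (s t) (s t) + k t * I (B (v t)) (v t)
  + \<kappa> * ((1 + t) powr (- p) * (1 + t) powr (- p) * I (v t) (v t) / 2
         + \<epsilon> * (1 + t) powr (- p) * I (s t) (v t))"

text \<open>Young's inequality with parameter \<epsilon> uses up exactly the summand b^2 |v|^2 / 2
  and leaves a loss \<kappa> \<epsilon>^2 |s|^2 / 2, which is at most half of the kinetic term when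
  \<kappa> \<epsilon> \<le> 1.\<close>

lemma energy_ge:
  assumes t: "0 \<le> t" and \<kappa>: "0 \<le> \<kappa>" "\<kappa> * \<epsilon> \<le> 1"
  shows "\<epsilon> * I (s t) (s t) / 2 + \<mu> * I (B (v t)) (v t) \<le> energy \<kappa> t"
proof -
  let ?b = "(1 + t) powr (- p)"
  have "\<bar>I (s t) (?b *\<^sub>R v t)\<bar> \<le> (\<epsilon> * I (s t) (s t) + I (?b *\<^sub>R v t) (?b *\<^sub>R v t) / \<epsilon>) / 2"
    by (rule I_young[OF \<epsilon>_pos])
  then have "- (\<epsilon> * (?b * I (s t) (v t))) \<le> \<epsilon> * ((\<epsilon> * I (s t) (s t) + ?b * ?b * I (v t) (v t) / \<epsilon>) / 2)"
    using \<epsilon>_pos unfolding mult_minus_right[symmetric] by (intro mult_left_mono) (auto simp: I_simps mult.assoc)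
  moreover have "\<epsilon> * ((\<epsilon> * I (s t) (s t) + ?b * ?b * I (v t) (v t) / \<epsilon>) / 2)
      = \<epsilon> * (\<epsilon> * I (s t) (s t)) / 2 + ?b * ?b * I (v t) (v t) / 2"
    using \<epsilon>_pos by (simp add: field_simps)
  ultimately have "- (\<epsilon> * ?b * I (s t) (v t)) \<le> \<epsilon> * (\<epsilon> * I (s t) (s t)) / 2 + ?b * ?b * I (v t) (v t) / 2"
    by (simp add: mult.assoc)
  then have "- (\<epsilon> * (\<epsilon> * I (s t) (s t)) / 2) \<le> ?b * ?b * I (v t) (v t) / 2 + \<epsilon> * ?b * I (s t) (v t)"
    by linarith
  then have 1: "\<kappa> * - (\<epsilon> * (\<epsilon> * I (s t) (s t)) / 2) \<le> \<kappa> * (?b * ?b * I (v t) (v t) / 2 + \<epsilon> * ?b * I (s t) (v t))"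
    by (rule mult_left_mono) (rule \<kappa>)
  have "(\<kappa> * \<epsilon>) * (\<epsilon> * I (s t) (s t)) \<le> 1 * (\<epsilon> * I (s t) (s t))"
    using \<kappa> \<epsilon>_pos I_nonneg[of "s t"] by (intro mult_right_mono) auto
  moreover have "\<mu> * I (B (v t)) (v t) \<le> k t * I (B (v t)) (v t)"
    using k_bounds[OF t] B_nonneg by (intro mult_right_mono) auto
  ultimately show ?thesis using 1 unfolding energy_def by (simp add: algebra_simps)
qed

lemma energy_0: "energy \<kappa> 0 = 0"
  using I_simps B_simps linear by (simp add: energy_def v_0 s_0 bounded_bilinear.zero_left[OF bilinear]
      bounded_bilinear.zero_right[OF bilinear])

text \<open>Two cancellations: k <B v, s> between the kinetic and the potential part, and b^2 <s, v>
  inside the bracket. The terms with \<open>e\<close> are due to the boundary layer v' - s = e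
  w.\<close>

lemma energy_deriv:
  assumes t: "0 \<le> t"
  defines "b \<equiv> (1 + t) powr (- p)" and "b' \<equiv> - p * (1 + t) powr (- p - 1)"
    and "e \<equiv> exp (- damping_primitive p t / \<epsilon>)"
  shows "(energy \<kappa> has_real_derivative
     - 2 * b * I (s t) (s t) + 2 * I (g t) (s t) + k' t * I (B (v t)) (v t)
     + 2 * (k t * e * I (B (v t)) w)
     + \<kappa> * (b * b' * I (v t) (v t) + b * b * e * I (v t) w + \<epsilon> * b' * I (s t) (v t)
          - b * k t * I (B (v t)) (v t) + b * I (g t) (v t) + \<epsilon> * b * I (s t) (s t)
          + \<epsilon> * b * e * I (s t) w)) (at t within {0..})"
proof -
  note d = powr_half_line_deriv[OF t, of "- p", folded b_def b'_def]
  note sv = s_deriv[OF t] v_deriv[OF t, folded e_def]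
  let ?v' = "s t + e *\<^sub>R w"
  have 1: "(energy \<kappa> has_real_derivative
      \<epsilon> * (I (s t) (s' t) + I (s' t) (s t))
      + (k' t * I (B (v t)) (v t) + (I (B (v t)) ?v' + I (B ?v') (v t)) * k t)
      + \<kappa> * (((b' * b + b' * b) * I (v t) (v t) + (I (v t) ?v' + I ?v' (v t)) * (b * b)) / 2
           + ((\<epsilon> * b') * I (s t) (v t) + (I (s t) ?v' + I (s' t) (v t)) * (\<epsilon> * b)))) (at t within {0..})"
    unfolding energy_def b_def
    by (intro DERIV_add DERIV_cmult DERIV_mult DERIV_cdivide d[unfolded b_def b'_def]
        I_deriv B_vector_derivative sv k_deriv[OF t] 
        | (rule d[unfolded b_def b'_def, folded b'_def]))+
  show ?thesis
  proof (rule DERIV_cong[OF 1], goal_cases)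
    case 1
    have a: "\<epsilon> * I (s' t) (s t) = - b * I (s t) (s t) - k t * I (B (v t)) (s t) + I (g t) (s t)"
      and c: "\<epsilon> * I (s' t) (v t) = - b * I (s t) (v t) - k t * I (B (v t)) (v t) + I (g t) (v t)"
      unfolding b_def by (rule s_eq_g[OF t])+
    have "I (B (s t)) (v t) = I (B (v t)) (s t)" "I (B w) (v t) = I (B (v t)) w"
      using I_sym I_commute by metis+
    moreover have "I w (v t) = I (v t) w" "I (s t) (s' t) = I (s' t) (s t)" "I (v t) (s t) = I (s t) (v t)"
      by (rule I_commute)+
    moreover have "\<epsilon> * (I (s' t) (s t) + I (s' t) (s t)) = 2 * (- b * I (s t) (s t) - k t * I (B (v t)) (s t) + I (g t) (s t))"
      using a by simp
    moreover have "\<kappa> * b * (\<epsilon> * I (s' t) (v t)) = \<kappa> * b * (- b * I (s t) (v t) - k t * I (B (v t)) (v t) + I (g t) (v t))"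
      using c by simp
    ultimately show ?case
      by (simp add: I_simps B_simps algebra_simps add_divide_distrib)
  qed
qed

text \<open>A weight growing no faster than \<beta> b is harmless for most of the energy: a large
  \<kappa> absorbs the potential part and a small \<epsilon> the rest. The exception is \<kappa> b^2
  |v|^2 / 2, which scales with \<kappa> like the dissipation itself. For it the growth bound q (1 +
  t)^p is used, and \<open>d\<close> is the coercivity that survives.\<close>

lemma energy_dissipation:
  assumes t: "0 \<le> t" and \<kappa>: "0 < \<kappa>" and q: "0 \<le> q" "q < 2 * \<mu> * \<nu>" and \<beta>: "0 \<le> \<beta>"
  defines "d \<equiv> \<mu> - q / (2 * \<nu>)"
  assumes \<kappa>_ge: "M4 + \<beta> * M3 \<le> \<kappa> * d / 2"
    and \<epsilon>1: "\<epsilon> \<le> 1" and \<epsilon>2: "\<epsilon> * (\<beta> + 1) \<le> \<nu> * d / 2"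
    and \<epsilon>3: "\<epsilon> * (\<beta> + \<kappa> * \<beta> / 2 + 3 * \<kappa> / 2) \<le> 1 / 2" and \<epsilon>4: "\<kappa> * \<epsilon> \<le> 1"
    and W: "(W has_real_derivative W') (at t within {0..})" and W0: "0 < W t" "0 \<le> W'"
    and W1: "W' \<le> \<beta> * (1 + t) powr (- p) * W t" and W2: "W' \<le> q * (1 + t) powr p * W t"
  defines "e \<equiv> exp (- damping_primitive p t / \<epsilon>)"
  obtains D where "((\<lambda>t. W t * energy \<kappa> t) has_real_derivative D) (at t within {0..})"
    "D \<le> W t * ((2 + \<kappa> / (\<nu> * d)) * ((1 + t) powr p * I (g t) (g t))
        + e / \<epsilon> * (((M3 + \<kappa> / (2 * \<nu>)) / \<mu> + \<kappa>) * (\<epsilon> * I (s t) (s t) / 2 + \<mu> * I (B (v t)) (v t)))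
        + e * \<epsilon> * (M3 * I (B w) w + \<kappa> * I w w))"
proof
  define b where "b = (1 + t) powr (- p)"
  define R where "R = (1 + t) powr p"
  define b' where "b' = - p * (1 + t) powr (- p - 1)"
  \<comment> \<open>The logarithmic derivative of the weight; after division by \<open>W t\<close>
    only \<open>\<omega> * energy \<kappa> t + F'\<close> has to be estimated.\<close>
  define \<omega> where "\<omega> = W' / W t"
  define Ns where "Ns = I (s t) (s t)"
  define Nv where "Nv = I (v t) (v t)"
  define av where "av = I (B (v t)) (v t)"
  define Ng where "Ng = I (g t) (g t)"
  define Nw where "Nw = I w w"
  define aw where "aw = I (B w) w"
  define F' where "F' = - 2 * b * Ns + 2 * I (g t) (s t) + k' t * av
     + 2 * (k t * e * I (B (v t)) w)
     + \<kappa> * (b * b' * Nv + b * b * e * I (v t) w + \<epsilon> * b' * I (s t) (v t)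
          - b * k t * av + b * I (g t) (v t) + \<epsilon> * b * Ns
          + \<epsilon> * b * e * I (s t) w)"
  note N_defs = Ns_def Nv_def av_def Ng_def Nw_def aw_def
  have b0: "0 < b" "b \<le> 1" and Rb: "R * b = 1" and R0: "0 < R" and eR: "R = 1 / b"
    using t p powr_mono[of "- p" 0 "1 + t"] unfolding b_def R_def by (auto simp: powr_minus field_simps)
  have b'0: "b' \<le> 0" "\<bar>b'\<bar> \<le> b"
  proof -
    show "b' \<le> 0" unfolding b'_def using p by simp
    have "p * (1 + t) powr (- p - 1) \<le> 1 * (1 + t) powr (- p)"
      using p t by (intro mult_mono powr_mono) auto
    then show "\<bar>b'\<bar> \<le> b" using p unfolding b'_def b_def by (simp add: abs_mult)
  qed
  have d0: "0 < d" unfolding d_def using q \<nu>_pos by (simp add: field_simps)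
  have e0: "0 < e" unfolding e_def by simp
  have N0: "0 \<le> Ns" "0 \<le> Nv" "0 \<le> av" "0 \<le> Ng" "0 \<le> Nw" "0 \<le> aw"
    unfolding N_defs by (rule I_nonneg B_nonneg)+
  have M3: "0 \<le> M3" using k_bounds[OF t] \<mu>_pos by auto
  have kb: "\<mu> \<le> k t" "k t \<le> M3" "0 \<le> k t" using k_bounds[OF t] \<mu>_pos by auto
  have Nv: "Nv \<le> av / \<nu>" unfolding N_defs by (rule I_le_B)
  have \<omega>: "0 \<le> \<omega>" "\<omega> \<le> \<beta> * b" "\<omega> \<le> q * R"
    using W0 W1 W2 by (auto simp: \<omega>_def b_def R_def field_simps)
  have sv: "\<bar>I (s t) (v t)\<bar> \<le> (Ns + Nv) / 2" unfolding N_defs using I_young[of 1] by simp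
  have i1: "\<omega> * (\<epsilon> * Ns) \<le> \<beta> * b * (\<epsilon> * Ns)"
    using \<omega> N0 \<epsilon>_pos by (intro mult_right_mono) auto
  have i2: "\<omega> * (k t * av) \<le> \<beta> * b * (M3 * av)"
    using \<omega> N0 kb \<beta> b0 by (intro mult_mono) auto
  \<comment> \<open>The place where \<omega> \<le> q R enters: R b = 1 turns \<omega> b^2 into q b,
    the weight of the available dissipation.\<close>
  have "\<omega> * (b * b * Nv / 2) \<le> (q * R) * (b * b * Nv / 2)"
    using \<omega> N0 b0 by (intro mult_right_mono) auto
  also have "\<dots> = (R * b) * (q * b * Nv / 2)" by (simp add: mult_ac)
  also have "\<dots> = q * b * Nv / 2" unfolding Rb by simp
  also have "\<dots> \<le> q * b * (av / \<nu>) / 2" using q b0 Nv by (intro divide_right_mono mult_left_mono) auto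
  finally have i3: "\<kappa> * (\<omega> * (b * b * Nv / 2)) \<le> \<kappa> * (q * b * (av / \<nu>) / 2)"
    using \<kappa> by (intro mult_left_mono) auto
  have "b * I (s t) (v t) \<le> 1 * ((Ns + Nv) / 2)"
    using b0 sv N0 by (intro order_trans[OF mult_left_mono[OF abs_le_D1[OF sv]] mult_right_mono]) auto
  then have "\<omega> * (b * I (s t) (v t)) \<le> \<omega> * ((Ns + Nv) / 2)" using \<omega> by (intro mult_left_mono) auto
  also have "\<dots> \<le> \<beta> * b * ((Ns + Nv) / 2)" using \<omega> N0 by (intro mult_right_mono) auto
  also have "\<dots> \<le> \<beta> * b * ((Ns + av / \<nu>) / 2)"
    using \<beta> b0 Nv by (auto intro!: mult_left_mono)
  finally have i4: "\<kappa> * \<epsilon> * (\<omega> * (b * I (s t) (v t))) \<le> \<kappa> * \<epsilon> * (\<beta> * b * ((Ns + av / \<nu>) / 2))"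
    using \<kappa> \<epsilon>_pos by (intro mult_left_mono) auto
  have j1: "2 * I (g t) (s t) \<le> b * Ns / 2 + 2 * (R * Ng)"
    using abs_le_D1[OF I_young[of "b / 2" "s t" "g t"]] b0 I_commute[of "s t" "g t"]
    by (simp add: N_defs eR field_simps)
  have j2: "k' t * av \<le> M4 * b * av"
    using k'_bound[OF t] N0 unfolding b_def by (intro mult_right_mono) auto
  \<comment> \<open>The parameter 1 / \<epsilon> matches the duration \<epsilon> of the layer: e /
    \<epsilon> has a bounded integral and may multiply the energy, while \<epsilon> e, multiplying
    the data, integrates to order \<epsilon>^2.\<close>
  have "2 * (k t * e * I (B (v t)) w) \<le> 2 * (k t * e * ((1 / \<epsilon> * av + aw / (1 / \<epsilon>)) / 2))"
    using B_young[of "1 / \<epsilon>" "v t" w] \<epsilon>_pos kb e0 unfolding N_defs by (intro mult_left_mono) auto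
  also have "\<dots> \<le> 2 * (M3 * e * ((1 / \<epsilon> * av + aw / (1 / \<epsilon>)) / 2))"
    using \<epsilon>_pos kb e0 N0 by (intro mult_left_mono mult_right_mono) auto
  also have "\<dots> = e / \<epsilon> * (M3 * av) + e * \<epsilon> * (M3 * aw)"
    using \<epsilon>_pos by (simp add: field_simps)
  finally have j3: "2 * (k t * e * I (B (v t)) w) \<le> e / \<epsilon> * (M3 * av) + e * \<epsilon> * (M3 * aw)" .
  have j4: "\<kappa> * (b * b' * Nv) \<le> 0"
    using mult_nonneg_nonpos[OF less_imp_le[OF \<kappa>] mult_nonpos_nonneg[OF mult_nonneg_nonpos[OF less_imp_le[OF b0(1)] b'0(1)] N0(2)]] .
  have "b * b * e * I (v t) w \<le> b * b * e * ((1 / \<epsilon> * Nv + Nw / (1 / \<epsilon>)) / 2)"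
    using I_young[of "1 / \<epsilon>" "v t" w] \<epsilon>_pos b0 e0 unfolding N_defs by (intro mult_left_mono) auto
  also have "\<dots> \<le> 1 * e * ((1 / \<epsilon> * (av / \<nu>) + Nw / (1 / \<epsilon>)) / 2)"
    using \<epsilon>_pos b0 e0 N0 Nv mult_le_one[of b b] by (intro mult_mono divide_right_mono add_mono) auto
  also have "\<dots> = e / \<epsilon> * (av / (2 * \<nu>)) + e * \<epsilon> * (Nw / 2)"
    using \<epsilon>_pos by (simp add: field_simps)
  finally have j5: "\<kappa> * (b * b * e * I (v t) w) \<le> \<kappa> * (e / \<epsilon> * (av / (2 * \<nu>)) + e * \<epsilon> * (Nw / 2))"
    using \<kappa> by (intro mult_left_mono) auto
  have "b' * I (s t) (v t) \<le> \<bar>b'\<bar> * \<bar>I (s t) (v t)\<bar>"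
    using abs_ge_self[of "b' * I (s t) (v t)"] by (simp add: abs_mult)
  also have "\<dots> \<le> b * ((Ns + Nv) / 2)" using b0 by (intro mult_mono b'0 sv) auto
  finally have "\<epsilon> * (b' * I (s t) (v t)) \<le> \<epsilon> * (b * ((Ns + Nv) / 2))"
    using \<epsilon>_pos by (intro mult_left_mono) auto
  also have "\<dots> \<le> \<epsilon> * (b * ((Ns + av / \<nu>) / 2))"
    using \<epsilon>_pos b0 Nv by (auto intro!: mult_left_mono)
  finally have j6: "\<kappa> * (\<epsilon> * b' * I (s t) (v t)) \<le> \<kappa> * (\<epsilon> * (b * ((Ns + av / \<nu>) / 2)))"
    using \<kappa> by (simp add: mult.assoc)
  have gv: "I (g t) (v t) \<le> \<nu> * d / 4 * Nv + Ng / (\<nu> * d)"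
    using I_young[of "\<nu> * d / 2" "v t" "g t"] \<nu>_pos d0 I_commute[of "v t" "g t"] by (simp add: N_defs)
  have "\<nu> * d / 4 * Nv \<le> \<nu> * d / 4 * (av / \<nu>)" using \<nu>_pos d0 Nv by (intro mult_left_mono) auto
  then have gv: "I (g t) (v t) \<le> d / 4 * av + Ng / (\<nu> * d)"
    using gv \<nu>_pos by (simp add: field_simps)
  have "b * I (g t) (v t) \<le> b * (d / 4 * av) + b * (Ng / (\<nu> * d))"
    using mult_left_mono[OF gv, of b] b0 by (simp add: algebra_simps)
  also have "b * (Ng / (\<nu> * d)) \<le> R * (Ng / (\<nu> * d))"
    using N0 \<nu>_pos d0 b0 by (intro mult_right_mono) (auto simp: eR pos_le_divide_eq mult_le_one)
  finally have j7: "\<kappa> * (b * I (g t) (v t)) \<le> \<kappa> * (b * (d / 4 * av) + R * (Ng / (\<nu> * d)))"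
    using \<kappa> by simp
  have "I (s t) w \<le> (1 / \<epsilon> * Ns + Nw / (1 / \<epsilon>)) / 2"
    using I_young[of "1 / \<epsilon>" "s t" w] \<epsilon>_pos unfolding N_defs by auto
  then have "\<epsilon> * b * e * I (s t) w \<le> \<epsilon> * b * e * ((1 / \<epsilon> * Ns + Nw / (1 / \<epsilon>)) / 2)"
    using b0 e0 \<epsilon>_pos by (intro mult_left_mono) auto
  also have "\<dots> = b * (e * ((Ns + \<epsilon> * \<epsilon> * Nw) / 2))" using \<epsilon>_pos by (simp add: field_simps)
  also have "\<dots> \<le> 1 * (e * ((Ns + 1 * \<epsilon> * Nw) / 2))"
    using b0 e0 \<epsilon>_pos N0 \<epsilon>1 by (intro mult_mono divide_right_mono add_mono) auto
  also have "\<dots> = e / \<epsilon> * (\<epsilon> * Ns / 2) + e * \<epsilon> * (Nw / 2)" using \<epsilon>_pos by (simp add: field_simps)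
  finally have j9: "\<kappa> * (\<epsilon> * b * e * I (s t) w) \<le> \<kappa> * (e / \<epsilon> * (\<epsilon> * Ns / 2) + e * \<epsilon> * (Nw / 2))"
    using \<kappa> by simp
  have j10: "\<kappa> * (b * \<mu> * av) \<le> \<kappa> * (b * k t * av)"
    using \<kappa> b0 kb N0 by (intro mult_left_mono mult_right_mono) auto
  \<comment> \<open>The budget. Of the damping 2 b |s|^2 the forcing takes 1/2 and \<open>k1\<close>
    another 1/2. Of \<kappa> d b <B v, v>, \<open>k2\<close> takes 1/2, \<open>k3\<close> takes 1/4
    and the forcing in \<open>j7\<close> the remaining 1/4.\<close>
  have k1: "(\<epsilon> * (\<beta> + \<kappa> * \<beta> / 2 + 3 * \<kappa> / 2)) * (b * Ns) \<le> 1 / 2 * (b * Ns)"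
    using \<epsilon>3 b0 N0 by (intro mult_right_mono) auto
  have k2: "(M4 + \<beta> * M3) * (b * av) \<le> (\<kappa> * d / 2) * (b * av)"
    using \<kappa>_ge b0 N0 by (intro mult_right_mono) auto
  have "(\<epsilon> * (\<beta> + 1)) * (\<kappa> * b * av / (2 * \<nu>)) \<le> (\<nu> * d / 2) * (\<kappa> * b * av / (2 * \<nu>))"
    using \<epsilon>2 b0 N0 \<kappa> \<nu>_pos by (intro mult_right_mono) auto
  moreover have "(\<epsilon> * (\<beta> + 1)) * (\<kappa> * b * av / (2 * \<nu>))
      = \<epsilon> * \<beta> * \<kappa> * (b * (av / \<nu>)) / 2 + \<epsilon> * \<kappa> * (b * (av / \<nu>)) / 2"
    by (simp add: field_simps add_divide_distrib)
  moreover have "(\<nu> * d / 2) * (\<kappa> * b * av / (2 * \<nu>)) = d * \<kappa> * (b * av) / 4"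
    using \<nu>_pos by (simp add: field_simps)
  ultimately have k3: "\<epsilon> * \<beta> * \<kappa> * (b * (av / \<nu>)) / 2 + \<epsilon> * \<kappa> * (b * (av / \<nu>)) / 2 \<le> d * \<kappa> * (b * av) / 4"
    by linarith
  have dd: "\<kappa> * (b * \<mu> * av) = \<kappa> * d * (b * av) + \<kappa> * (q * b * (av / \<nu>) / 2)"
    unfolding d_def using \<nu>_pos by (simp add: field_simps)
  have bN: "0 \<le> b * Ns" using b0 N0 by simp
  define G where "G = e / \<epsilon> * (M3 * av) + e * \<epsilon> * (M3 * aw)
      + \<kappa> * (e / \<epsilon> * (av / (2 * \<nu>)) + e * \<epsilon> * (Nw / 2)) + \<kappa> * (e / \<epsilon> * (\<epsilon> * Ns / 2) + e * \<epsilon> * (Nw / 2))"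
  have "\<omega> * energy \<kappa> t + F' \<le> (2 + \<kappa> / (\<nu> * d)) * (R * Ng) + G"
  proof -
    have "\<omega> * energy \<kappa> t = \<omega> * (\<epsilon> * Ns) + \<omega> * (k t * av) + \<kappa> * (\<omega> * (b * b * Nv / 2))
        + \<kappa> * \<epsilon> * (\<omega> * (b * I (s t) (v t)))"
      unfolding energy_def N_defs b_def by (simp add: algebra_simps)
    also have "\<dots> \<le> \<beta> * b * (\<epsilon> * Ns) + \<beta> * b * (M3 * av) + \<kappa> * (q * b * (av / \<nu>) / 2)
        + \<kappa> * \<epsilon> * (\<beta> * b * ((Ns + av / \<nu>) / 2))"
      by (intro add_mono i1 i2 i3 i4)
    finally have A: "\<omega> * energy \<kappa> t \<le> \<dots>" .
    have "F' = - 2 * b * Ns + 2 * I (g t) (s t) + k' t * av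
       + 2 * (k t * e * I (B (v t)) w)
       + \<kappa> * (b * b' * Nv) + \<kappa> * (b * b * e * I (v t) w) + \<kappa> * (\<epsilon> * b' * I (s t) (v t))
            - \<kappa> * (b * k t * av) + \<kappa> * (b * I (g t) (v t)) + \<kappa> * (\<epsilon> * b * Ns)
            + \<kappa> * (\<epsilon> * b * e * I (s t) w)"
      unfolding F'_def by (simp add: algebra_simps)
    also have "\<dots> \<le> - 2 * b * Ns + (b * Ns / 2 + 2 * (R * Ng)) + M4 * b * av
       + (e / \<epsilon> * (M3 * av) + e * \<epsilon> * (M3 * aw))
       + 0 + \<kappa> * (e / \<epsilon> * (av / (2 * \<nu>)) + e * \<epsilon> * (Nw / 2)) + \<kappa> * (\<epsilon> * (b * ((Ns + av / \<nu>) / 2)))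
            - \<kappa> * (b * \<mu> * av) + \<kappa> * (b * (d / 4 * av) + R * (Ng / (\<nu> * d))) + \<kappa> * (\<epsilon> * b * Ns)
            + \<kappa> * (e / \<epsilon> * (\<epsilon> * Ns / 2) + e * \<epsilon> * (Nw / 2))"
      by (intro add_mono diff_mono order_refl j1 j2 j3 j4 j5 j6 j7 j9 j10)
    finally have Bd: "F' \<le> \<dots>" .
    define y where "y = av / \<nu>"
    have ring: "\<beta> * b * (\<epsilon> * Ns) + \<beta> * b * (M3 * av) + \<kappa> * (q * b * y / 2)
        + \<kappa> * \<epsilon> * (\<beta> * b * ((Ns + y) / 2))
       + (- 2 * b * Ns + (b * Ns / 2 + 2 * (R * Ng)) + M4 * b * av
       + (e / \<epsilon> * (M3 * av) + e * \<epsilon> * (M3 * aw))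
       + 0 + \<kappa> * (e / \<epsilon> * (av / (2 * \<nu>)) + e * \<epsilon> * (Nw / 2)) + \<kappa> * (\<epsilon> * (b * ((Ns + y) / 2)))
            - \<kappa> * (b * \<mu> * av) + \<kappa> * (b * (d / 4 * av) + R * (Ng / (\<nu> * d))) + \<kappa> * (\<epsilon> * b * Ns)
            + \<kappa> * (e / \<epsilon> * (\<epsilon> * Ns / 2) + e * \<epsilon> * (Nw / 2)))
      = (2 + \<kappa> / (\<nu> * d)) * (R * Ng) + G
        + ((\<epsilon> * (\<beta> + \<kappa> * \<beta> / 2 + 3 * \<kappa> / 2)) * (b * Ns) - 3 / 2 * (b * Ns))
        + ((M4 + \<beta> * M3) * (b * av) - 2 * (\<kappa> * d / 2 * (b * av)) + d * \<kappa> * (b * av) / 4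
           + (\<epsilon> * \<beta> * \<kappa> * (b * y) / 2 + \<epsilon> * \<kappa> * (b * y) / 2))
        + (\<kappa> * d * (b * av) + \<kappa> * (q * b * y / 2) - \<kappa> * (b * \<mu> * av))"
      unfolding G_def by (simp add: algebra_simps add_divide_distrib)
    have "0 \<le> \<kappa> * d / 2 * (b * av)" using \<kappa> d0 b0 N0 by simp
    moreover have "d * \<kappa> * (b * av) / 4 = \<kappa> * d / 2 * (b * av) / 2" by simp
    ultimately show ?thesis
      using add_mono[OF A Bd, folded y_def, unfolded ring] k1 k2 k3[folded y_def] dd[folded y_def] bN by linarith
  qed
  also have "G \<le> e / \<epsilon> * (((M3 + \<kappa> / (2 * \<nu>)) / \<mu> + \<kappa>) * (\<epsilon> * Ns / 2 + \<mu> * av)) + e * \<epsilon> * (M3 * aw + \<kappa> * Nw)"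
  proof -
    let ?m = "(M3 + \<kappa> / (2 * \<nu>)) / \<mu>"
    have m: "0 \<le> ?m" using M3 \<kappa> \<nu>_pos \<mu>_pos by simp
    have "M3 * av + \<kappa> * av / (2 * \<nu>) + \<kappa> * (\<epsilon> * Ns / 2) = ?m * (\<mu> * av) + \<kappa> * (\<epsilon> * Ns / 2)"
      using \<mu>_pos \<nu>_pos by (simp add: field_simps)
    also have "\<dots> \<le> (?m + \<kappa>) * (\<mu> * av) + (?m + \<kappa>) * (\<epsilon> * Ns / 2)"
      using m \<kappa> \<mu>_pos N0 \<epsilon>_pos by (intro add_mono mult_right_mono) auto
    also have "\<dots> = (?m + \<kappa>) * (\<epsilon> * Ns / 2 + \<mu> * av)"
      by (simp only: distrib_left add.commute)
    finally have "M3 * av + \<kappa> * av / (2 * \<nu>) + \<kappa> * (\<epsilon> * Ns / 2) \<le> (?m + \<kappa>) * (\<epsilon> * Ns / 2 + \<mu> * av)" .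
    then have "e / \<epsilon> * (M3 * av + \<kappa> * av / (2 * \<nu>) + \<kappa> * (\<epsilon> * Ns / 2))
        \<le> e / \<epsilon> * ((?m + \<kappa>) * (\<epsilon> * Ns / 2 + \<mu> * av))"
      using e0 \<epsilon>_pos by (intro mult_left_mono) auto
    moreover have "G = e / \<epsilon> * (M3 * av + \<kappa> * av / (2 * \<nu>) + \<kappa> * (\<epsilon> * Ns / 2)) + e * \<epsilon> * (M3 * aw + \<kappa> * Nw)"
      unfolding G_def by (simp add: algebra_simps)
    ultimately show ?thesis by linarith
  qed
  finally have main: "\<omega> * energy \<kappa> t + F' \<le> (2 + \<kappa> / (\<nu> * d)) * (R * Ng)
      + (e / \<epsilon> * (((M3 + \<kappa> / (2 * \<nu>)) / \<mu> + \<kappa>) * (\<epsilon> * Ns / 2 + \<mu> * av)) + e * \<epsilon> * (M3 * aw + \<kappa> * Nw))"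
    by simp
  show "((\<lambda>t. W t * energy \<kappa> t) has_real_derivative W' * energy \<kappa> t + F' * W t) (at t within {0..})"
    using energy_deriv[OF t, of \<kappa>, folded b_def b'_def e_def]
    unfolding F'_def N_defs by (intro DERIV_mult W) auto
  have "W' * energy \<kappa> t + F' * W t = W t * (\<omega> * energy \<kappa> t + F')"
    using W0 by (simp add: \<omega>_def field_simps)
  also have "\<dots> \<le> W t * ((2 + \<kappa> / (\<nu> * d)) * (R * Ng)
      + (e / \<epsilon> * (((M3 + \<kappa> / (2 * \<nu>)) / \<mu> + \<kappa>) * (\<epsilon> * Ns / 2 + \<mu> * av)) + e * \<epsilon> * (M3 * aw + \<kappa> * Nw)))"
    using W0 by (intro mult_left_mono main) auto
  finally show "W' * energy \<kappa> t + F' * W t \<le> W t * ((2 + \<kappa> / (\<nu> * d)) * ((1 + t) powr p * I (g t) (g t))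
        + e / \<epsilon> * (((M3 + \<kappa> / (2 * \<nu>)) / \<mu> + \<kappa>) * (\<epsilon> * I (s t) (s t) / 2 + \<mu> * I (B (v t)) (v t)))
        + e * \<epsilon> * (M3 * I (B w) w + \<kappa> * I w w))"
    by (simp only: N_defs R_def add.assoc)
qed


text \<open>
  All errors are collected in the functional \<open>Z\<close>: the parabolic term absorbs the forcing, and adding
  \<open>\<epsilon>\<^sup>2\<close> makes the boundary layer contribute at most \<open>(C / \<epsilon>) (1 + t) powr (- N) Z\<close> to \<open>Z'\<close> with
  \<open>N = 1 / \<epsilon> - \<beta>\<close>, whose coefficient has an integral that is bounded in \<open>\<epsilon>\<close>.
\<close>

theorem energy_decay:
  fixes V V' W W' :: "real \<Rightarrow> real"
  assumes t: "0 \<le> t" and \<kappa>: "0 < \<kappa>" and q: "0 \<le> q" "q < 2 * \<mu> * \<nu>" and \<beta>: "0 \<le> \<beta>"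
  defines "d \<equiv> \<mu> - q / (2 * \<nu>)"
  assumes \<kappa>_ge: "M4 + \<beta> * M3 \<le> \<kappa> * d / 2"
    and \<epsilon>1: "\<epsilon> * (\<beta> + 1) \<le> 1 / 2" and \<epsilon>2: "\<epsilon> * (\<beta> + 1) \<le> \<nu> * d / 2"
    and \<epsilon>3: "\<epsilon> * (\<beta> + \<kappa> * \<beta> / 2 + 3 * \<kappa> / 2) \<le> 1 / 2" and \<epsilon>4: "\<kappa> * \<epsilon> \<le> 1"
    and W: "\<And>t. 0 \<le> t \<Longrightarrow> (W has_real_derivative W' t) (at t within {0..})"
    and W0: "\<And>t. 0 \<le> t \<Longrightarrow> 0 < W t \<and> 0 \<le> W' t"
    and W1: "\<And>t. 0 \<le> t \<Longrightarrow> W' t \<le> \<beta> * (1 + t) powr (- p) * W t"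
    and W2: "\<And>t. 0 \<le> t \<Longrightarrow> W' t \<le> q * (1 + t) powr p * W t"
    and W3: "\<And>t. 0 \<le> t \<Longrightarrow> W t \<le> K0 * exp (\<beta> * damping_primitive p t)"
    and V: "\<And>t. 0 \<le> t \<Longrightarrow> (V has_real_derivative V' t) (at t within {0..})"
    and V1: "\<And>t. 0 \<le> t \<Longrightarrow> 0 \<le> V t \<and> V' t \<le> q * (1 + t) powr p * V t"
    and WV: "\<And>t. 0 \<le> t \<Longrightarrow> W t * (1 + t) powr (4 * p) \<le> K4 * V t"
    and w: "I w w \<le> Kw" "I (B w) w \<le> Kw" and Y0: "I (B (B (U 0))) (B (U 0)) \<le> KY"
  shows "W t * (\<epsilon> * I (s t) (s t) / 2 + \<mu> * I (B (v t)) (v t))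
    \<le> (forcing_const * (2 + \<kappa> / (\<nu> * d)) * K4 / (2 * d) * V 0 * KY + 1)
      * exp (2 * ((M3 + \<kappa> / (2 * \<nu>)) / \<mu> + \<kappa> + K0 * ((M3 + \<kappa>) * Kw))) * \<epsilon>\<^sup>2"
proof -
  \<comment> \<open>Chosen so that the dissipation 2 d \<eta> \<epsilon>^2 of the parabolic term
    cancels the forcing bound exactly.\<close>
  define \<eta> where "\<eta> = forcing_const * (2 + \<kappa> / (\<nu> * d)) * K4 / (2 * d)"
  define C1 where "C1 = (M3 + \<kappa> / (2 * \<nu>)) / \<mu> + \<kappa>"
  define C2 where "C2 = (M3 + \<kappa>) * Kw"
  define C3 where "C3 = C1 + K0 * C2"
  define N where "N = 1 / \<epsilon> - \<beta>"
  define Z where "Z t = W t * energy \<kappa> t + (\<eta> * \<epsilon>\<^sup>2) * (V t * Y t) + \<epsilon>\<^sup>2" for t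
  \<comment> \<open>A primitive of the coefficient C3 / \<epsilon> (1 + t)^(- N). The condition
    \<epsilon> (\<beta> + 1) \<le> 1/2 says N - 1 \<ge> 1 / (2 \<epsilon>), so that
    \<open>S t - S 0\<close> is at most 2 C3 whatever \<epsilon> is.\<close>
  define S where "S t = - (C3 / \<epsilon>) * ((1 + t) powr (1 - N) / (N - 1))" for t
  have d0: "0 < d" unfolding d_def using q \<nu>_pos by (simp add: field_simps)
  have "\<epsilon> * 1 \<le> \<epsilon> * (\<beta> + 1)" using \<epsilon>_pos \<beta> by (intro mult_left_mono) auto
  then have \<epsilon>_le: "\<epsilon> \<le> 1" using \<epsilon>1 by simp
  have N: "1 / (2 * \<epsilon>) \<le> N - 1" using \<epsilon>1 \<epsilon>_pos by (simp add: N_def field_simps)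
  then have N1: "0 < N - 1" using \<epsilon>_pos by (smt (verit) divide_pos_pos)
  have M3: "0 \<le> M3" using k_bounds[OF order_refl] \<mu>_pos by auto
  have Kw: "0 \<le> Kw" using w(1) I_nonneg[of w] by linarith
  have KY: "0 \<le> KY" using Y0 Y_nonneg[of 0] by (simp add: Y_def)
  have K0: "0 \<le> K0" using W3[of 0] W0[of 0] by simp
  have "0 < K4 * V 0" using WV[of 0] W0[of 0] by simp
  then have K4: "0 < K4" using V1[of 0] by (simp add: zero_less_mult_iff)
  have C1: "0 \<le> C1" and C2: "0 \<le> C2" using M3 \<kappa> \<mu>_pos \<nu>_pos Kw by (auto simp: C1_def C2_def)
  have C3: "0 \<le> C3" using C1 C2 K0 by (simp add: C3_def)
  have \<eta>0: "0 \<le> \<eta>" using forcing_const_nonneg \<kappa> \<nu>_pos d0 K4 by (simp add: \<eta>_def)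
  have Wen: "W t * (\<epsilon> * I (s t) (s t) / 2 + \<mu> * I (B (v t)) (v t)) \<le> Z t - \<epsilon>\<^sup>2" if t: "0 \<le> t" for t
  proof -
    have "W t * (\<epsilon> * I (s t) (s t) / 2 + \<mu> * I (B (v t)) (v t)) \<le> W t * energy \<kappa> t"
      using W0[OF t] energy_ge[OF t _ \<epsilon>4] \<kappa> by (intro mult_left_mono) auto
    moreover have "0 \<le> (\<eta> * \<epsilon>\<^sup>2) * (V t * Y t)" using \<eta>0 V1[OF t] Y_nonneg by simp
    ultimately show ?thesis by (simp add: Z_def)
  qed
  have step: "\<exists>D. (Z has_real_derivative D) (at t within {0..}) \<and> D \<le> C3 / \<epsilon> * (1 + t) powr (- N) * Z t"
    if t: "0 \<le> t" for t
  proof -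
    define \<sigma> where "\<sigma> = (1 + t) powr (- N)"
    define e where "e = exp (- damping_primitive p t / \<epsilon>)"
    define H where "H = \<epsilon> * I (s t) (s t) / 2 + \<mu> * I (B (v t)) (v t)"
    define R where "R = (1 + t) powr p"
    define Q where "Q = I (B (B (U t))) (B (B (U t)))"
    define c0 where "c0 = 2 + \<kappa> / (\<nu> * d)"
    obtain D1 where D1: "((\<lambda>t. W t * energy \<kappa> t) has_real_derivative D1) (at t within {0..})"
      and D1_le: "D1 \<le> W t * (c0 * (R * I (g t) (g t)) + e / \<epsilon> * (C1 * H) + e * \<epsilon> * (M3 * I (B w) w + \<kappa> * I w w))"
      unfolding C1_def H_def R_def c0_def e_def d_def
      by (rule energy_dissipation[OF t \<kappa> q \<beta> \<kappa>_ge[unfolded d_def] \<epsilon>_le \<epsilon>2[unfolded d_def] \<epsilon>3 \<epsilon>4 W[OF t]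
            conjunct1[OF W0[OF t]] conjunct2[OF W0[OF t]] W1[OF t] W2[OF t]])
    obtain D2 where D2: "((\<lambda>t. V t * Y t) has_real_derivative D2) (at t within {0..})"
      and D2_le: "D2 \<le> - (2 * \<mu> - q / \<nu>) * (V t * R * Q)"
      unfolding R_def Q_def
      by (rule weighted_Y_deriv[OF t V[OF t] conjunct1[OF V1[OF t]] conjunct2[OF V1[OF t]] q(1)])
    have pos: "0 < e" "0 < R" "0 \<le> Q" "0 \<le> H" "0 < W t" "0 \<le> V t" "0 < c0" "0 < \<sigma>"
      using t \<epsilon>_pos \<mu>_pos W0[OF t] V1[OF t] d0 \<nu>_pos \<kappa> I_nonneg B_nonneg
      by (auto simp: e_def R_def Q_def H_def c0_def \<sigma>_def intro!: add_pos_nonneg add_nonneg_nonneg)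
    \<comment> \<open>These inequalities are used in the exponents: exp (\<beta> B) e equals exp (-
      N B), and B \<ge> ln (1 + t).\<close>
    have "0 \<le> (1 / \<epsilon>) * (damping_primitive p t - ln (1 + t)) "
      using damping_primitive_ge_ln[OF p(2) t] \<epsilon>_pos by simp
    moreover have "0 \<le> N * (damping_primitive p t - ln (1 + t))"
      using damping_primitive_ge_ln[OF p(2) t] N1 by simp
    moreover have "0 \<le> \<beta> * ln (1 + t)" using \<beta> t by simp
    moreover have "0 \<le> \<beta> * damping_primitive p t" using \<beta> damping_primitive_nonneg[OF p(2) t] by simp
    ultimately have e\<sigma>: "e \<le> \<sigma>" "exp (\<beta> * damping_primitive p t) * e \<le> \<sigma>"
      using t by (simp_all add: e_def \<sigma>_def N_def powr_def exp_add[symmetric] algebra_simps)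
    have "D1 \<le> c0 * R * (W t * I (g t) (g t)) + C1 / \<epsilon> * (e * (W t * H)) + \<epsilon> * ((W t * e) * (M3 * I (B w) w + \<kappa> * I w w))"
      using D1_le by (simp add: algebra_simps)
    \<comment> \<open>This is why two weights are carried: \<open>W\<close> for the energy and the
      larger \<open>V\<close> for the parabolic term, which has to make up for the factor (1 + t)^(4
      p) of the forcing.\<close>
    also have "c0 * R * (W t * I (g t) (g t)) \<le> \<eta> * \<epsilon>\<^sup>2 * (2 * d) * (V t * R * Q)"
    proof -
      have "W t * I (g t) (g t) \<le> W t * (\<epsilon>\<^sup>2 * forcing_const * (1 + t) powr (4 * p) * Q)"
        unfolding Q_def using pos by (intro mult_left_mono g_bound t) auto
      also have "\<dots> = \<epsilon>\<^sup>2 * forcing_const * (W t * (1 + t) powr (4 * p)) * Q" by simp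
      also have "\<dots> \<le> \<epsilon>\<^sup>2 * forcing_const * (K4 * V t) * Q"
        using pos forcing_const_nonneg by (intro mult_left_mono mult_right_mono WV t) auto
      finally have "c0 * R * (W t * I (g t) (g t)) \<le> c0 * R * (\<epsilon>\<^sup>2 * forcing_const * (K4 * V t) * Q)"
        using pos by (intro mult_left_mono) auto
      also have "\<dots> = \<eta> * \<epsilon>\<^sup>2 * (2 * d) * (V t * R * Q)"
        using d0 by (simp add: \<eta>_def c0_def)
      finally show ?thesis .
    qed
    also have "C1 / \<epsilon> * (e * (W t * H)) \<le> C1 / \<epsilon> * (\<sigma> * Z t)"
    proof -
      have "W t * H \<le> Z t" using Wen[OF t] zero_le_power2[of \<epsilon>] unfolding H_def by linarith
      then show ?thesis using C1 \<epsilon>_pos pos e\<sigma> by (intro mult_left_mono mult_mono) auto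
    qed
    also have "\<epsilon> * ((W t * e) * (M3 * I (B w) w + \<kappa> * I w w)) \<le> K0 * C2 / \<epsilon> * (\<sigma> * Z t)"
    proof -
      have "W t * e \<le> (K0 * exp (\<beta> * damping_primitive p t)) * e"
        using W3[OF t] pos by (intro mult_right_mono) auto
      also have "\<dots> \<le> K0 * \<sigma>"
        using e\<sigma> K0 by (simp add: mult.assoc mult_left_mono)
      finally have 1: "W t * e \<le> K0 * \<sigma>" .
      have 2: "M3 * I (B w) w + \<kappa> * I w w \<le> C2"
        using w M3 \<kappa> unfolding C2_def distrib_right by (intro add_mono mult_left_mono) auto
      have "\<epsilon> * ((W t * e) * (M3 * I (B w) w + \<kappa> * I w w)) \<le> \<epsilon> * ((K0 * \<sigma>) * C2)"
        using \<epsilon>_pos pos K0 M3 \<kappa> I_nonneg B_nonneg by (intro mult_left_mono mult_mono 1 2) auto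
      also have "\<dots> = K0 * C2 / \<epsilon> * (\<sigma> * \<epsilon>\<^sup>2)" using \<epsilon>_pos by (simp add: power2_eq_square)
      also have "\<dots> \<le> K0 * C2 / \<epsilon> * (\<sigma> * Z t)"
      proof -
        have "0 \<le> W t * H" using pos by simp
        then have "\<epsilon>\<^sup>2 \<le> Z t" using Wen[OF t] unfolding H_def by linarith
        then show ?thesis using K0 C2 \<epsilon>_pos pos by (intro mult_left_mono) auto
      qed
      finally show ?thesis .
    qed
    finally have D1': "D1 \<le> \<eta> * \<epsilon>\<^sup>2 * (2 * d) * (V t * R * Q) + C1 / \<epsilon> * (\<sigma> * Z t) + K0 * C2 / \<epsilon> * (\<sigma> * Z t)"
      by simp
    have "2 * \<mu> - q / \<nu> = 2 * d" unfolding d_def by simp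
    then have "\<eta> * \<epsilon>\<^sup>2 * D2 \<le> \<eta> * \<epsilon>\<^sup>2 * (- (2 * d) * (V t * R * Q))"
      using D2_le \<eta>0 by (intro mult_left_mono) auto
    then have "D1 + \<eta> * \<epsilon>\<^sup>2 * D2 \<le> C3 / \<epsilon> * \<sigma> * Z t"
      using D1' by (simp add: C3_def add_divide_distrib algebra_simps)
    moreover have "(Z has_real_derivative D1 + \<eta> * \<epsilon>\<^sup>2 * D2 + 0) (at t within {0..})"
      unfolding Z_def by (intro DERIV_add D1 DERIV_cmult D2 DERIV_const)
    ultimately show ?thesis unfolding \<sigma>_def by auto
  qed
  then obtain Z' where Z': "\<And>t. 0 \<le> t \<Longrightarrow> (Z has_real_derivative Z' t) (at t within {0..})"
    "\<And>t. 0 \<le> t \<Longrightarrow> Z' t \<le> C3 / \<epsilon> * (1 + t) powr (- N) * Z t" by metis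
  have S': "(S has_real_derivative C3 / \<epsilon> * (1 + t) powr (- N)) (at t within {0..})" if "0 \<le> t" for t
  proof -
    have "(S has_real_derivative - (C3 / \<epsilon>) * (((1 - N) * (1 + t) powr (1 - N - 1)) / (N - 1))) (at t within {0..})"
      unfolding S_def by (intro DERIV_cmult DERIV_cdivide powr_half_line_deriv that)
    moreover have "((1 - N) * x) / (N - 1) = - x" for x
      using N1 minus_diff_eq[of N 1] by (metis less_irrefl minus_divide_left mult_minus_left nonzero_mult_div_cancel_left)
    ultimately show ?thesis by simp
  qed
  have "Z t \<le> Z 0 * exp (S t - S 0)" by (rule gronwall_half_line[OF Z'(1) S' Z'(2) t])
  also have "\<dots> \<le> ((\<eta> * V 0 * KY + 1) * \<epsilon>\<^sup>2) * exp (2 * C3)"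
  proof (intro mult_mono)
    have "\<eta> * V 0 * Y 0 \<le> \<eta> * V 0 * KY"
      using \<eta>0 V1[of 0] Y0 by (intro mult_left_mono) (auto simp: Y_def)
    then have "(\<eta> * V 0 * Y 0 + 1) * \<epsilon>\<^sup>2 \<le> (\<eta> * V 0 * KY + 1) * \<epsilon>\<^sup>2"
      by (intro mult_right_mono) auto
    then show "Z 0 \<le> (\<eta> * V 0 * KY + 1) * \<epsilon>\<^sup>2" by (simp add: Z_def energy_0 algebra_simps)
    have "S t - S 0 \<le> (C3 / \<epsilon>) * (1 / (N - 1))"
      using C3 \<epsilon>_pos N1 t by (simp add: S_def)
    also have "1 / (N - 1) \<le> 2 * \<epsilon>"
      using N N1 \<epsilon>_pos by (simp add: field_simps)
    then have "(C3 / \<epsilon>) * (1 / (N - 1)) \<le> (C3 / \<epsilon>) * (2 * \<epsilon>)"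
      using C3 \<epsilon>_pos by (intro mult_left_mono) auto
    finally show "exp (S t - S 0) \<le> exp (2 * C3)" using \<epsilon>_pos by (simp add: mult.commute)
    show "0 \<le> (\<eta> * V 0 * KY + 1) * \<epsilon>\<^sup>2" using \<eta>0 V1[of 0] KY by simp
  qed auto
  finally have "Z t \<le> (\<eta> * V 0 * KY + 1) * \<epsilon>\<^sup>2 * exp (2 * C3)" .
  moreover have "W t * (\<epsilon> * I (s t) (s t) / 2 + \<mu> * I (B (v t)) (v t)) \<le> Z t"
    using Wen[OF t] zero_le_power2[of \<epsilon>] by linarith
  ultimately show ?thesis unfolding \<eta>_def C3_def C1_def C2_def by (simp add: algebra_simps)
qed

text \<open>Pointwise decay of the parabolic solution by itself. In the energy estimate the forcing
  is absorbed into a dissipation; the velocity estimate needs it bounded at each time.\<close>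

lemma weighted_Y_le:
  fixes V V' :: "real \<Rightarrow> real"
  assumes t: "0 \<le> t" and q: "0 \<le> q" "q < 2 * \<mu> * \<nu>"
    and V: "\<And>t. 0 \<le> t \<Longrightarrow> (V has_real_derivative V' t) (at t within {0..})"
    and V1: "\<And>t. 0 \<le> t \<Longrightarrow> 0 \<le> V t \<and> V' t \<le> q * (1 + t) powr p * V t"
  shows "V t * Y t \<le> V 0 * Y 0"
proof -
  have "\<exists>D. ((\<lambda>t. V t * Y t) has_real_derivative D) (at t within {0..}) \<and> D \<le> 0" if t: "0 \<le> t" for t
  proof -
    obtain D where D: "((\<lambda>t. V t * Y t) has_real_derivative D) (at t within {0..})"
      "D \<le> - (2 * \<mu> - q / \<nu>) * (V t * (1 + t) powr p * I (B (B (U t))) (B (B (U t))))"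
      by (rule weighted_Y_deriv[OF t V[OF t] conjunct1[OF V1[OF t]] conjunct2[OF V1[OF t]] q(1)])
    have "0 \<le> 2 * \<mu> - q / \<nu>" using q \<nu>_pos by (simp add: field_simps)
    then have "- (2 * \<mu> - q / \<nu>) * (V t * (1 + t) powr p * I (B (B (U t))) (B (B (U t)))) \<le> 0"
      using V1[OF t] I_nonneg by (intro mult_nonpos_nonneg) auto
    then show ?thesis using D by (intro exI[of _ D]) linarith
  qed
  then obtain D where "\<And>t. 0 \<le> t \<Longrightarrow> ((\<lambda>t. V t * Y t) has_real_derivative D t) (at t within {0..})"
    "\<And>t. 0 \<le> t \<Longrightarrow> D t \<le> 0" by metis
  from nonincreasing_half_line[OF this t] show ?thesis .
qed

text \<open>In \<epsilon> s' + b s = - k B v + g the velocity relaxes at rate b / \<epsilon> towards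
  a source divided by b, which is why the hypothesis has the factor b^2 on the right. Half of the
  damping is kept after Young's inequality and the growth \<beta> of the weight, since \<beta>
  \<epsilon> \<le> 1/2.\<close>

lemma velocity_decay:
  assumes t: "0 \<le> t" and \<beta>: "0 \<le> \<beta>" "\<beta> * \<epsilon> \<le> 1 / 2"
    and K: "\<And>t. 0 \<le> t \<Longrightarrow> exp (\<beta> * damping_primitive p t) * (M3\<^sup>2 * I (B (v t)) (B (v t)) + I (g t) (g t))
      \<le> K * \<epsilon>\<^sup>2 * ((1 + t) powr (- p))\<^sup>2"
  shows "exp (\<beta> * damping_primitive p t) * I (s t) (s t) \<le> 4 * K * \<epsilon>\<^sup>2"
proof -
  define E where "E t = exp (\<beta> * damping_primitive p t)" for t
  define b where "b t = (1 + t) powr (- p)" for t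
  \<comment> \<open>4 K \<epsilon>^2 is the equilibrium between the remaining damping b / 2 and the
    source 2 K \<epsilon>^2 b; \<open>X\<close> starts at or below 0 and satisfies a linear
    inequality with negative rate.\<close>
  define X where "X t = E t * I (s t) (s t) + - 4 * K * \<epsilon>\<^sup>2" for t
  have X': "(X has_real_derivative
      E t * (I (s t) (s' t) + I (s' t) (s t)) + (exp (\<beta> * damping_primitive p t) * (\<beta> * b t)) * I (s t) (s t) + 0)
      (at t within {0..})"
    if t: "0 \<le> t" for t
    unfolding X_def E_def b_def
    by (intro DERIV_add DERIV_const DERIV_mult' I_deriv s_deriv DERIV_chain2[OF DERIV_exp] DERIV_cmult damping_primitive_deriv t)
  have le: "E t * (I (s t) (s' t) + I (s' t) (s t)) + (exp (\<beta> * damping_primitive p t) * (\<beta> * b t)) * I (s t) (s t) + 0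
      \<le> (- 1 / (2 * \<epsilon>) * b t) * X t" if t: "0 \<le> t" for t
  proof -
    define Ns where "Ns = I (s t) (s t)"
    define Bv where "Bv = I (B (v t)) (B (v t))"
    define Ng where "Ng = I (g t) (g t)"
    have E0: "0 < E t" and b0: "0 < b t" using t by (auto simp: E_def b_def)
    have kb: "0 \<le> k t" "k t \<le> M3" using k_bounds[OF t] \<mu>_pos by auto
    have N0: "0 \<le> Ns" "0 \<le> Bv" unfolding Ns_def Bv_def by (rule I_nonneg)+
    have "\<bar>I (s t) (k t *\<^sub>R B (v t))\<bar> \<le> (b t / 2 * Ns + (k t)\<^sup>2 * Bv / (b t / 2)) / 2"
      using I_young[of "b t / 2" "s t" "k t *\<^sub>R B (v t)"] b0 by (simp add: I_simps Ns_def Bv_def power2_eq_square)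
    also have "\<dots> \<le> (b t / 2 * Ns + M3\<^sup>2 * Bv / (b t / 2)) / 2"
      using kb b0 N0 by (intro divide_right_mono add_left_mono mult_right_mono power_mono) auto
    finally have 1: "- (2 * (k t * I (B (v t)) (s t))) \<le> b t * Ns / 2 + 2 * M3\<^sup>2 * Bv / b t"
      using I_commute[of "s t" "B (v t)"] b0 by (simp add: I_simps abs_le_iff field_simps)
    have 2: "2 * I (g t) (s t) \<le> b t * Ns / 2 + 2 * Ng / b t"
      using abs_le_D1[OF I_young[of "b t / 2" "s t" "g t"]] b0 I_commute[of "s t" "g t"]
      by (simp add: Ns_def Ng_def field_simps)
    have "2 * (\<epsilon> * I (s' t) (s t)) = - 2 * b t * Ns - 2 * (k t * I (B (v t)) (s t)) + 2 * I (g t) (s t)"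
      unfolding s_eq_g[OF t] b_def Ns_def by simp
    also have "\<dots> \<le> - b t * Ns + 2 / b t * (M3\<^sup>2 * Bv + Ng)"
      using 1 2 by (simp add: algebra_simps add_divide_distrib)
    finally have "E t * (2 * (\<epsilon> * I (s' t) (s t))) \<le> E t * (- b t * Ns + 2 / b t * (M3\<^sup>2 * Bv + Ng))"
      using E0 by (intro mult_left_mono) auto
    also have "\<dots> = - b t * (E t * Ns) + 2 / b t * (E t * (M3\<^sup>2 * Bv + Ng))"
      by (simp add: algebra_simps)
    also have "\<dots> \<le> - b t * (E t * Ns) + 2 / b t * (K * \<epsilon>\<^sup>2 * (b t)\<^sup>2)"
      using K[OF t] b0 unfolding E_def b_def Bv_def Ng_def by (intro add_left_mono mult_left_mono) auto
    also have "\<dots> = - b t * (E t * Ns) + 2 * K * \<epsilon>\<^sup>2 * b t" using b0 by (simp add: power2_eq_square)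
    finally have 3: "E t * (2 * (\<epsilon> * I (s' t) (s t))) \<le> - b t * (E t * Ns) + 2 * K * \<epsilon>\<^sup>2 * b t" .
    have "(\<beta> * \<epsilon>) * (b t * (E t * Ns)) \<le> 1 / 2 * (b t * (E t * Ns))"
      using \<beta> b0 E0 N0 by (intro mult_right_mono) auto
    then have "\<epsilon> * (E t * (2 * I (s' t) (s t)) + E t * (\<beta> * b t) * Ns) \<le> - 1 / 2 * b t * (E t * Ns + - 4 * K * \<epsilon>\<^sup>2)"
      using 3 by (simp add: algebra_simps)
    also have "\<dots> = \<epsilon> * ((- 1 / (2 * \<epsilon>) * b t) * X t)" using \<epsilon>_pos by (simp add: X_def Ns_def)
    finally have "E t * (2 * I (s' t) (s t)) + E t * (\<beta> * b t) * Ns \<le> (- 1 / (2 * \<epsilon>) * b t) * X t"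
      using \<epsilon>_pos by (rule mult_left_le_imp_le)
    then show ?thesis using I_commute[of "s t" "s' t"] unfolding E_def Ns_def by simp
  qed
  have "0 \<le> exp (\<beta> * damping_primitive p 0) * (M3\<^sup>2 * I (B (v 0)) (B (v 0)) + I (g 0) (g 0))"
    using I_nonneg by simp
  also have "\<dots> \<le> K * \<epsilon>\<^sup>2" using K[of 0] by simp
  finally have K0: "0 \<le> K * \<epsilon>\<^sup>2" .
  have "X t \<le> X 0 * exp (- 1 / (2 * \<epsilon>) * damping_primitive p t - - 1 / (2 * \<epsilon>) * damping_primitive p 0)"
  proof (rule gronwall_half_line[OF X' _ le t])
    show "((\<lambda>t. - 1 / (2 * \<epsilon>) * damping_primitive p t) has_real_derivative - 1 / (2 * \<epsilon>) * b t) (at t within {0..})"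
      if "0 \<le> t" for t unfolding b_def by (intro DERIV_cmult damping_primitive_deriv that)
  qed
  also have "\<dots> \<le> 0"
    using K0 by (intro mult_nonpos_nonneg) (auto simp: X_def s_0 bounded_bilinear.zero_left[OF bilinear])
  finally show ?thesis by (simp add: X_def E_def)
qed

end

text \<open>
  For \<open>p > 0\<close> the factor \<open>(1 + t) powr p\<close> beats any fixed rate \<open>L\<close> from some time on, and adding a large
  constant to the weight takes care of the time before. This is why \<open>\<beta>\<close> is restricted only when \<open>p = 0\<close>.
\<close>

lemma parabolic_weight:
  fixes f :: "real \<Rightarrow> real"
  assumes pq: "0 < p" "0 < q" and L: "0 \<le> L"
    and f: "\<And>t. 0 \<le> t \<Longrightarrow> (f has_real_derivative f' t) (at t within {0..})"
    and f': "\<And>t. 0 \<le> t \<Longrightarrow> f' t \<le> L * f t" and f0: "\<And>t. 0 \<le> t \<Longrightarrow> 0 \<le> f t"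
  obtains K where "0 \<le> K" "\<forall>t\<ge>0. f' t \<le> q * (1 + t) powr p * (K + f t)"
proof
  \<comment> \<open>From \<open>T\<close> on, q (1 + t)^p exceeds L. Before \<open>T\<close>,
    Gronwall bounds L f by L f(0) exp (L T), and \<open>K\<close> is this bound divided by
    q.\<close>
  define T where "T = (L / q) powr (1 / p)"
  define K where "K = L * (f 0 * exp (L * T)) / q"
  show K0: "0 \<le> K" unfolding K_def using L f0[of 0] pq by simp
  show "\<forall>t\<ge>0. f' t \<le> q * (1 + t) powr p * (K + f t)"
  proof (intro allI impI)
    fix t :: real assume t: "0 \<le> t"
    show "f' t \<le> q * (1 + t) powr p * (K + f t)"
    proof (cases "t \<le> T")
      case True
      have "f t \<le> f 0 * exp (L * t - L * 0)"
        by (rule gronwall_half_line[OF f _ f' t]) (auto intro!: derivative_eq_intros)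
      also have "\<dots> \<le> f 0 * exp (L * T)"
        using True L f0[of 0] by (intro mult_left_mono) (auto intro: mult_left_mono)
      finally have "f' t \<le> L * (f 0 * exp (L * T))"
        using f'[OF t] L by (meson mult_left_mono order_trans)
      also have "\<dots> = q * 1 * (K + 0)" using pq by (simp add: K_def)
      also have "\<dots> \<le> q * (1 + t) powr p * (K + f t)"
        using K0 f0[OF t] pq t by (intro mult_mono) (auto intro: ge_one_powr_ge_zero)
      finally show ?thesis .
    next
      case False
      have "L / q = T powr p"
        using pq L by (cases "L = 0") (auto simp: T_def powr_powr)
      also have "\<dots> \<le> (1 + t) powr p"
        using False pq t by (intro powr_mono2) (auto simp: T_def)
      finally have "L \<le> q * (1 + t) powr p" using pq by (simp add: field_simps)
      then have "L * f t \<le> q * (1 + t) powr p * f t" using f0[OF t] by (intro mult_right_mono)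
      also have "\<dots> \<le> q * (1 + t) powr p * (K + f t)"
        using K0 pq by (intro mult_left_mono) auto
      finally show ?thesis using f'[OF t] by linarith
    qed
  qed
qed

section \<open>Estimates whose constants depend neither on the operator nor on \<epsilon>\<close>

context
  fixes p \<beta> \<mu> \<nu> :: real
  assumes p: "0 \<le> p" "p \<le> 1" and \<beta>: "0 \<le> \<beta>" and \<mu>: "0 < \<mu>" and \<nu>: "0 < \<nu>"
    and p0: "p = 0 \<Longrightarrow> \<beta> < 2 * \<mu> * \<nu>"
begin

lemma exp_damping_primitive_deriv:
  assumes "0 \<le> t"
  shows "((\<lambda>t. exp (\<beta> * damping_primitive p t)) has_real_derivative
    exp (\<beta> * damping_primitive p t) * (\<beta> * (1 + t) powr (- p))) (at t within X)"
  by (intro DERIV_chain2[OF DERIV_exp] DERIV_cmult damping_primitive_deriv assms)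

text \<open>The weights are W = K + exp (\<beta> B) and V = K' + exp (L t). In the exponent 6 p, 4 p
  serves the forcing and 2 p the division by b^2 in the velocity estimate; L = \<beta> + 6 works
  because B \<le> t and (1 + t)^6 \<le> exp (6 t). For p = 0 there is nothing to gain: q = L =
  \<beta> and no added constants. For p > 0 any q below 2 \<mu> \<nu> would do, and \<mu> \<nu> is
  taken.\<close>

lemma decay_weights:
  obtains q K K' L where "0 \<le> q" "q < 2 * \<mu> * \<nu>" "0 \<le> K" "0 \<le> K'"
    "\<forall>t\<ge>0. exp (\<beta> * damping_primitive p t) * (\<beta> * (1 + t) powr (- p))
        \<le> q * (1 + t) powr p * (K + exp (\<beta> * damping_primitive p t))"
    "\<forall>t\<ge>0. exp (L * t) * L \<le> q * (1 + t) powr p * (K' + exp (L * t))"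
    "\<forall>t\<ge>0. exp (\<beta> * damping_primitive p t) * (1 + t) powr (6 * p) \<le> exp (L * t)"
proof (cases "p = 0")
  case True
  show ?thesis
    by (rule that[of \<beta> 0 0 \<beta>]) (use True \<beta> p0 in \<open>auto simp: damping_primitive_def\<close>)
next
  case False
  then have p1: "0 < p" using p by simp
  define L where "L = \<beta> + 6"
  have q: "0 < \<mu> * \<nu>" using \<mu> \<nu> by simp
  have L: "0 \<le> L" using \<beta> by (simp add: L_def)
  have f': "exp (\<beta> * damping_primitive p t) * (\<beta> * (1 + t) powr (- p)) \<le> \<beta> * exp (\<beta> * damping_primitive p t)"
    if "0 \<le> t" for t
  proof -
    have "(1 + t) powr (- p) \<le> 1" using that p powr_mono[of "- p" 0 "1 + t"] by simp
    then have "\<beta> * (1 + t) powr (- p) \<le> \<beta>" using \<beta> by (simp add: mult_left_le)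
    then show ?thesis by (simp add: mult.commute mult_left_mono)
  qed
  obtain K where K: "0 \<le> K" "\<forall>t\<ge>0. exp (\<beta> * damping_primitive p t) * (\<beta> * (1 + t) powr (- p))
        \<le> (\<mu> * \<nu>) * (1 + t) powr p * (K + exp (\<beta> * damping_primitive p t))"
    by (rule parabolic_weight[OF p1 q \<beta> exp_damping_primitive_deriv f' exp_ge_zero])
  have d: "((\<lambda>t. exp (L * t)) has_real_derivative exp (L * t) * L) (at t within X)" for t X
    by (auto intro!: derivative_eq_intros)
  have g': "exp (L * t) * L \<le> L * exp (L * t)" for t by simp
  obtain K' where K': "0 \<le> K'" "\<forall>t\<ge>0. exp (L * t) * L \<le> (\<mu> * \<nu>) * (1 + t) powr p * (K' + exp (L * t))"
    by (rule parabolic_weight[OF p1 q L d g' exp_ge_zero])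
  show ?thesis
  proof (rule that[of "\<mu> * \<nu>" K K' L])
    show "\<forall>t\<ge>0. exp (\<beta> * damping_primitive p t) * (1 + t) powr (6 * p) \<le> exp (L * t)"
    proof (intro allI impI)
      fix t :: real assume t: "0 \<le> t"
      have "(1 + t) powr (6 * p) \<le> (1 + t) powr 6" using t p by (intro powr_mono) auto
      also have "\<dots> \<le> exp t powr 6" using t exp_ge_add_one_self[of t] by (intro powr_mono2) auto
      finally have "(1 + t) powr (6 * p) \<le> exp (6 * t)" by (simp add: powr_def)
      moreover have "exp (\<beta> * damping_primitive p t) \<le> exp (\<beta> * t)"
        using damping_primitive_le[OF p(1) t] \<beta> by (simp add: mult_left_mono)
      ultimately have "exp (\<beta> * damping_primitive p t) * (1 + t) powr (6 * p) \<le> exp (\<beta> * t) * exp (6 * t)"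
        by (intro mult_mono) auto
      then show "exp (\<beta> * damping_primitive p t) * (1 + t) powr (6 * p) \<le> exp (L * t)"
        by (simp add: L_def exp_add[symmetric] algebra_simps)
    qed
  qed (use q K K' in auto)
qed

text \<open>The order of quantifiers is the point: \<open>\<epsilon>1\<close> and \<open>C\<close>
  are fixed before the form, the operator and the solutions, so they are common to all compressions
  and all \<epsilon>. The data enter only through \<open>Kw\<close> and \<open>KY\<close>.\<close>

theorem uniform_energy_decay:
  obtains \<epsilon>1 C where "0 < \<epsilon>1"
    "\<And>I :: 'h::real_normed_vector \<Rightarrow> 'h \<Rightarrow> real. \<And>B \<epsilon> c c' k k' U v s s' w t.
      \<lbrakk>band_problem I B \<nu> p \<mu> M1 M2 M3 M4 M5 \<epsilon> c c' k k' U v s s' w; \<epsilon> < \<epsilon>1;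
       I w w \<le> Kw; I (B w) w \<le> Kw; I (B (B (U 0))) (B (U 0)) \<le> KY; 0 \<le> t\<rbrakk>
      \<Longrightarrow> \<epsilon> * I (s t) (s t) / 2 + \<mu> * I (B (v t)) (v t) \<le> C * \<epsilon>\<^sup>2 * exp (- \<beta> * damping_primitive p t)"
proof -
  obtain q K K' L where q: "0 \<le> q" "q < 2 * \<mu> * \<nu>" and K: "0 \<le> K" "0 \<le> K'"
    and W: "\<forall>t\<ge>0. exp (\<beta> * damping_primitive p t) * (\<beta> * (1 + t) powr (- p))
        \<le> q * (1 + t) powr p * (K + exp (\<beta> * damping_primitive p t))"
    and V: "\<forall>t\<ge>0. exp (L * t) * L \<le> q * (1 + t) powr p * (K' + exp (L * t))"
    and WV: "\<forall>t\<ge>0. exp (\<beta> * damping_primitive p t) * (1 + t) powr (6 * p) \<le> exp (L * t)"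
    by (rule decay_weights)
  note W = W[rule_format] and V = V[rule_format] and WV = WV[rule_format]
  define d where "d = \<mu> - q / (2 * \<nu>)"
  have d: "0 < d" using q \<nu> by (simp add: d_def field_simps)
  \<comment> \<open>Solves M4 + \<beta> M3 \<le> \<kappa> d / 2; the absolute values spare a
    discussion of signs and the added 1 keeps \<kappa> positive.\<close>
  define \<kappa> where "\<kappa> = 2 * (\<bar>M4\<bar> + \<beta> * \<bar>M3\<bar>) / d + 1"
  have \<kappa>: "0 < \<kappa>" using d \<beta> by (simp add: \<kappa>_def add_nonneg_pos)
  have "\<beta> * M3 \<le> \<beta> * \<bar>M3\<bar>" using \<beta> by (intro mult_left_mono) auto
  moreover have "\<kappa> * d / 2 = \<bar>M4\<bar> + \<beta> * \<bar>M3\<bar> + d / 2" using d by (simp add: \<kappa>_def field_simps)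
  ultimately have "M4 + \<beta> * M3 \<le> \<kappa> * d / 2"
    using d abs_ge_self[of M4] by linarith
  note \<kappa>_ge = this[unfolded d_def]
  \<comment> \<open>\<open>A\<close> dominates \<beta> + 1, the bracket in the third smallness
    condition and \<kappa> / 2, so \<epsilon> A \<le> 1/2 and \<epsilon> A \<le> \<nu> d / 2 imply
    all four conditions.\<close>
  define A where "A = \<beta> + 1 + \<kappa> * \<beta> / 2 + 3 * \<kappa> / 2"
  have A: "1 \<le> A" using \<kappa> \<beta> by (simp add: A_def add_nonneg_nonneg)
  define \<epsilon>1 where "\<epsilon>1 = min (1 / (2 * A)) (\<nu> * d / (2 * A))"
  have \<epsilon>1: "0 < \<epsilon>1" using A \<nu> d by (simp add: \<epsilon>1_def)
  have \<epsilon>A: "\<epsilon> * A \<le> 1 / 2" "\<epsilon> * A \<le> \<nu> * d / 2" if "\<epsilon> < \<epsilon>1" for \<epsilon>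
  proof -
    have "\<epsilon> \<le> 1 / (2 * A)" "\<epsilon> \<le> \<nu> * d / (2 * A)" using that by (auto simp: \<epsilon>1_def)
    then show "\<epsilon> * A \<le> 1 / 2" "\<epsilon> * A \<le> \<nu> * d / 2" using A by (auto simp: field_simps)
  qed
  define KF where "KF = 2 * M5\<^sup>2 / \<nu>\<^sup>2 + 4 * M1 ^ 4 + 4 * (M1 + M2)\<^sup>2 / \<nu>\<^sup>2"
  define C where "C = (KF * (2 + \<kappa> / (\<nu> * d)) * (K + 1) / (2 * d) * (K' + 1) * KY + 1)
      * exp (2 * ((M3 + \<kappa> / (2 * \<nu>)) / \<mu> + \<kappa> + (K + 1) * ((M3 + \<kappa>) * Kw)))"
  show ?thesis
  proof (rule that[OF \<epsilon>1])
    fix I :: "'h \<Rightarrow> 'h \<Rightarrow> real" and B \<epsilon> c c' k k' U v s s' w t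
    assume bp: "band_problem I B \<nu> p \<mu> M1 M2 M3 M4 M5 \<epsilon> c c' k k' U v s s' w"
      and \<epsilon>: "\<epsilon> < \<epsilon>1" and w: "I w w \<le> Kw" "I (B w) w \<le> Kw" and Y: "I (B (B (U 0))) (B (U 0)) \<le> KY"
      and t: "(0::real) \<le> t"
    interpret band_problem I B \<nu> p \<mu> M1 M2 M3 M4 M5 \<epsilon> c c' k k' U v s s' w by (rule bp)
    let ?W = "\<lambda>t. K + exp (\<beta> * damping_primitive p t)" and ?V = "\<lambda>t. K' + exp (L * t)"
    let ?H = "\<epsilon> * I (s t) (s t) / 2 + \<mu> * I (B (v t)) (v t)"
    have le: "\<epsilon> * x \<le> \<epsilon> * A" if "x \<le> A" for x using that \<epsilon>_pos by (intro mult_left_mono) auto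
    have E1: "\<epsilon> * (\<beta> + 1) \<le> \<epsilon> * A" "\<epsilon> * (\<beta> + \<kappa> * \<beta> / 2 + 3 * \<kappa> / 2) \<le> \<epsilon> * A" "\<epsilon> * \<kappa> / 2 \<le> \<epsilon> * A"
      using le[of "\<beta> + 1"] le[of "\<beta> + \<kappa> * \<beta> / 2 + 3 * \<kappa> / 2"] le[of "\<kappa> / 2"] \<kappa> \<beta> mult_nonneg_nonneg[of \<kappa> \<beta>]
      unfolding A_def by auto
    have small: "\<epsilon> * (\<beta> + 1) \<le> 1 / 2" "\<epsilon> * (\<beta> + 1) \<le> \<nu> * (\<mu> - q / (2 * \<nu>)) / 2"
      "\<epsilon> * (\<beta> + \<kappa> * \<beta> / 2 + 3 * \<kappa> / 2) \<le> 1 / 2" "\<kappa> * \<epsilon> \<le> 1"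
      using E1 \<epsilon>A[OF \<epsilon>] unfolding d_def by (auto simp: mult.commute)
    have "(K + exp (\<beta> * damping_primitive p t)) * ?H \<le>
      (forcing_const * (2 + \<kappa> / (\<nu> * (\<mu> - q / (2 * \<nu>)))) * (K + 1) / (2 * (\<mu> - q / (2 * \<nu>))) * (K' + exp (L * 0)) * KY + 1)
      * exp (2 * ((M3 + \<kappa> / (2 * \<nu>)) / \<mu> + \<kappa> + (K + 1) * ((M3 + \<kappa>) * Kw))) * \<epsilon>\<^sup>2"
    \<comment> \<open>One constant K + 1 serves in both comparisons: since exp (\<beta> B) \<ge> 1,
      the weight K + exp (\<beta> B) is at most (K + 1) exp (\<beta> B).\<close>
    proof (rule energy_decay[OF t \<kappa> q \<beta> \<kappa>_ge small, where W = ?W and V = ?V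
          and W' = "\<lambda>t. 0 + exp (\<beta> * damping_primitive p t) * (\<beta> * (1 + t) powr (- p))"
          and V' = "\<lambda>t. exp (L * t) * L" and ?K0.0 = "K + 1" and ?K4.0 = "K + 1"])
      fix r :: real assume r: "0 \<le> r"
      show "(?W has_real_derivative 0 + exp (\<beta> * damping_primitive p r) * (\<beta> * (1 + r) powr (- p))) (at r within {0..})"
        by (intro DERIV_add DERIV_const exp_damping_primitive_deriv r)
      show "0 < ?W r \<and> 0 \<le> 0 + exp (\<beta> * damping_primitive p r) * (\<beta> * (1 + r) powr (- p))"
        using K \<beta> by (simp add: add_nonneg_pos)
      show "0 + exp (\<beta> * damping_primitive p r) * (\<beta> * (1 + r) powr (- p)) \<le> \<beta> * (1 + r) powr (- p) * ?W r"
        using K \<beta> by (simp add: algebra_simps)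
      show "0 + exp (\<beta> * damping_primitive p r) * (\<beta> * (1 + r) powr (- p)) \<le> q * (1 + r) powr p * ?W r"
        using W[OF r] by simp
      have 1: "1 \<le> exp (\<beta> * damping_primitive p r)" using \<beta> damping_primitive_nonneg[OF p(2) r] by simp
      have "K * 1 \<le> K * exp (\<beta> * damping_primitive p r)" using 1 K by (intro mult_left_mono)
      then show WK: "?W r \<le> (K + 1) * exp (\<beta> * damping_primitive p r)" by (simp add: algebra_simps)
      show "(?V has_real_derivative exp (L * r) * L) (at r within {0..})"
        by (auto intro!: derivative_eq_intros)
      show "0 \<le> ?V r \<and> exp (L * r) * L \<le> q * (1 + r) powr p * ?V r"
        using K V[OF r] by (simp add: add_nonneg_nonneg)
      have "(1 + r) powr (4 * p) \<le> (1 + r) powr (6 * p)" using r p by (intro powr_mono) auto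
      then have "?W r * (1 + r) powr (4 * p) \<le> ((K + 1) * exp (\<beta> * damping_primitive p r)) * (1 + r) powr (6 * p)"
        using WK K by (intro mult_mono) auto
      also have "\<dots> \<le> (K + 1) * exp (L * r)" using WV[OF r] K by (simp add: mult.assoc mult_left_mono)
      also have "\<dots> \<le> (K + 1) * ?V r" using K by (intro mult_left_mono) auto
      finally show "?W r * (1 + r) powr (4 * p) \<le> (K + 1) * ?V r" .
    qed (use w Y in auto)
    also have "\<dots> = C * \<epsilon>\<^sup>2" unfolding C_def KF_def d_def forcing_const_def by simp
    finally have "(K + exp (\<beta> * damping_primitive p t)) * ?H \<le> C * \<epsilon>\<^sup>2" .
    moreover have "0 \<le> K * ?H" using K \<epsilon>_pos \<mu>_pos I_nonneg B_nonneg by (intro mult_nonneg_nonneg add_nonneg_nonneg) auto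
    ultimately have "exp (\<beta> * damping_primitive p t) * ?H \<le> C * \<epsilon>\<^sup>2" unfolding distrib_right by linarith
    then show "?H \<le> C * \<epsilon>\<^sup>2 * exp (- \<beta> * damping_primitive p t)"
      by (simp add: exp_minus field_simps)
  qed
qed

theorem uniform_parabolic_decay:
  obtains C where "0 \<le> C"
    "\<And>I :: 'h::real_normed_vector \<Rightarrow> 'h \<Rightarrow> real. \<And>B \<epsilon> c c' k k' U v s s' w t M1 M2 M3 M4 M5.
      \<lbrakk>band_problem I B \<nu> p \<mu> M1 M2 M3 M4 M5 \<epsilon> c c' k k' U v s s' w; 0 \<le> t\<rbrakk>
      \<Longrightarrow> exp (\<beta> * damping_primitive p t) * (1 + t) powr (6 * p) * I (B (B (U t))) (B (U t)) \<le> C * I (B (B (U 0))) (B (U 0))"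
proof -
  obtain q K K' L where q: "0 \<le> q" "q < 2 * \<mu> * \<nu>" and K: "0 \<le> K" "0 \<le> K'"
    and W: "\<forall>t\<ge>0. exp (\<beta> * damping_primitive p t) * (\<beta> * (1 + t) powr (- p))
        \<le> q * (1 + t) powr p * (K + exp (\<beta> * damping_primitive p t))"
    and V: "\<forall>t\<ge>0. exp (L * t) * L \<le> q * (1 + t) powr p * (K' + exp (L * t))"
    and WV: "\<forall>t\<ge>0. exp (\<beta> * damping_primitive p t) * (1 + t) powr (6 * p) \<le> exp (L * t)"
    by (rule decay_weights)
  note W = W[rule_format] and V = V[rule_format] and WV = WV[rule_format]
  show ?thesis
  proof (rule that[of "K' + 1"])
    show "0 \<le> K' + 1" using K by simp
    fix I :: "'h \<Rightarrow> 'h \<Rightarrow> real" and B \<epsilon> c c' k k' U v s s' w t M1 M2 M3 M4 M5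
    assume bp: "band_problem I B \<nu> p \<mu> M1 M2 M3 M4 M5 \<epsilon> c c' k k' U v s s' w" and t: "(0::real) \<le> t"
    interpret band_problem I B \<nu> p \<mu> M1 M2 M3 M4 M5 \<epsilon> c c' k k' U v s s' w by (rule bp)
    let ?V = "\<lambda>t. K' + exp (L * t)"
    have "?V t * Y t \<le> ?V 0 * Y 0"
    proof (rule weighted_Y_le[OF t q])
      fix r :: real assume r: "0 \<le> r"
      show "(?V has_real_derivative exp (L * r) * L) (at r within {0..})"
        by (auto intro!: derivative_eq_intros)
      show "0 \<le> ?V r \<and> exp (L * r) * L \<le> q * (1 + r) powr p * ?V r"
        using K V[OF r] by (simp add: add_nonneg_nonneg)
    qed
    moreover have "exp (\<beta> * damping_primitive p t) * (1 + t) powr (6 * p) * Y t \<le> ?V t * Y t"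
      using WV[OF t] K Y_nonneg[of t] by (intro mult_right_mono) auto
    ultimately show "exp (\<beta> * damping_primitive p t) * (1 + t) powr (6 * p) * I (B (B (U t))) (B (U t))
      \<le> (K' + 1) * I (B (B (U 0))) (B (U 0))" by (simp add: Y_def)
  qed
qed

end

text \<open>The equations and derivatives live in the normed space and involve \<open>B\<close>
  only; \<open>I\<close> enters through \<open>energy_form\<close> alone, so it can be exchanged
  while everything else stays.\<close>

lemma (in band_problem) derived_band_problem:
  "band_problem (\<lambda>x y. I (B x) y) B \<nu> p \<mu> M1 M2 M3 M4 M5 \<epsilon> c c' k k' U v s s' w"
  using derived_form band_problem_axioms by (simp add: band_problem_def)

text \<open>Both sources of the velocity equation are bounded through the derived form: its energy
  controls |B v|^2 and its parabolic energy controls |B (B U)|^2, hence \<open>g\<close>. The data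
  bounds are therefore one order higher than in the energy estimate.\<close>

theorem uniform_velocity_decay:
  fixes p \<beta> \<mu> \<nu> M1 M2 M3 M4 M5 Kw KY :: real
  assumes p: "0 \<le> p" "p \<le> 1" and \<beta>: "0 \<le> \<beta>" and \<mu>: "0 < \<mu>" and \<nu>: "0 < \<nu>"
    and p0: "p = 0 \<Longrightarrow> \<beta> < 2 * \<mu> * \<nu>"
  obtains \<epsilon>1 C where "0 < \<epsilon>1"
    "\<And>I :: 'h::real_normed_vector \<Rightarrow> 'h \<Rightarrow> real. \<And>B \<epsilon> c c' k k' U v s s' w t.
      \<lbrakk>band_problem I B \<nu> p \<mu> M1 M2 M3 M4 M5 \<epsilon> c c' k k' U v s s' w; \<epsilon> < \<epsilon>1;
       I (B w) w \<le> Kw; I (B w) (B w) \<le> Kw; I (B (B (U 0))) (B (B (U 0))) \<le> KY; 0 \<le> t\<rbrakk>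
      \<Longrightarrow> I (s t) (s t) \<le> C * \<epsilon>\<^sup>2 * exp (- \<beta> * damping_primitive p t)"
proof -
  \<comment> \<open>The source has to beat b^2, which for p > 0 costs (1 + t)^(2 p) \<le> exp (2 B).
    For p = 0 the coefficient b is 1, nothing is lost, and the threshold on the rate is
    respected.\<close>
  define \<beta>' where "\<beta>' = (if p = 0 then \<beta> else \<beta> + 2)"
  have \<beta>': "0 \<le> \<beta>'" "p = 0 \<Longrightarrow> \<beta>' < 2 * \<mu> * \<nu>" using \<beta> p0 by (auto simp: \<beta>'_def)
  obtain \<epsilon>1 C where \<epsilon>1: "0 < \<epsilon>1" and C:
    "\<And>I :: 'h::real_normed_vector \<Rightarrow> 'h \<Rightarrow> real. \<And>B \<epsilon> c c' k k' U v s s' w t.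
      \<lbrakk>band_problem I B \<nu> p \<mu> M1 M2 M3 M4 M5 \<epsilon> c c' k k' U v s s' w; \<epsilon> < \<epsilon>1;
       I w w \<le> Kw; I (B w) w \<le> Kw; I (B (B (U 0))) (B (U 0)) \<le> KY; 0 \<le> t\<rbrakk>
      \<Longrightarrow> \<epsilon> * I (s t) (s t) / 2 + \<mu> * I (B (v t)) (v t) \<le> C * \<epsilon>\<^sup>2 * exp (- \<beta>' * damping_primitive p t)"
    by (rule uniform_energy_decay[OF p \<beta>'(1) \<mu> \<nu> \<beta>'(2)]) blast+
  obtain C' where C': "0 \<le> C'"
    "\<And>I :: 'h::real_normed_vector \<Rightarrow> 'h \<Rightarrow> real. \<And>B \<epsilon> c c' k k' U v s s' w t M1 M2 M3 M4 M5.
      \<lbrakk>band_problem I B \<nu> p \<mu> M1 M2 M3 M4 M5 \<epsilon> c c' k k' U v s s' w; 0 \<le> t\<rbrakk>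
      \<Longrightarrow> exp (\<beta> * damping_primitive p t) * (1 + t) powr (6 * p) * I (B (B (U t))) (B (U t)) \<le> C' * I (B (B (U 0))) (B (U 0))"
    by (rule uniform_parabolic_decay[OF p \<beta> \<mu> \<nu> p0]) blast+
  define KF where "KF = 2 * M5\<^sup>2 / \<nu>\<^sup>2 + 4 * M1 ^ 4 + 4 * (M1 + M2)\<^sup>2 / \<nu>\<^sup>2"
  have KF: "0 \<le> KF" by (simp add: KF_def)
  define K where "K = M3\<^sup>2 * (C / \<mu>) + KF * (C' * KY)"
  define \<epsilon>2 where "\<epsilon>2 = min \<epsilon>1 (1 / (2 * (\<beta> + 1)))"
  show ?thesis
  proof (rule that[of \<epsilon>2 "4 * K"])
    show "0 < \<epsilon>2" using \<epsilon>1 \<beta> by (simp add: \<epsilon>2_def)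
    fix I :: "'h \<Rightarrow> 'h \<Rightarrow> real" and B \<epsilon> c c' k k' U v s s' w t
    assume bp: "band_problem I B \<nu> p \<mu> M1 M2 M3 M4 M5 \<epsilon> c c' k k' U v s s' w"
      and \<epsilon>: "\<epsilon> < \<epsilon>2" and w: "I (B w) w \<le> Kw" "I (B w) (B w) \<le> Kw" and Y: "I (B (B (U 0))) (B (B (U 0))) \<le> KY"
      and t: "(0::real) \<le> t"
    interpret band_problem I B \<nu> p \<mu> M1 M2 M3 M4 M5 \<epsilon> c c' k k' U v s s' w by (rule bp)
    have "\<epsilon> \<le> \<epsilon>1" "\<epsilon> \<le> 1 / (2 * (\<beta> + 1))" and \<epsilon>': "\<epsilon> < \<epsilon>1" using \<epsilon> by (auto simp: \<epsilon>2_def)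
    then have "\<epsilon> * (\<beta> + 1) \<le> 1 / 2" using \<beta> by (simp add: field_simps)
    then have \<beta>\<epsilon>: "\<beta> * \<epsilon> \<le> 1 / 2" using \<epsilon>_pos by (simp add: algebra_simps)
    have sym: "I (B x) (B y) = I (B (B x)) y" for x y using I_sym by simp
    have "exp (\<beta> * damping_primitive p t) * I (s t) (s t) \<le> 4 * K * \<epsilon>\<^sup>2"
    proof (rule velocity_decay[OF t \<beta> \<beta>\<epsilon>])
      fix r :: real assume r: "0 \<le> r"
      let ?E = "exp (\<beta> * damping_primitive p r)" and ?b2 = "((1 + r) powr (- p))\<^sup>2"
      have b2: "?b2 = (1 + r) powr (- 2 * p)" using r by (simp add: powr_power)
      have "\<epsilon> * I (B (s r)) (s r) / 2 + \<mu> * I (B (B (v r))) (v r) \<le> C * \<epsilon>\<^sup>2 * exp (- \<beta>' * damping_primitive p r)"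
        by (rule C[OF derived_band_problem \<epsilon>' _ _ _ r]) (use w Y sym in auto)
      moreover have "0 \<le> \<epsilon> * I (B (s r)) (s r) / 2" using \<epsilon>_pos B_nonneg by simp
      ultimately have "\<mu> * I (B (v r)) (B (v r)) \<le> C * \<epsilon>\<^sup>2 * exp (- \<beta>' * damping_primitive p r)"
        using sym by simp
      then have 1: "I (B (v r)) (B (v r)) \<le> C / \<mu> * \<epsilon>\<^sup>2 * exp (- \<beta>' * damping_primitive p r)"
        using \<mu> by (simp add: field_simps)
      \<comment> \<open>The sign of \<open>C\<close> is not part of the energy estimate; it is read
        off from the fact that the bounded quantity is nonnegative.\<close>
      have C0: "0 \<le> C / \<mu> * \<epsilon>\<^sup>2"
        using order_trans[OF I_nonneg 1] by (meson exp_gt_zero mult_neg_pos not_less)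
      have "?E * exp (- \<beta>' * damping_primitive p r) \<le> ?b2"
      proof (cases "p = 0")
        case True
        then show ?thesis using r by (simp add: \<beta>'_def exp_minus)
      next
        case False
        have "?E * exp (- \<beta>' * damping_primitive p r) = exp (- (2 * damping_primitive p r))"
          using False by (simp add: \<beta>'_def exp_add[symmetric] algebra_simps)
        also have "\<dots> \<le> exp (- (2 * ln (1 + r)))"
          using damping_primitive_ge_ln[OF p(2) r] by simp
        also have "\<dots> = (1 + r) powr (- 2)" using r by (simp add: powr_def)
        also have "\<dots> \<le> ?b2" unfolding b2 using r p by (intro powr_mono) auto
        finally show ?thesis .
      qed
      then have "C / \<mu> * \<epsilon>\<^sup>2 * (?E * exp (- \<beta>' * damping_primitive p r)) \<le> C / \<mu> * \<epsilon>\<^sup>2 * ?b2"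
        using C0 by (rule mult_left_mono)
      moreover have "?E * I (B (v r)) (B (v r)) \<le> ?E * (C / \<mu> * \<epsilon>\<^sup>2 * exp (- \<beta>' * damping_primitive p r))"
        by (intro mult_left_mono 1) auto
      ultimately have 2: "?E * I (B (v r)) (B (v r)) \<le> C / \<mu> * \<epsilon>\<^sup>2 * ?b2" by (simp add: algebra_simps)
      let ?Y = "I (B (B (U r))) (B (B (U r)))"
      have "?E * (1 + r) powr (6 * p) * ?Y \<le> C' * I (B (B (U 0))) (B (B (U 0)))"
        using C'(2)[OF derived_band_problem r] sym by simp
      also have "\<dots> \<le> C' * KY" using C' Y by (intro mult_left_mono)
      finally have 3: "?E * (1 + r) powr (6 * p) * ?Y \<le> C' * KY" .
      \<comment> \<open>Here 6 p = 4 p + 2 p: the surplus over the forcing becomes the required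
        factor b^2.\<close>
      have "(1 + r) powr (4 * p) = (1 + r) powr (6 * p) * ?b2"
        unfolding b2 using r by (simp add: powr_add[symmetric])
      then have "?E * I (g r) (g r) \<le> ?E * (\<epsilon>\<^sup>2 * KF * ((1 + r) powr (6 * p) * ?b2) * ?Y)"
        using g_bound[OF r] unfolding KF_def forcing_const_def by simp
      also have "\<dots> = \<epsilon>\<^sup>2 * KF * ?b2 * (?E * (1 + r) powr (6 * p) * ?Y)" by simp
      also have "\<dots> \<le> \<epsilon>\<^sup>2 * KF * ?b2 * (C' * KY)" using KF by (intro mult_left_mono 3) auto
      finally have 4: "?E * I (g r) (g r) \<le> \<epsilon>\<^sup>2 * KF * ?b2 * (C' * KY)" .
      have "M3\<^sup>2 * (?E * I (B (v r)) (B (v r))) \<le> M3\<^sup>2 * (C / \<mu> * \<epsilon>\<^sup>2 * ?b2)"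
        by (intro mult_left_mono 2) auto
      then show "?E * (M3\<^sup>2 * I (B (v r)) (B (v r)) + I (g r) (g r)) \<le> K * \<epsilon>\<^sup>2 * ?b2"
        using 4 by (simp add: K_def algebra_simps)
    qed
    then show "I (s t) (s t) \<le> 4 * K * \<epsilon>\<^sup>2 * exp (- \<beta> * damping_primitive p t)"
      by (simp add: exp_minus field_simps)
  qed
qed

section \<open>Spectral calculus\<close>

lemma UN_symmetric_Ioc: "(\<Union>n. {- real n<..real n}) = UNIV"
proof safe
  fix x :: real
  obtain n where "\<bar>x\<bar> < real n" using reals_Archimedean2 by blast
  then show "x \<in> (\<Union>n. {- real n<..real n})" by (intro UN_I[of n]) (auto simp: abs_less_iff)
qed auto

text \<open>Half-open intervals form an intersection-stable generator with a finite exhaustion.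
  Through this the spectral measures of E b x and A x are recognised as densities over that of
  x.\<close>

lemma interval_measure_eqI:
  assumes F: "\<And>x y. x \<le> y \<Longrightarrow> F x \<le> F y" "\<And>a. continuous (at_right a) F"
    and M: "sets M = sets borel" "\<And>a b. a \<le> b \<Longrightarrow> emeasure M {a<..b} = ennreal (F b - F a)"
  shows "interval_measure F = M"
proof (rule measure_eqI_generator_eq[where A = "\<lambda>n. {- real n<..real n}" and \<Omega> = UNIV
      and E = "range (\<lambda>(a, b). {a<..b::real})"])
  show "Int_stable (range (\<lambda>(a, b). {a<..b::real}))"
    by (auto simp: Int_stable_def image_iff)
  show "sets (interval_measure F) = sigma_sets UNIV (range (\<lambda>(a, b). {a<..b}))"
    by (simp add: borel_sigma_sets_Ioc)
  then show "sets M = sigma_sets UNIV (range (\<lambda>(a, b). {a<..b}))" using M by simp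
  show "emeasure (interval_measure F) X = emeasure M X" if "X \<in> range (\<lambda>(a, b). {a<..b})" for X
  proof -
    have "\<exists>ab. X = {fst ab<..snd ab}" using that unfolding case_prod_unfold by (rule rangeE) blast
    then obtain a b where X: "X = {a<..b}" by blast
    show ?thesis
    proof (cases "a \<le> b")
      case True
      then show ?thesis using emeasure_interval_measure_Ioc[OF True F] M(2)[OF True] X by simp
    qed (simp add: X)
  qed
  show "(\<Union>n. {- real n<..real n}) = UNIV" by (rule UN_symmetric_Ioc)
  show "emeasure (interval_measure F) {- real n<..real n} \<noteq> \<infinity>" for n
    using emeasure_interval_measure_Ioc[OF _ F, of "- real n" "real n"] by simp
qed auto

locale resolution =
  fixes E :: "real \<Rightarrow> 'h::{real_inner, complete_space} \<Rightarrow> 'h"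
  assumes resolution: "resolution_of_identity E"
begin

lemma linear: "bounded_linear (E s)"
  and E_idem [simp]: "E s (E s x) = E s x"
  and E_sym: "inner (E s x) y = inner x (E s y)"
  using resolution by (auto simp: resolution_of_identity_def orthogonal_projection_def)

lemmas E_simps = linear_simps[OF linear]

text \<open>The definition gives one order of the product; the other one follows by taking adjoints,
  as all \<open>E s\<close> are symmetric.\<close>

lemma E_E: "E s (E t x) = E (min s t) x"
proof (cases "s \<le> t")
  case True
  then show ?thesis using resolution by (simp add: resolution_of_identity_def)
next
  case False
  then have *: "E t (E s y) = E t y" for y using resolution by (simp add: resolution_of_identity_def)
  have "inner (E s (E t x)) y = inner (E t x) y" for y
    using * E_sym by metis
  then have "E s (E t x) = E t x" by (metis inner_commute vector_eq_rdot)
  then show ?thesis using False by simp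
qed

lemma E_right: "((\<lambda>t. E t x) \<longlongrightarrow> E s x) (at_right s)"
  and E_bot: "((\<lambda>t. E t x) \<longlongrightarrow> 0) at_bot"
  and E_top: "((\<lambda>t. E t x) \<longlongrightarrow> x) at_top"
  using resolution by (auto simp: resolution_of_identity_def)

lemma E_seq: "(\<lambda>n. E (real n) x) \<longlonglongrightarrow> x"
  using filterlim_compose[OF E_top filterlim_real_sequentially] by simp

lemma inner_E_mono: "s \<le> t \<Longrightarrow> inner (E s x) x \<le> inner (E t x) x"
proof -
  assume st: "s \<le> t"
  have "inner (E t x - E s x) x = inner (E t x - E s x) (E t x - E s x)"
    using st E_sym[of t] E_sym[of s] by (simp add: inner_simps E_E inner_commute)
  then have "0 \<le> inner (E t x - E s x) x" by simp
  then show ?thesis by (simp add: inner_simps)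
qed

lemma inner_E_right: "continuous (at_right s) (\<lambda>s. inner (E s x) x)"
  unfolding continuous_within by (intro tendsto_intros E_right)

abbreviation \<sigma> where "\<sigma> \<equiv> spectral_measure E"

lemma sets_\<sigma> [simp, measurable_cong]: "sets (\<sigma> x) = sets borel"
  by (simp add: spectral_measure_def)

lemma space_\<sigma> [simp]: "space (\<sigma> x) = UNIV"
  by (simp add: spectral_measure_def)

definition band :: "real \<Rightarrow> real \<Rightarrow> 'h \<Rightarrow> 'h" where
  "band a b x = E b x - E a x"

lemma band_linear: "bounded_linear (band a b)"
  unfolding band_def by (intro bounded_linear_sub linear)

lemmas band_simps = linear_simps[OF band_linear]

lemma inner_band: "inner (band a b x) (band c d y) = inner (band c d (band a b x)) y"
  using E_sym[of d "band a b x" y] E_sym[of c "band a b x" y] by (simp add: band_def[of c d] inner_simps)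

lemma band_idem: "a \<le> b \<Longrightarrow> band a b (band a b x) = band a b x"
  by (simp add: band_def E_simps E_E)

lemma emeasure_Ioc: "a \<le> b \<Longrightarrow> emeasure (\<sigma> x) {a<..b} = ennreal (inner (band a b x) x)"
  unfolding spectral_measure_def band_def
  by (subst emeasure_interval_measure_Ioc) (auto intro: inner_E_mono inner_E_right simp: inner_simps)

lemma inner_band_self: "a \<le> b \<Longrightarrow> inner (band a b x) x = (norm (band a b x))\<^sup>2"
  using inner_band[of a b x a b x] by (simp add: band_idem power2_norm_eq_inner)

lemma \<sigma>_eqI:
  assumes "sets M = sets borel" "\<And>a b. a \<le> b \<Longrightarrow> emeasure M {a<..b} = ennreal (inner (band a b x) x)"
  shows "\<sigma> x = M"
  unfolding spectral_measure_def using assms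
  by (intro interval_measure_eqI inner_E_mono inner_E_right) (auto simp: band_def inner_simps)

lemma emeasure_UNIV: "emeasure (\<sigma> x) UNIV = ennreal ((norm x)\<^sup>2)"
proof -
  have "(\<lambda>n. emeasure (\<sigma> x) {- real n<..real n}) \<longlonglongrightarrow> emeasure (\<sigma> x) (\<Union>n. {- real n<..real n})"
    by (rule Lim_emeasure_incseq) (auto simp: incseq_def)
  moreover note UN_symmetric_Ioc
  moreover have "(\<lambda>n. emeasure (\<sigma> x) {- real n<..real n}) \<longlonglongrightarrow> ennreal (inner (x - 0) x)"
  proof -
    have "(\<lambda>n. E (- real n) x) \<longlonglongrightarrow> 0"
      by (rule filterlim_compose[OF E_bot]) (simp add: filterlim_uminus_at_top[symmetric] filterlim_real_sequentially filterlim_uminus_at_bot)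
    then have "(\<lambda>n. ennreal (inner (band (- real n) (real n) x) x)) \<longlonglongrightarrow> ennreal (inner (x - 0) x)"
      unfolding band_def by (intro tendsto_intros tendsto_ennrealI E_seq)
    then show ?thesis by (simp add: emeasure_Ioc)
  qed
  ultimately have "emeasure (\<sigma> x) UNIV = ennreal (inner (x - 0) x)"
    using LIMSEQ_unique[of "\<lambda>n. emeasure (\<sigma> x) {- real n<..real n}"] by metis
  then show ?thesis by (simp add: power2_norm_eq_inner)
qed

sublocale finite_measure "\<sigma> x" for x
  by standard (simp add: emeasure_UNIV)

lemma measure_Ioc: "a \<le> b \<Longrightarrow> measure (\<sigma> x) {a<..b} = inner (band a b x) x"
  using emeasure_Ioc[of a b x] inner_band_self[of a b x] by (simp add: measure_def)

text \<open>On (c, d] both sides reduce to the product of two bands, which is the band of the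
  intersection, or 0 when the intervals are disjoint.\<close>

lemma \<sigma>_band:
  assumes ab: "a \<le> b"
  shows "\<sigma> (band a b x) = density (\<sigma> x) (indicator {a<..b})"
proof (rule \<sigma>_eqI)
  fix c d :: real assume cd: "c \<le> d"
  have "emeasure (density (\<sigma> x) (indicator {a<..b})) {c<..d} = emeasure (\<sigma> x) ({a<..b} \<inter> {c<..d})"
    by (subst emeasure_restricted) (auto simp: Int_commute)
  also have "\<dots> = emeasure (\<sigma> x) {max a c<..min b d}" by simp
  also have "\<dots> = ennreal (inner (band c d (band a b x)) (band a b x))"
  proof (cases "max a c \<le> min b d")
    case True
    have "band a b (band c d (band a b x)) = band (max a c) (min b d) x"
      using ab cd True by (auto simp: band_def E_simps E_E min_def max_def)
    then show ?thesis using True inner_band[of "c" "d" "band a b x" a b x] by (simp add: emeasure_Ioc)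
  next
    case False
    have "band a b (band c d (band a b x)) = 0"
      using ab cd False by (auto simp: band_def E_simps E_E min_def max_def split: if_splits)
    moreover have "{max a c<..min b d} = {}" using False by auto
    ultimately show ?thesis using inner_band[of "c" "d" "band a b x" a b x] by (simp del: greaterThanAtMost_empty_iff)
  qed
  finally show "emeasure (density (\<sigma> x) (indicator {a<..b})) {c<..d} = ennreal (inner (band c d (band a b x)) (band a b x))" .
qed simp

lemma band_commute: "band a b (band c d x) = band c d (band a b x)"
  by (simp add: band_def E_simps E_E min.commute)

text \<open>Contains the orthogonality of disjoint bands; in this form sums over two different grids
  become integrals of products of step functions.\<close>

lemma inner_band_band:
  assumes "a \<le> b" "c \<le> d"
  shows "inner (band a b x) (band c d x) = measure (\<sigma> x) ({a<..b} \<inter> {c<..d})"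
proof -
  have "measure (\<sigma> x) ({a<..b} \<inter> {c<..d}) = measure (density (\<sigma> x) (indicator {a<..b})) {c<..d}"
    unfolding measure_def by (subst emeasure_restricted) (auto simp: Int_commute)
  also have "\<dots> = inner (band c d (band a b x)) (band a b x)"
    using assms by (simp add: \<sigma>_band[symmetric] measure_Ioc)
  also have "\<dots> = inner (band c d (band a b x)) x"
    unfolding inner_band[of c d "band a b x" a b x] band_commute[of a b c d "band a b x"]
    using assms by (simp add: band_idem)
  finally show ?thesis by (simp add: inner_band)
qed

lemma integral_band:
  fixes f :: "real \<Rightarrow> real"
  assumes "a \<le> b" "f \<in> borel_measurable borel"
  shows "integrable (\<sigma> (band a b x)) f \<longleftrightarrow> integrable (\<sigma> x) (\<lambda>s. indicator {a<..b} s * f s)"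
    and "(LINT s|\<sigma> (band a b x). f s) = (LINT s|\<sigma> x. indicator {a<..b} s * f s)"
proof -
  have "\<sigma> (band a b x) = density (\<sigma> x) (\<lambda>s. ennreal (indicator {a<..b} s))"
    using assms by (simp add: \<sigma>_band ennreal_indicator)
  then show "integrable (\<sigma> (band a b x)) f \<longleftrightarrow> integrable (\<sigma> x) (\<lambda>s. indicator {a<..b} s * f s)"
    "(LINT s|\<sigma> (band a b x). f s) = (LINT s|\<sigma> x. indicator {a<..b} s * f s)"
    using assms by (simp_all add: integrable_density integral_density)
qed

end

text \<open>The k * k cells of length 1 / k cover (0, k], so the grid refines and spreads at once.
  Taking the left endpoint keeps the step function below an increasing \<open>f\<close>.\<close>

definition lower_step :: "(real \<Rightarrow> real) \<Rightarrow> nat \<Rightarrow> real \<Rightarrow> real" where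
  "lower_step f k s = (\<Sum>i<k * k. f (real i / real k) * indicator {real i / real k<..real (Suc i) / real k} s)"

lemma lower_step_eq:
  assumes "0 < s" "s \<le> real k"
  shows "lower_step f k s = f (real (nat \<lceil>s * real k\<rceil> - 1) / real k)"
    and "real (nat \<lceil>s * real k\<rceil> - 1) / real k < s"
    and "s - 1 / real k \<le> real (nat \<lceil>s * real k\<rceil> - 1) / real k"
proof -
  have k: "0 < real k" using assms by linarith
  \<comment> \<open>The cells are open on the left, hence the ceiling minus one: a grid point
    belongs to the cell that ends there.\<close>
  define i where "i = nat \<lceil>s * real k\<rceil> - 1"
  have pos: "0 < \<lceil>s * real k\<rceil>" using assms k by simp
  then have "1 \<le> nat \<lceil>s * real k\<rceil>" by linarith
  then have ri: "real i = of_int \<lceil>s * real k\<rceil> - 1"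
    unfolding i_def using of_nat_diff[of 1 "nat \<lceil>s * real k\<rceil>", where 'a = real] pos by simp
  have i: "real i < s * real k" "s * real k \<le> real i + 1" unfolding ri by linarith+
  show "real (nat \<lceil>s * real k\<rceil> - 1) / real k < s" unfolding i_def[symmetric] using i k by (simp add: field_simps)
  show "s - 1 / real k \<le> real (nat \<lceil>s * real k\<rceil> - 1) / real k"
    unfolding i_def[symmetric] using i k by (simp add: pos_le_divide_eq left_diff_distrib)
  have "s * real k \<le> real k * real k" using assms k by (intro mult_right_mono) auto
  then have "real i < real (k * k)" using i by simp
  then have ik: "i < k * k" unfolding of_nat_less_iff .
  have "(if j = i then f (real i / real k) else 0)
      = f (real j / real k) * indicator {real j / real k<..real (Suc j) / real k} s" for j
  proof -
    have "s \<in> {real j / real k<..real (Suc j) / real k} \<longleftrightarrow> real j < s * real k \<and> s * real k \<le> real j + 1"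
      using k by (simp add: field_simps)
    also have "\<dots> \<longleftrightarrow> j = i"
    proof
      assume "real j < s * real k \<and> s * real k \<le> real j + 1"
      then have "real j < real i + 1" "real i < real j + 1" using i by linarith+
      then show "j = i" by linarith
    qed (use i in auto)
    finally show ?thesis by (simp add: indicator_def)
  qed
  then have "lower_step f k s = (\<Sum>j<k * k. if j = i then f (real i / real k) else 0)"
    unfolding lower_step_def by simp
  also have "\<dots> = f (real i / real k)" using ik by simp
  finally show "lower_step f k s = f (real (nat \<lceil>s * real k\<rceil> - 1) / real k)" by (simp add: i_def)
qed

lemma lower_step_eq_0:
  assumes "s \<le> 0 \<or> real k < s"
  shows "lower_step f k s = 0"
  unfolding lower_step_def
proof (rule sum.neutral, rule ballI)
  fix i assume i: "i \<in> {..<k * k}"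
  then have k: "0 < real k" by (cases k) auto
  have "s \<notin> {real i / real k<..real (Suc i) / real k}"
  proof
    assume s: "s \<in> {real i / real k<..real (Suc i) / real k}"
    have "real (Suc i) \<le> real (k * k)" unfolding of_nat_le_iff using i by simp
    then have "real (Suc i) / real k \<le> real k" using k by (simp add: field_simps)
    moreover have "0 \<le> real i / real k" using k by simp
    ultimately have "0 < s" "s \<le> real k" using s by (meson greaterThanAtMost_iff le_less_trans order_trans)+
    then show False using assms by linarith
  qed
  then show "f (real i / real k) * indicator {real i / real k<..real (Suc i) / real k} s = 0" by simp
qed

lemma lower_step_product:
  "lower_step f k s * lower_step f l s = (\<Sum>i<k * k. \<Sum>j<l * l. (f (real i / real k) * f (real j / real l)) *
    indicator ({real i / real k<..real (Suc i) / real k} \<inter> {real j / real l<..real (Suc j) / real l}) s)"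
  unfolding lower_step_def sum_product
  by (intro sum.cong refl) (simp only: indicator_inter_arith ac_simps)

lemma lower_step_measurable [measurable]: "lower_step f k \<in> borel_measurable borel"
  unfolding lower_step_def by measurable

section \<open>Resolutions supported on the positive half-line and their step operators\<close>

locale positive_resolution = resolution +
  assumes E_0: "E 0 x = 0"
begin

lemma E_nonpos: "s \<le> 0 \<Longrightarrow> E s x = 0"
  using E_E[of s 0 x] E_0 linear_simps(3)[OF linear] by simp

lemma band_0: "band 0 b = E b"
  by (rule ext) (simp add: band_def E_0)

lemma AE_pos: "AE s in \<sigma> x. 0 < s"
proof (rule AE_I')
  have "(\<Union>n. {- real n<..0}) \<in> null_sets (\<sigma> x)"
    by (intro null_sets_UN null_setsI) (auto simp: emeasure_Ioc band_def E_nonpos)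
  moreover have "(\<Union>n. {- real n<..0}) = {..0}"
  proof safe
    fix s :: real assume "s \<le> 0"
    obtain n where "- s < real n" using reals_Archimedean2 by blast
    then show "s \<in> (\<Union>n. {- real n<..0})" using \<open>s \<le> 0\<close> by (intro UN_I[of n]) auto
  qed auto
  ultimately show "{..0} \<in> null_sets (\<sigma> x)" by simp
qed auto

text \<open>The operator obtained by inserting the resolution into \<open>lower_step f k\<close>: a
  finite combination of spectral projections, linear and symmetric.\<close>

definition approx :: "(real \<Rightarrow> real) \<Rightarrow> nat \<Rightarrow> 'a \<Rightarrow> 'a" where
  "approx f k x = (\<Sum>i<k * k. f (real i / real k) *\<^sub>R band (real i / real k) (real (Suc i) / real k) x)"

lemma approx_add: "approx f k (x + y) = approx f k x + approx f k y"
  by (simp add: approx_def band_simps sum.distrib scaleR_add_right)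

lemma approx_diff: "approx f k (x - y) = approx f k x - approx f k y"
  by (simp add: approx_def band_simps sum_subtractf scaleR_diff_right)

lemma band_sym: "inner (band a b x) y = inner x (band a b y)"
  by (simp add: band_def inner_simps E_sym)

lemma approx_sym: "inner (approx f k x) y = inner x (approx f k y)"
  by (simp add: approx_def inner_sum_left inner_sum_right band_sym)

lemma grid_le: "real i / real k \<le> real (Suc i) / real k"
  by (intro divide_right_mono) auto

lemma inner_approx_self: "inner (approx f k x) x = (LINT s|\<sigma> x. lower_step f k s)"
proof -
  have "(LINT s|\<sigma> x. lower_step f k s)
      = (\<Sum>i<k * k. f (real i / real k) * measure (\<sigma> x) {real i / real k<..real (Suc i) / real k})"
    unfolding lower_step_def by (subst Bochner_Integration.integral_sum) (auto simp: emeasure_finite less_top[symmetric] intro!: integrable_mult_right)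
  then show ?thesis by (simp add: approx_def inner_sum_left measure_Ioc[OF grid_le] del: of_nat_Suc)
qed

text \<open>The isometry of the calculus on step functions. Two independent indices are needed to
  turn Cauchy sequences of operators into L^2 convergence.\<close>

lemma inner_approx_approx:
  "inner (approx f k x) (approx f l x) = (LINT s|\<sigma> x. lower_step f k s * lower_step f l s)"
proof -
  let ?I = "\<lambda>k i. {real i / real k<..real (Suc i) / real k}"
  have "(LINT s|\<sigma> x. lower_step f k s * lower_step f l s)
     = (LINT s|\<sigma> x. (\<Sum>i<k * k. \<Sum>j<l * l. (f (real i / real k) * f (real j / real l)) * indicator (?I k i \<inter> ?I l j) s))"
    unfolding lower_step_product ..
  also have "\<dots> = (\<Sum>i<k * k. \<Sum>j<l * l. (f (real i / real k) * f (real j / real l)) * measure (\<sigma> x) (?I k i \<inter> ?I l j))"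
  proof -
    have int: "integrable (\<sigma> x) (\<lambda>s. (f (real i / real k) * f (real j / real l)) * indicator (?I k i \<inter> ?I l j) s)" for i j
      by (intro integrable_mult_right integrable_real_indicator) (auto simp: emeasure_finite less_top[symmetric])
    have "(LINT s|\<sigma> x. (\<Sum>i<k * k. \<Sum>j<l * l. (f (real i / real k) * f (real j / real l)) * indicator (?I k i \<inter> ?I l j) s))
      = (\<Sum>i<k * k. \<Sum>j<l * l. LINT s|\<sigma> x. (f (real i / real k) * f (real j / real l)) * indicator (?I k i \<inter> ?I l j) s)"
      by (subst Bochner_Integration.integral_sum, intro Bochner_Integration.integrable_sum int,
          intro sum.cong refl Bochner_Integration.integral_sum int)
    then show ?thesis by simp
  qed
  also have "\<dots> = inner (approx f k x) (approx f l x)"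
    unfolding approx_def inner_sum_left unfolding inner_sum_right
    by (intro sum.cong refl) (simp add: inner_band_band[OF grid_le grid_le] del: of_nat_Suc Int_greaterThanAtMost)
  finally show ?thesis by simp
qed

text \<open>\<open>spectral_form\<close> is the polarization of the diagonal integrals, and a
  symmetric operator is recovered from its quadratic form by the same formula.\<close>

lemma inner_approx: "inner (approx f k x) z = spectral_form E (lower_step f k) x z"
proof -
  have "inner (approx f k z) x = inner (approx f k x) z"
    using approx_sym[of f k z x] by (simp add: inner_commute)
  then show ?thesis
    unfolding spectral_form_def inner_approx_self[symmetric]
    by (simp add: approx_add approx_diff inner_simps)
qed

lemma integrable_lower_step2: "integrable (\<sigma> x) (\<lambda>s. lower_step f k s * lower_step f l s)"
  unfolding lower_step_product
  by (intro Bochner_Integration.integrable_sum integrable_mult_right integrable_real_indicator) (auto simp: emeasure_finite less_top[symmetric])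

end

text \<open>Turns bounds that are uniform over truncations into membership in a spectral domain,
  keeping the constant.\<close>

lemma fatou_integrable:
  fixes f :: "'a \<Rightarrow> real"
  assumes lim: "AE x in M. (\<lambda>n. g n x) \<longlonglongrightarrow> f x"
    and f: "f \<in> borel_measurable M" "AE x in M. 0 \<le> f x"
    and g: "\<And>n. integrable M (g n)" "\<And>n. AE x in M. 0 \<le> g n x" "\<And>n::nat. integral\<^sup>L M (g n) \<le> K"
  shows "integrable M f" "integral\<^sup>L M f \<le> K"
proof -
  have gm [measurable]: "g n \<in> borel_measurable M" for n using g(1) by auto
  have K: "0 \<le> K" using integral_nonneg_AE[OF g(2)[of 0]] g(3)[of 0] by linarith
  have "(\<integral>\<^sup>+x. ennreal (f x) \<partial>M) = (\<integral>\<^sup>+x. liminf (\<lambda>n. ennreal (g n x)) \<partial>M)"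
  proof (rule nn_integral_cong_AE)
    show "AE x in M. ennreal (f x) = liminf (\<lambda>n. ennreal (g n x))"
      using lim by eventually_elim (rule lim_imp_Liminf[symmetric], auto intro: tendsto_ennrealI)
  qed
  also have "\<dots> \<le> liminf (\<lambda>n. \<integral>\<^sup>+x. ennreal (g n x) \<partial>M)"
    by (rule nn_integral_liminf) measurable
  also have "\<dots> \<le> ennreal K"
  proof -
    have "(\<integral>\<^sup>+x. ennreal (g n x) \<partial>M) \<le> ennreal K" for n
      using nn_integral_eq_integral[OF g(1) g(2)] g(3) K by (simp add: ennreal_leI)
    then have "liminf (\<lambda>n. \<integral>\<^sup>+x. ennreal (g n x) \<partial>M) \<le> liminf (\<lambda>n::nat. ennreal K)"
      by (intro Liminf_mono) auto
    then show ?thesis by (simp add: Liminf_const)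
  qed
  finally have le: "(\<integral>\<^sup>+x. ennreal (f x) \<partial>M) \<le> ennreal K" .
  then have "(\<integral>\<^sup>+x. ennreal (f x) \<partial>M) < \<infinity>" using le_less_trans[OF le] by simp
  then show int: "integrable M f" using f by (intro integrableI_nonneg) auto
  show "integral\<^sup>L M f \<le> K"
    using le nn_integral_eq_integral[OF int f(2)] K by simp
qed

lemma lower_step_bounds:
  assumes mono: "\<And>a b. 0 \<le> a \<Longrightarrow> a \<le> b \<Longrightarrow> f a \<le> f b" and f0: "0 \<le> f 0" and s: "0 < s"
  shows "0 \<le> lower_step f k s" "lower_step f k s \<le> f s"
proof -
  have fs: "0 \<le> f r" if "0 \<le> r" for r using mono[of 0 r] f0 that by simp
  consider "s \<le> real k" | "real k < s" by linarith
  then have "0 \<le> lower_step f k s \<and> lower_step f k s \<le> f s"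
  proof cases
    case 1
    show ?thesis using lower_step_eq(1)[OF s 1, of f] lower_step_eq(2)[OF s 1] by (auto intro!: fs mono)
  next
    case 2
    then show ?thesis using fs[of s] s by (simp add: lower_step_eq_0)
  qed
  then show "0 \<le> lower_step f k s" "lower_step f k s \<le> f s" by auto
qed

lemma lower_step_tendsto:
  assumes cont: "continuous_on {0..} f" and s: "0 < s"
  shows "(\<lambda>k. lower_step f k s) \<longlonglongrightarrow> f s"
proof -
  define x where "x k = real (nat \<lceil>s * real k\<rceil> - 1) / real k" for k
  obtain N where "s < real N" using reals_Archimedean2 by blast
  then have ev: "\<forall>\<^sub>F k in sequentially. s \<le> real k"
    by (intro eventually_sequentiallyI[of N]) (meson less_imp_le of_nat_le_iff order_trans)
  have "(\<lambda>k. s - 1 / real k) \<longlonglongrightarrow> s - 0" by (intro tendsto_intros lim_1_over_n)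
  then have x: "x \<longlonglongrightarrow> s"
  proof (intro tendsto_sandwich[of "\<lambda>k. s - 1 / real k" x sequentially "\<lambda>_. s"])
    show "\<forall>\<^sub>F k in sequentially. s - 1 / real k \<le> x k"
      using ev by eventually_elim (auto simp: x_def dest: lower_step_eq(3)[OF s])
    show "\<forall>\<^sub>F k in sequentially. x k \<le> s"
      using ev by eventually_elim (auto simp: x_def intro: less_imp_le dest: lower_step_eq(2)[OF s])
  qed auto
  have "(\<lambda>k. f (x k)) \<longlonglongrightarrow> f s"
    by (rule continuous_on_tendsto_compose[OF cont x]) (use s in \<open>auto simp: x_def\<close>)
  moreover have "\<forall>\<^sub>F k in sequentially. f (x k) = lower_step f k s"
    using ev by eventually_elim (simp add: x_def lower_step_eq(1)[OF s])
  ultimately show ?thesis by (rule Lim_transform_eventually)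
qed

context positive_resolution
begin

section \<open>Functional calculus for nonnegative, nondecreasing, continuous functions\<close>

context
  fixes f :: "real \<Rightarrow> real"
  assumes f_meas [measurable]: "f \<in> borel_measurable borel"
    and f_mono: "\<And>a b. 0 \<le> a \<Longrightarrow> a \<le> b \<Longrightarrow> f a \<le> f b"
    and f_cont: "continuous_on {0..} f" and f_0: "0 \<le> f 0"
begin

lemma AE_lower_step:
  "AE s in \<sigma> x. (\<lambda>k. lower_step f k s) \<longlonglongrightarrow> f s"
  "AE s in \<sigma> x. 0 \<le> lower_step f k s \<and> lower_step f k s \<le> f s"
  using AE_pos[of x] by (eventually_elim, simp add: lower_step_tendsto f_cont lower_step_bounds f_mono f_0)+

lemma norm_approx: "(norm (approx f k x))\<^sup>2 = (LINT s|\<sigma> x. (lower_step f k s)\<^sup>2)"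
  unfolding power2_norm_eq_inner inner_approx_approx by (simp add: power2_eq_square)

lemma integrable_lower_step_power2: "integrable (\<sigma> x) (\<lambda>s. (lower_step f k s)\<^sup>2)"
  using integrable_lower_step2[of x f k k] by (simp add: power2_eq_square)

lemma approx_norm_le:
  assumes "x \<in> spectral_domain E f"
  shows "(norm (approx f k x))\<^sup>2 \<le> (LINT s|\<sigma> x. (f s)\<^sup>2)"
  unfolding norm_approx
proof (rule integral_mono_AE)
  show "integrable (\<sigma> x) (\<lambda>s. (f s)\<^sup>2)" using assms by (simp add: spectral_domain_def)
  show "AE s in \<sigma> x. (lower_step f k s)\<^sup>2 \<le> (f s)\<^sup>2"
    using AE_lower_step(2)[where k = k] by eventually_elim (simp add: power_mono)
qed (rule integrable_lower_step_power2)

lemma spectral_domainI: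
  assumes "\<And>k. (norm (approx f k x))\<^sup>2 \<le> K"
  shows "x \<in> spectral_domain E f"
proof -
  have "AE s in \<sigma> x. (\<lambda>k. (lower_step f k s)\<^sup>2) \<longlonglongrightarrow> (f s)\<^sup>2"
    using AE_lower_step(1) by eventually_elim (rule tendsto_power)
  then have "integrable (\<sigma> x) (\<lambda>s. (f s)\<^sup>2)"
    by (rule fatou_integrable(1)[where K = K]) (use assms integrable_lower_step_power2 in \<open>auto simp: norm_approx\<close>)
  then show ?thesis by (simp add: spectral_domain_def)
qed

text \<open>The spectral measures are quadratic and not additive in the vector, so integrability
  cannot be added directly. It is passed through the step operators, which are linear, and recovered
  by \<open>spectral_domainI\<close>.\<close>

lemma spectral_domain_add_diff:
  assumes "x \<in> spectral_domain E f" "z \<in> spectral_domain E f"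
  shows "x + z \<in> spectral_domain E f" "x - z \<in> spectral_domain E f"
proof -
  let ?K = "2 * (LINT s|\<sigma> x. (f s)\<^sup>2) + 2 * (LINT s|\<sigma> z. (f s)\<^sup>2)"
  have le: "(norm (a + b))\<^sup>2 \<le> 2 * (norm a)\<^sup>2 + 2 * (norm b)\<^sup>2" "(norm (a - b))\<^sup>2 \<le> 2 * (norm a)\<^sup>2 + 2 * (norm b)\<^sup>2" for a b :: 'a
    using inner_ge_zero[of "a - b"] inner_ge_zero[of "a + b"]
    by (simp_all add: power2_norm_eq_inner inner_simps inner_commute)
  show "x + z \<in> spectral_domain E f"
    by (rule spectral_domainI[where K = ?K]) (use approx_norm_le[OF assms(1)] approx_norm_le[OF assms(2)] in
        \<open>auto simp: approx_add intro!: order_trans[OF le(1)] add_mono\<close>)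
  show "x - z \<in> spectral_domain E f"
    by (rule spectral_domainI[where K = ?K]) (use approx_norm_le[OF assms(1)] approx_norm_le[OF assms(2)] in
        \<open>auto simp: approx_diff intro!: order_trans[OF le(2)] add_mono\<close>)
qed

lemma integrable_f:
  assumes "x \<in> spectral_domain E f"
  shows "integrable (\<sigma> x) f"
proof (rule Bochner_Integration.integrable_bound)
  show "integrable (\<sigma> x) (\<lambda>s. 1 + (f s)\<^sup>2)" using assms by (simp add: spectral_domain_def)
  have "\<bar>a\<bar> \<le> 1 + a\<^sup>2" for a :: real
  proof -
    have "2 * \<bar>a\<bar> \<le> 1 + a\<^sup>2" using zero_le_power2[of "\<bar>a\<bar> - 1"] by (simp add: power2_diff)
    then show ?thesis using abs_ge_zero[of a] by linarith
  qed
  then show "AE s in \<sigma> x. norm (f s) \<le> norm (1 + (f s)\<^sup>2)" by simp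
qed simp

lemma integral_lower_step_tendsto:
  assumes "x \<in> spectral_domain E f"
  shows "(\<lambda>k. LINT s|\<sigma> x. lower_step f k s) \<longlonglongrightarrow> (LINT s|\<sigma> x. f s)"
proof (rule integral_dominated_convergence)
  show "AE s in \<sigma> x. norm (lower_step f k s) \<le> f s" for k
    using AE_lower_step(2)[where x = x and k = k] by eventually_elim simp
qed (use integrable_f[OF assms] AE_lower_step(1) in auto)

lemma integral_lower_step_diff:
  assumes "x \<in> spectral_domain E f"
  shows "integrable (\<sigma> x) (\<lambda>s. (lower_step f k s - f s)\<^sup>2)"
    and "(\<lambda>k. LINT s|\<sigma> x. (lower_step f k s - f s)\<^sup>2) \<longlonglongrightarrow> 0"
proof -
  have dom: "integrable (\<sigma> x) (\<lambda>s. (f s)\<^sup>2)" using assms by (simp add: spectral_domain_def)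
  have bd: "AE s in \<sigma> x. norm ((lower_step f k s - f s)\<^sup>2) \<le> (f s)\<^sup>2" for k
    using AE_lower_step(2)[where x = x and k = k]
  proof eventually_elim
    case (elim s)
    then have "\<bar>lower_step f k s - f s\<bar> \<le> \<bar>f s\<bar>" by simp
    then have "(lower_step f k s - f s)\<^sup>2 \<le> (f s)\<^sup>2" by (simp only: abs_le_square_iff)
    then show ?case by simp
  qed
  show "integrable (\<sigma> x) (\<lambda>s. (lower_step f k s - f s)\<^sup>2)"
    by (rule Bochner_Integration.integrable_bound[OF dom]) (use bd in auto)
  have "(\<lambda>k. LINT s|\<sigma> x. (lower_step f k s - f s)\<^sup>2) \<longlonglongrightarrow> (LINT s|\<sigma> x. 0)"
  proof (rule integral_dominated_convergence[OF _ _ dom _ bd])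
    show "AE s in \<sigma> x. (\<lambda>k. (lower_step f k s - f s)\<^sup>2) \<longlonglongrightarrow> 0"
      using AE_lower_step(1)[where x = x]
    proof eventually_elim
      case (elim s)
      have "(\<lambda>k. (lower_step f k s - f s)\<^sup>2) \<longlonglongrightarrow> (f s - f s)\<^sup>2" by (intro tendsto_intros elim)
      then show ?case by simp
    qed
  qed auto
  then show "(\<lambda>k. LINT s|\<sigma> x. (lower_step f k s - f s)\<^sup>2) \<longlonglongrightarrow> 0" by simp
qed

lemma approx_diff_norm_le:
  assumes x: "x \<in> spectral_domain E f"
  shows "(norm (approx f k x - approx f l x))\<^sup>2
    \<le> 2 * (LINT s|\<sigma> x. (lower_step f k s - f s)\<^sup>2) + 2 * (LINT s|\<sigma> x. (lower_step f l s - f s)\<^sup>2)"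
proof -
  note int = integrable_lower_step2[of x f] 
  have "(norm (approx f k x - approx f l x))\<^sup>2 = (LINT s|\<sigma> x. lower_step f k s * lower_step f k s
      - lower_step f k s * lower_step f l s - lower_step f l s * lower_step f k s + lower_step f l s * lower_step f l s)"
    unfolding power2_norm_eq_inner inner_diff_left inner_diff_right inner_approx_approx
    by (simp add: int mult.commute)
  also have "\<dots> = (LINT s|\<sigma> x. (lower_step f k s - lower_step f l s)\<^sup>2)"
    by (intro Bochner_Integration.integral_cong refl) (simp add: power2_eq_square algebra_simps)
  also have "\<dots> \<le> (LINT s|\<sigma> x. 2 * (lower_step f k s - f s)\<^sup>2 + 2 * (lower_step f l s - f s)\<^sup>2)"
  proof (rule integral_mono_AE')
    have "(a - b)\<^sup>2 \<le> 2 * (a - c)\<^sup>2 + 2 * (b - c)\<^sup>2" for a b c :: real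
      using zero_le_power2[of "(a - c) + (b - c)"] by (simp add: power2_eq_square algebra_simps)
    then show "AE s in \<sigma> x. (lower_step f k s - lower_step f l s)\<^sup>2 \<le> 2 * (lower_step f k s - f s)\<^sup>2 + 2 * (lower_step f l s - f s)\<^sup>2"
      by simp
  qed (use integral_lower_step_diff(1)[OF x] in auto)
  also have "\<dots> = 2 * (LINT s|\<sigma> x. (lower_step f k s - f s)\<^sup>2) + 2 * (LINT s|\<sigma> x. (lower_step f l s - f s)\<^sup>2)"
    using integral_lower_step_diff(1)[OF x] by simp
  finally show ?thesis .
qed

lemma Cauchy_approx:
  assumes x: "x \<in> spectral_domain E f"
  shows "Cauchy (\<lambda>k. approx f k x)"
proof (rule metric_CauchyI)
  fix e :: real assume e: "0 < e"
  then have "0 < e\<^sup>2 / 4" by simp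
  from LIMSEQ_D[OF integral_lower_step_diff(2)[OF x] this]
  obtain N where N: "\<And>k. k \<ge> N \<Longrightarrow> \<bar>LINT s|\<sigma> x. (lower_step f k s - f s)\<^sup>2\<bar> < e\<^sup>2 / 4" by auto
  have "dist (approx f k x) (approx f l x) < e" if "k \<ge> N" "l \<ge> N" for k l
  proof -
    have "(norm (approx f k x - approx f l x))\<^sup>2 < e\<^sup>2"
      using approx_diff_norm_le[OF x, of k l] N[OF that(1)] N[OF that(2)] by linarith
    then show ?thesis using e by (simp add: dist_norm power_less_imp_less_base)
  qed
  then show "\<exists>M. \<forall>m\<ge>M. \<forall>n\<ge>M. dist (approx f m x) (approx f n x) < e" by blast
qed

text \<open>The value is constructed as the norm limit of step operators, and the identities for
  form and norm are limits of those for step functions. The convergence is part of the conclusion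
  because it later shows that A commutes with the projections.\<close>

theorem functional_calculus:
  assumes x: "x \<in> spectral_domain E f"
  obtains y where "(\<lambda>k. approx f k x) \<longlonglongrightarrow> y" "has_spectral_integral E f x y"
    "(norm y)\<^sup>2 = (LINT s|\<sigma> x. (f s)\<^sup>2)" "inner y x = (LINT s|\<sigma> x. f s)"
proof -
  obtain y where y: "(\<lambda>k. approx f k x) \<longlonglongrightarrow> y"
    using Cauchy_convergent[OF Cauchy_approx[OF x]] by (auto simp: convergent_def)
  have "has_spectral_integral E f x y"
    unfolding has_spectral_integral_def
  proof (intro conjI ballI x)
    fix z assume z: "z \<in> spectral_domain E f"
    have "(\<lambda>k. inner (approx f k x) z) \<longlonglongrightarrow> spectral_form E f x z"
      unfolding inner_approx spectral_form_def
      by (intro tendsto_intros integral_lower_step_tendsto spectral_domain_add_diff x z) simp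
    moreover have "(\<lambda>k. inner (approx f k x) z) \<longlonglongrightarrow> inner y z" by (intro tendsto_intros y)
    ultimately show "inner y z = spectral_form E f x z" using LIMSEQ_unique by blast
  qed
  moreover have "(\<lambda>k. (norm (approx f k x))\<^sup>2) \<longlonglongrightarrow> (LINT s|\<sigma> x. (f s)\<^sup>2)"
    unfolding norm_approx
  proof (rule integral_dominated_convergence)
    show "AE s in \<sigma> x. norm ((lower_step f k s)\<^sup>2) \<le> (f s)\<^sup>2" for k
      using AE_lower_step(2)[where x = x and k = k] by eventually_elim (simp add: power_mono)
    show "AE s in \<sigma> x. (\<lambda>k. (lower_step f k s)\<^sup>2) \<longlonglongrightarrow> (f s)\<^sup>2"
      using AE_lower_step(1) by eventually_elim (rule tendsto_power)
  qed (use x in \<open>auto simp: spectral_domain_def\<close>)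
  then have "(norm y)\<^sup>2 = (LINT s|\<sigma> x. (f s)\<^sup>2)"
    using LIMSEQ_unique tendsto_power[OF tendsto_norm[OF y]] by blast
  moreover have "inner y x = (LINT s|\<sigma> x. f s)"
    using LIMSEQ_unique[OF tendsto_inner[OF y tendsto_const]] integral_lower_step_tendsto[OF x]
    by (simp add: inner_approx_self)
  ultimately show ?thesis using that y by blast
qed

lemma E_mem_spectral_domain: "E b x \<in> spectral_domain E f"
proof -
  have *: "E b x \<in> spectral_domain E f" if b: "0 \<le> b" for b
  proof -
    have "integrable (\<sigma> x) (\<lambda>s. indicator {0<..b} s * (f s)\<^sup>2)"
    proof (rule integrable_const_bound[where B = "(f b)\<^sup>2"])
      have "0 \<le> f s" if "0 \<le> s" for s using f_mono[of 0 s] f_0 that by simp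
      then show "AE s in \<sigma> x. norm (indicator {0<..b} s * (f s)\<^sup>2) \<le> (f b)\<^sup>2"
        using f_mono by (auto simp: indicator_def intro!: power_mono)
    qed auto
    then show ?thesis using b integral_band(1)[of 0 b "\<lambda>s. (f s)\<^sup>2" x] by (simp add: spectral_domain_def band_0)
  qed
  then show ?thesis using *[of b] *[of 0] E_nonpos[of b x] E_0 by (cases "0 \<le> b") auto
qed

lemma has_spectral_integral_unique:
  assumes "has_spectral_integral E f x y" "has_spectral_integral E f x y'"
  shows "y = y'"
proof -
  have "inner (y - y') (E (real n) z) = 0" for n z
    using assms E_mem_spectral_domain[of n z] by (simp add: has_spectral_integral_def inner_simps)
  moreover have "(\<lambda>n. inner (y - y') (E (real n) z)) \<longlonglongrightarrow> inner (y - y') z" for z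
    by (intro tendsto_inner tendsto_const E_seq)
  ultimately have "(\<lambda>n::nat. 0) \<longlonglongrightarrow> inner (y - y') z" for z by simp
  then have "inner (y - y') (y - y') = 0" using LIMSEQ_unique[OF _ tendsto_const] by blast
  then show ?thesis using inner_eq_zero_iff[of "y - y'"] by simp
qed

end

end

text \<open>\<open>\<nu>\<close> is any positive real lower bound of the form, not its infimum,
  which is infinite on the zero space.\<close>

locale positive_self_adjoint =
  fixes D :: "'h::{real_inner, complete_space} set" and A :: "'h \<Rightarrow> 'h" and E :: "real \<Rightarrow> 'h \<Rightarrow> 'h" and \<nu> :: real
  assumes self_adjoint: "self_adjoint_operator D A"
    and spectral: "is_spectral_resolution D A E"
    and \<nu>_pos: "0 < \<nu>"
    and form_ge: "x \<in> D \<Longrightarrow> \<nu> * (norm x)\<^sup>2 \<le> inner (A x) x"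
begin

lemma D_eq: "D = spectral_domain E (\<lambda>s. s)"
  and A_integral: "x \<in> D \<Longrightarrow> has_spectral_integral E (\<lambda>s. s) x (A x)"
  using spectral by (auto simp: is_spectral_resolution_def)

lemma A_sym: "x \<in> D \<Longrightarrow> y \<in> D \<Longrightarrow> inner (A x) y = inner x (A y)"
  and A_add: "x \<in> D \<Longrightarrow> y \<in> D \<Longrightarrow> A (x + y) = A x + A y"
  and A_scaleR: "x \<in> D \<Longrightarrow> A (a *\<^sub>R x) = a *\<^sub>R A x"
  and D_subspace: "subspace D"
  using self_adjoint by (auto simp: self_adjoint_operator_def)

sublocale resolution E
  by standard (use spectral in \<open>simp add: is_spectral_resolution_def\<close>)

lemma band_in_D:
  assumes "a \<le> b"
  shows "band a b x \<in> D"
proof -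
  have "integrable (spectral_measure E x) (\<lambda>s. indicator {a<..b} s * s\<^sup>2)"
  proof (rule integrable_const_bound[where B = "a\<^sup>2 + b\<^sup>2"])
    have "s\<^sup>2 \<le> a\<^sup>2 + b\<^sup>2" if "a < s" "s \<le> b" for s
    proof (cases "0 \<le> s")
      case True
      then have "s\<^sup>2 \<le> b\<^sup>2" using that by (intro power_mono)
      then show ?thesis using zero_le_power2[of a] by linarith
    next
      case False
      then have "(- s)\<^sup>2 \<le> (- a)\<^sup>2" using that by (intro power_mono) auto
      then show ?thesis using zero_le_power2[of b] unfolding power2_minus by linarith
    qed
    then show "AE s in spectral_measure E x. norm (indicator {a<..b} s * s\<^sup>2) \<le> a\<^sup>2 + b\<^sup>2"
      by (auto simp: indicator_def)
  qed auto
  then show ?thesis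
    using integral_band(1)[OF assms, of "\<lambda>s. s\<^sup>2" x] by (simp add: D_eq spectral_domain_def)
qed

text \<open>On the band (- n, 0] the form of A integrates the nonpositive function s, while
  coercivity bounds it below by \<nu> times the squared norm; so the band is trivial. Polarization
  at a repeated vector evaluates the measures of its double and of 0, the latter being null.\<close>

lemma E_zero: "E 0 x = 0"
proof -
  have "band (- real n) 0 x = 0" for n
  proof -
    let ?y = "band (- real n) 0 x"
    have y: "?y \<in> D" by (simp add: band_in_D)
    have int: "(LINT s|spectral_measure E (band (- real n) 0 z). s)
        = (LINT s|spectral_measure E z. indicator {- real n<..0} s * s)" for z
      using integral_band(2)[of "- real n" 0 "\<lambda>s. s" z] by simp
    have "(LINT s|spectral_measure E (x + x). indicator {- real n<..0} s * s) \<le> 0"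
      by (rule order_trans[OF integral_mono_AE'[of _ "\<lambda>_. 0"]]) (auto simp: indicator_def)
    moreover have "AE s in spectral_measure E 0. indicator {- real n<..0} s * s = 0"
      by (rule AE_I'[of UNIV]) (auto intro!: null_setsI simp: emeasure_UNIV)
    then have "(LINT s|spectral_measure E 0. indicator {- real n<..0} s * s) = 0"
      by (rule integral_eq_zero_AE)
    moreover have "?y + ?y = band (- real n) 0 (x + x)" "?y - ?y = band (- real n) 0 0"
      by (simp_all add: band_simps)
    moreover have "inner (A ?y) ?y = spectral_form E (\<lambda>s. s) ?y ?y"
      using A_integral[OF y] y unfolding has_spectral_integral_def D_eq by blast
    ultimately have "inner (A ?y) ?y \<le> 0"
      unfolding spectral_form_def using int[of "x + x"] int[of 0] by simp
    then have "\<nu> * (norm ?y)\<^sup>2 \<le> 0" using form_ge[OF y] by linarith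
    then show ?thesis using \<nu>_pos by (simp add: mult_le_0_iff)
  qed
  then have "E (- real n) x = E 0 x" for n by (simp add: band_def)
  moreover have "(\<lambda>n. E (- real n) x) \<longlonglongrightarrow> 0"
    by (rule filterlim_compose[OF E_bot]) (simp add: filterlim_uminus_at_top[symmetric] filterlim_real_sequentially filterlim_uminus_at_bot)
  ultimately have "(\<lambda>n::nat. E 0 x) \<longlonglongrightarrow> 0" by simp
  then show ?thesis by (simp add: LIMSEQ_const_iff)
qed

sublocale positive_resolution E
  by standard (rule E_zero)

lemma E_in_D: "0 \<le> b \<Longrightarrow> E b x \<in> D"
  using band_in_D[of 0 b x] by (simp add: band_0)

lemma A_calculus:
  assumes "x \<in> D"
  shows "(\<lambda>k. approx (\<lambda>s. s) k x) \<longlonglongrightarrow> A x" "(norm (A x))\<^sup>2 = (LINT s|\<sigma> x. s\<^sup>2)"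
    "inner (A x) x = (LINT s|\<sigma> x. s)"
proof -
  obtain y where y: "(\<lambda>k. approx (\<lambda>s. s) k x) \<longlonglongrightarrow> y" "has_spectral_integral E (\<lambda>s. s) x y"
    "(norm y)\<^sup>2 = (LINT s|\<sigma> x. s\<^sup>2)" "inner y x = (LINT s|\<sigma> x. s)"
    by (rule functional_calculus[of "\<lambda>s. s" x]) (use assms D_eq in auto)
  have "y = A x"
    by (rule has_spectral_integral_unique[OF _ _ _ _ y(2) A_integral[OF assms]]) auto
  with y show "(\<lambda>k. approx (\<lambda>s. s) k x) \<longlonglongrightarrow> A x" "(norm (A x))\<^sup>2 = (LINT s|\<sigma> x. s\<^sup>2)"
    "inner (A x) x = (LINT s|\<sigma> x. s)" by auto
qed

lemma band_approx: "band a b (approx f k x) = approx f k (band a b x)"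
  unfolding approx_def linear_sum[OF bounded_linear.linear[OF band_linear]] band_simps
  by (intro sum.cong refl arg_cong[where f = "scaleR _"] band_commute)

lemma band_A:
  assumes x: "x \<in> D" and ab: "a \<le> b"
  shows "band a b (A x) = A (band a b x)"
proof -
  have "(\<lambda>k. band a b (approx (\<lambda>s. s) k x)) \<longlonglongrightarrow> band a b (A x)"
    by (rule bounded_linear.tendsto[OF band_linear A_calculus(1)[OF x]])
  then show ?thesis
    unfolding band_approx by (rule LIMSEQ_unique[OF _ A_calculus(1)[OF band_in_D[OF ab]]])
qed

lemma E_A: "x \<in> D \<Longrightarrow> 0 \<le> b \<Longrightarrow> E b (A x) = A (E b x)"
  using band_A[of x 0 b] by (simp add: band_0)

text \<open>Because A commutes with bands, the mass of (a, b] is the squared norm of A applied to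
  the band of x, that is, the integral of s^2 over (a, b]. Higher powers of A then reduce to moments
  of one measure.\<close>

lemma \<sigma>_A:
  assumes x: "x \<in> D"
  shows "\<sigma> (A x) = density (\<sigma> x) (\<lambda>s. ennreal (s\<^sup>2))"
proof (rule \<sigma>_eqI)
  fix a b :: real assume ab: "a \<le> b"
  have int: "integrable (\<sigma> (band a b x)) (\<lambda>s. s\<^sup>2)"
    using band_in_D[OF ab] by (simp add: D_eq spectral_domain_def)
  have "emeasure (density (\<sigma> x) (\<lambda>s. ennreal (s\<^sup>2))) {a<..b} = (\<integral>\<^sup>+s. ennreal (s\<^sup>2) * indicator {a<..b} s \<partial>\<sigma> x)"
    by (rule emeasure_density) auto
  also have "\<dots> = (\<integral>\<^sup>+s. ennreal (indicator {a<..b} s * s\<^sup>2) \<partial>\<sigma> x)"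
    by (intro nn_integral_cong) (auto simp: indicator_def)
  also have "\<dots> = ennreal (LINT s|\<sigma> x. indicator {a<..b} s * s\<^sup>2)"
    using int integral_band(1)[OF ab, of "\<lambda>s. s\<^sup>2" x] by (intro nn_integral_eq_integral) auto
  also have "\<dots> = ennreal ((norm (A (band a b x)))\<^sup>2)"
    using integral_band(2)[OF ab, of "\<lambda>s. s\<^sup>2" x] A_calculus(2)[OF band_in_D[OF ab]] by simp
  also have "\<dots> = ennreal (inner (band a b (A x)) (A x))"
    using inner_band_self[OF ab, of "A x"] band_A[OF x ab] by simp
  finally show "emeasure (density (\<sigma> x) (\<lambda>s. ennreal (s\<^sup>2))) {a<..b} = ennreal (inner (band a b (A x)) (A x))" .
qed simp

lemma integral_A:
  assumes "x \<in> D" "f \<in> borel_measurable borel"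
  shows "(LINT s|\<sigma> (A x). f s) = (LINT s|\<sigma> x. s\<^sup>2 * f s)"
  using assms by (simp add: \<sigma>_A integral_density)

lemma integral_E:
  fixes f :: "real \<Rightarrow> real"
  assumes "0 \<le> b" "f \<in> borel_measurable borel"
  shows "(LINT s|\<sigma> (E b x). f s) = (LINT s|\<sigma> x. indicator {0<..b} s * f s)"
  using integral_band(2)[OF assms] by (simp add: band_0)

lemma A_E_bounded_linear:
  assumes b: "0 \<le> b"
  shows "bounded_linear (\<lambda>x. A (E b x))"
proof
  show "A (E b (x + y)) = A (E b x) + A (E b y)" for x y
    using b by (simp add: E_simps A_add E_in_D)
  show "A (E b (r *\<^sub>R x)) = r *\<^sub>R A (E b x)" for r x
    using b by (simp add: E_simps A_scaleR E_in_D)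
  have "norm (A (E b x)) \<le> norm x * b" for x
  proof -
    have "(norm (A (E b x)))\<^sup>2 = (LINT s|\<sigma> x. indicator {0<..b} s * s\<^sup>2)"
      using A_calculus(2)[OF E_in_D[OF b]] integral_E[OF b, of "\<lambda>s. s\<^sup>2"] by simp
    also have "\<dots> \<le> (LINT s|\<sigma> x. b\<^sup>2)"
    proof (rule integral_mono_AE')
      show "AE s in \<sigma> x. indicator {0<..b} s * s\<^sup>2 \<le> b\<^sup>2"
        by (rule AE_I2) (simp add: indicator_def power_mono)
    qed auto
    also have "\<dots> = (norm x * b)\<^sup>2"
      using emeasure_UNIV[of x] by (simp add: measure_def power_mult_distrib)
    finally show ?thesis by (rule power2_le_imp_le) (use b in simp)
  qed
  then show "\<exists>K. \<forall>x. norm (A (E b x)) \<le> norm x * K" by (intro exI[of _ b] allI)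
qed

lemma inner_A_E: "0 \<le> b \<Longrightarrow> inner (A (E b x)) (E b x) = (LINT s|\<sigma> x. indicator {0<..b} s * s)"
  using A_calculus(3)[OF E_in_D] integral_E[where b = b and f = "\<lambda>s. s" and x = x] by simp

lemma A_E_in_D:
  assumes "0 \<le> b"
  shows "A (E b x) \<in> D"
proof -
  have "E b (A (E b x)) = A (E b x)" using E_A[OF E_in_D[OF assms] assms] by simp
  moreover have "E b (A (E b x)) \<in> D" by (rule E_in_D[OF assms])
  ultimately show ?thesis by simp
qed

lemma inner_AAA_E:
  assumes "0 \<le> b"
  shows "inner (A (A (E b x))) (A (E b x)) = (LINT s|\<sigma> x. indicator {0<..b} s * s ^ 3)"
proof -
  have "(\<lambda>s::real. s\<^sup>2 * s) = (\<lambda>s. s ^ 3)" by (auto simp: power2_eq_square power3_eq_cube)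
  then show ?thesis
    using A_calculus(3)[OF A_E_in_D[OF assms], of x] integral_A[OF E_in_D[OF assms], of "\<lambda>s. s" x]
      integral_E[OF assms, of "\<lambda>s. s ^ 3" x] by simp
qed

lemma norm_AA_E:
  assumes "0 \<le> b"
  shows "(norm (A (A (E b x))))\<^sup>2 = (LINT s|\<sigma> x. indicator {0<..b} s * s ^ 4)"
proof -
  have "(\<lambda>s::real. s\<^sup>2 * s\<^sup>2) = (\<lambda>s. s ^ 4)" by (auto simp: power2_eq_square power4_eq_xxxx)
  then show ?thesis
    using A_calculus(2)[OF A_E_in_D[OF assms], of x] integral_A[OF E_in_D[OF assms], of "\<lambda>s. s\<^sup>2" x]
      integral_E[OF assms, of "\<lambda>s. s ^ 4" x] by simp
qed

text \<open>Supplies data bounds that do not see the cutoff \<open>b\<close>; used with m = 1, 3, 4,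
  the orders of the forms of A, A^3 and A^4.\<close>

lemma integral_indicator_le:
  assumes x: "x \<in> spectral_domain E (\<lambda>s. s powr \<alpha>)" and \<alpha>: "2 * \<alpha> = real m"
  shows "(LINT s|\<sigma> x. indicator {0<..b} s * s ^ m) \<le> (LINT s|\<sigma> x. (s powr \<alpha>)\<^sup>2)"
proof (rule integral_mono_AE')
  have "(s powr \<alpha>)\<^sup>2 = s ^ m" if "0 < s" for s
    using that \<alpha> by (simp add: power2_eq_square powr_add[symmetric] powr_realpow)
  then show "AE s in \<sigma> x. indicator {0<..b} s * s ^ m \<le> (s powr \<alpha>)\<^sup>2"
    by (auto simp: indicator_def)
qed (use x in \<open>auto simp: spectral_domain_def\<close>)

text \<open>The truncated forms are integrals of s over (0, n], and their integrands converge to s.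
  The Fatou lemma then yields domain and bound together, so nothing about the square root has to be
  known in advance.\<close>

lemma half_power:
  assumes K: "\<And>n::nat. inner (A (E n x)) (E n x) \<le> K"
  obtains y where "x \<in> spectral_domain E (\<lambda>s. s powr (1/2))"
    "has_spectral_integral E (\<lambda>s. s powr (1/2)) x y" "(norm y)\<^sup>2 \<le> K"
proof -
  let ?f = "\<lambda>s::real. s powr (1/2)"
  let ?g = "\<lambda>n s. indicator {0<..real n} s * s :: real"
  have f: "(?f s)\<^sup>2 = s" if "0 < s" for s using that by (simp add: power2_eq_square powr_add[symmetric])
  have lim: "AE s in \<sigma> x. (\<lambda>n. ?g n s) \<longlonglongrightarrow> (?f s)\<^sup>2"
    using AE_pos
  proof eventually_elim
    case (elim s)
    obtain N where "s < real N" using reals_Archimedean2 by blast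
    then have "\<forall>\<^sub>F n in sequentially. (?f s)\<^sup>2 = ?g n s"
      using elim f[OF elim] by (intro eventually_sequentiallyI[of N]) (auto simp: indicator_def)
    then show ?case by (rule Lim_transform_eventually[rotated]) simp
  qed
  have meas: "(\<lambda>s. (?f s)\<^sup>2) \<in> borel_measurable (\<sigma> x)" by measurable
  have int: "integrable (\<sigma> x) (?g n)" for n
    by (rule integrable_const_bound[where B = "real n"]) (auto simp: indicator_def)
  have nn: "AE s in \<sigma> x. 0 \<le> ?g n s" for n by (auto simp: indicator_def)
  have le: "integral\<^sup>L (\<sigma> x) (?g n) \<le> K" for n using K[of n] inner_A_E[of n x] by simp
  note fat = fatou_integrable[OF lim meas _ int nn le]
  have dom: "x \<in> spectral_domain E ?f" using fat(1) by (simp add: spectral_domain_def)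
  obtain y where y: "has_spectral_integral E ?f x y" "(norm y)\<^sup>2 = (LINT s|\<sigma> x. (?f s)\<^sup>2)"
  proof (rule functional_calculus[OF _ _ _ _ dom])
    show "continuous_on {0..} ?f" by (intro continuous_on_powr' continuous_intros) auto
  qed (auto intro: powr_mono2)
  then show ?thesis using that dom fat(2) by simp
qed

end

section \<open>Decay-error estimates\<close>

lemma at_within_half_line_neq_bot:
  fixes t :: real
  assumes "0 \<le> t"
  shows "at t within {0..} \<noteq> bot"
proof -
  have "t islimpt {0..}"
    unfolding islimpt_approachable
  proof (intro allI impI)
    fix e :: real assume "0 < e"
    then show "\<exists>x'\<in>{0..}. x' \<noteq> t \<and> dist x' t < e"
      using assms by (intro bexI[of _ "t + e / 2"]) (auto simp: dist_real_def)
  qed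
  then show ?thesis by (simp add: trivial_limit_within)
qed

text \<open>Multiplied by exp (B / \<epsilon>), the derivative of the corrector is constant on the
  half-line; its value is read off at 0.\<close>

lemma corrector_deriv:
  assumes \<theta>: "corrector p \<epsilon> w \<theta>" and \<epsilon>: "0 < \<epsilon>"
  shows "\<theta> 0 = 0"
    and "0 \<le> t \<Longrightarrow> (\<theta> has_vector_derivative exp (- damping_primitive p t / \<epsilon>) *\<^sub>R w) (at t within {0..})"
proof -
  obtain \<theta>' \<theta>'' where d: "\<And>t. 0 \<le> t \<Longrightarrow> (\<theta> has_vector_derivative \<theta>' t) (at t within {0..})"
      "\<And>t. 0 \<le> t \<Longrightarrow> (\<theta>' has_vector_derivative \<theta>'' t) (at t within {0..})"
    and eq: "\<And>t. 0 \<le> t \<Longrightarrow> \<epsilon> *\<^sub>R \<theta>'' t + (1 / (1 + t) powr p) *\<^sub>R \<theta>' t = 0"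
    and init: "\<theta> 0 = 0" "\<theta>' 0 = w"
    using \<theta> by (auto simp: corrector_def C1_half_line_def)
  show "\<theta> 0 = 0" by (rule init)
  let ?e = "\<lambda>t. exp (damping_primitive p t / \<epsilon>)"
  have "((\<lambda>t. ?e t *\<^sub>R \<theta>' t) has_vector_derivative 0) (at t within {0..})" if t: "t \<in> {0..}" for t
  proof -
    have t: "0 \<le> t" using t by simp
    have "((\<lambda>t. ?e t) has_real_derivative ?e t * ((1 + t) powr (- p) / \<epsilon>)) (at t within {0..})"
      by (intro DERIV_chain2[OF DERIV_exp] DERIV_cdivide damping_primitive_deriv t)
    from has_vector_derivative_scaleR[OF this d(2)[OF t]]
    have "((\<lambda>t. ?e t *\<^sub>R \<theta>' t) has_vector_derivative
        ?e t *\<^sub>R \<theta>'' t + (?e t * ((1 + t) powr (- p) / \<epsilon>)) *\<^sub>R \<theta>' t) (at t within {0..})" .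
    moreover have "?e t *\<^sub>R \<theta>'' t + (?e t * ((1 + t) powr (- p) / \<epsilon>)) *\<^sub>R \<theta>' t
        = (?e t / \<epsilon>) *\<^sub>R (\<epsilon> *\<^sub>R \<theta>'' t + (1 / (1 + t) powr p) *\<^sub>R \<theta>' t)"
      using \<epsilon> t by (simp add: scaleR_add_right powr_minus divide_inverse mult_ac)
    ultimately show ?thesis using eq[OF t] by simp
  qed
  then have "\<exists>c. \<forall>t\<in>{0..}. ?e t *\<^sub>R \<theta>' t = c"
    by (intro has_derivative_zero_constant) (auto simp: has_vector_derivative_def)
  then obtain c where c: "\<And>t. 0 \<le> t \<Longrightarrow> ?e t *\<^sub>R \<theta>' t = c" by auto
  have w: "?e t *\<^sub>R \<theta>' t = w" if "0 \<le> t" for t using c[of t] c[of 0] that init by simp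
  have "exp (- damping_primitive p t / \<epsilon>) *\<^sub>R w = \<theta>' t" if "0 \<le> t" for t
    unfolding w[OF that, symmetric] by (simp add: exp_add[symmetric])
  then show "(\<theta> has_vector_derivative exp (- damping_primitive p t / \<epsilon>) *\<^sub>R w) (at t within {0..})" if "0 \<le> t"
    using d(1)[OF that] that by simp
qed

text \<open>For p = 0 a negative rate follows from rate 0, which is admissible because \<kappa> > 0.
  For 0 < p < 1 the rate \<beta> (1 - p) against B is used, and the normalization B(0) = 0
  contributes the factor exp \<beta> to the constant. For p = 1 the exponential of B is a power of 1
  + t.\<close>

lemma decay_error_estimatesI:
  fixes \<kappa> :: ereal
  assumes p: "0 \<le> p" "p \<le> 1" and \<kappa>: "0 < \<kappa>"
    and decay: "\<And>\<beta>. 0 \<le> \<beta> \<Longrightarrow> (p = 0 \<Longrightarrow> ereal \<beta> < \<kappa>) \<Longrightarrow>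
      \<exists>\<epsilon>1 C. 0 < \<epsilon>1 \<and> \<epsilon>1 \<le> \<epsilon>0 \<and> (\<forall>\<epsilon> t. 0 < \<epsilon> \<longrightarrow> \<epsilon> < \<epsilon>1 \<longrightarrow> 0 \<le> t \<longrightarrow>
        \<Gamma> \<epsilon> t \<le> C * \<epsilon>\<^sup>2 * exp (- \<beta> * damping_primitive p t))"
  shows "decay_error_estimates p \<kappa> \<epsilon>0 \<Gamma>"
  unfolding decay_error_estimates_def
proof (intro conjI impI allI)
  fix \<beta> :: real assume p0: "p = 0" and \<beta>: "ereal \<beta> < \<kappa>"
  have "ereal (max \<beta> 0) < \<kappa>" using \<beta> \<kappa> by (simp add: max_def zero_ereal_def)
  then obtain \<epsilon>1 C where C: "0 < \<epsilon>1" "\<epsilon>1 \<le> \<epsilon>0" "\<And>\<epsilon> t. 0 < \<epsilon> \<Longrightarrow> \<epsilon> < \<epsilon>1 \<Longrightarrow> 0 \<le> t \<Longrightarrow>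
        \<Gamma> \<epsilon> t \<le> C * \<epsilon>\<^sup>2 * exp (- max \<beta> 0 * damping_primitive p t)"
    using decay[of "max \<beta> 0"] by auto
  have "\<Gamma> \<epsilon> t \<le> \<bar>C\<bar> * \<epsilon>\<^sup>2 * exp (- \<beta> * t)" if "0 < \<epsilon>" "\<epsilon> < \<epsilon>1" "0 \<le> t" for \<epsilon> t
  proof -
    have "\<beta> * t \<le> max \<beta> 0 * t" using that by (intro mult_right_mono) auto
    then have "exp (- max \<beta> 0 * t) \<le> exp (- \<beta> * t)" by simp
    then have "C * \<epsilon>\<^sup>2 * exp (- max \<beta> 0 * t) \<le> \<bar>C\<bar> * \<epsilon>\<^sup>2 * exp (- \<beta> * t)"
      by (intro mult_mono) auto
    moreover have t: "damping_primitive p t = t" using p0 that by (simp add: damping_primitive_def)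
    ultimately show ?thesis by (intro order_trans[OF C(3)[OF that, unfolded t]])
  qed
  then show "\<exists>\<epsilon>1 C. 0 < \<epsilon>1 \<and> \<epsilon>1 \<le> \<epsilon>0 \<and> (\<forall>\<epsilon> t. 0 < \<epsilon> \<longrightarrow> \<epsilon> < \<epsilon>1 \<longrightarrow> 0 \<le> t \<longrightarrow> \<Gamma> \<epsilon> t \<le> C * \<epsilon>\<^sup>2 * exp (- \<beta> * t))"
    using C by (intro exI[of _ \<epsilon>1] exI[of _ "\<bar>C\<bar>"]) auto
next
  fix \<beta> :: real assume p1: "0 < p \<and> p < 1" and \<beta>: "0 < \<beta>"
  then obtain \<epsilon>1 C where C: "0 < \<epsilon>1" "\<epsilon>1 \<le> \<epsilon>0" "\<And>\<epsilon> t. 0 < \<epsilon> \<Longrightarrow> \<epsilon> < \<epsilon>1 \<Longrightarrow> 0 \<le> t \<Longrightarrow>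
        \<Gamma> \<epsilon> t \<le> C * \<epsilon>\<^sup>2 * exp (- (\<beta> * (1 - p)) * damping_primitive p t)"
    using decay[of "\<beta> * (1 - p)"] by auto
  have "exp (- (\<beta> * (1 - p)) * damping_primitive p t) = exp \<beta> * exp (- \<beta> * (1 + t) powr (1 - p))" for t
  proof -
    have *: "(1 - p) * damping_primitive p t = (1 + t) powr (1 - p) - 1"
      using p1 by (simp add: damping_primitive_def)
    have "- (\<beta> * (1 - p)) * damping_primitive p t = - \<beta> * ((1 - p) * damping_primitive p t)" by simp
    also have "\<dots> = \<beta> + - \<beta> * (1 + t) powr (1 - p)" unfolding * by (simp add: algebra_simps)
    finally show ?thesis by (simp only: exp_add)
  qed
  then show "\<exists>\<epsilon>1 C. 0 < \<epsilon>1 \<and> \<epsilon>1 \<le> \<epsilon>0 \<and> (\<forall>\<epsilon> t. 0 < \<epsilon> \<longrightarrow> \<epsilon> < \<epsilon>1 \<longrightarrow> 0 \<le> t \<longrightarrow>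
      \<Gamma> \<epsilon> t \<le> C * \<epsilon>\<^sup>2 * exp (- \<beta> * (1 + t) powr (1 - p)))"
    using C by (intro exI[of _ \<epsilon>1] exI[of _ "C * exp \<beta>"]) (simp add: mult_ac)
next
  fix \<beta> :: real assume p1: "p = 1" and \<beta>: "0 < \<beta>"
  then obtain \<epsilon>1 C where C: "0 < \<epsilon>1" "\<epsilon>1 \<le> \<epsilon>0" "\<And>\<epsilon> t. 0 < \<epsilon> \<Longrightarrow> \<epsilon> < \<epsilon>1 \<Longrightarrow> 0 \<le> t \<Longrightarrow>
        \<Gamma> \<epsilon> t \<le> C * \<epsilon>\<^sup>2 * exp (- \<beta> * damping_primitive p t)"
    using decay[of \<beta>] by auto
  have "exp (- \<beta> * damping_primitive p t) = 1 / (1 + t) powr \<beta>" if "0 \<le> t" for t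
    using p1 that by (simp add: damping_primitive_def powr_def exp_minus divide_inverse)
  then show "\<exists>\<epsilon>1 C. 0 < \<epsilon>1 \<and> \<epsilon>1 \<le> \<epsilon>0 \<and> (\<forall>\<epsilon> t. 0 < \<epsilon> \<longrightarrow> \<epsilon> < \<epsilon>1 \<longrightarrow> 0 \<le> t \<longrightarrow>
      \<Gamma> \<epsilon> t \<le> C * \<epsilon>\<^sup>2 / (1 + t) powr \<beta>)"
    using C by (intro exI[of _ \<epsilon>1] exI[of _ C]) force
qed

lemma form_infimum_bound:
  fixes D :: "'h::real_inner set"
  assumes A: "self_adjoint_operator D A" and \<nu>: "ereal \<nu> \<le> form_infimum D A" and x: "x \<in> D"
  shows "\<nu> * (norm x)\<^sup>2 \<le> inner (A x) x"
proof (cases "x = 0")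
  case True
  then show ?thesis by simp
next
  case False
  define y where "y = (1 / norm x) *\<^sub>R x"
  have y: "y \<in> D" "norm y = 1" "A y = (1 / norm x) *\<^sub>R A x"
    using A x False by (auto simp: y_def self_adjoint_operator_def subspace_scale)
  have "ereal \<nu> \<le> ereal (inner (A y) y)"
    unfolding form_infimum_def by (rule order_trans[OF \<nu>[unfolded form_infimum_def] INF_lower]) (use y in simp)
  then have "\<nu> \<le> inner (A x) x / (norm x)\<^sup>2" unfolding y(3) by (simp add: y_def power2_eq_square)
  then show ?thesis using False by (simp add: pos_le_divide_eq)
qed

lemma (in positive_resolution) norm_le_of_E:
  assumes "\<And>n::nat. (norm (E n x))\<^sup>2 \<le> K"
  shows "(norm x)\<^sup>2 \<le> K"
proof (rule LIMSEQ_le_const2)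
  show "(\<lambda>n. (norm (E (real n) x))\<^sup>2) \<longlonglongrightarrow> (norm x)\<^sup>2" by (intro tendsto_intros E_seq)
qed (use assms in blast)

section \<open>Compression of the operator and of the two problems\<close>

context positive_self_adjoint
begin

text \<open>
  The second summand keeps the form above \<open>\<nu>\<close> off the range of \<open>E n\<close>.
\<close>

definition truncation :: "nat \<Rightarrow> 'h \<Rightarrow> 'h" where
  "truncation n x = A (E n x) + \<nu> *\<^sub>R (x - E n x)"

lemma truncation_E: "truncation n (E n x) = A (E n x)"
  by (simp add: truncation_def)

lemma truncation_A_E: "truncation n (A (E n x)) = A (A (E n x))"
proof -
  have "E n (A (E n x)) = A (E n x)" using E_A[OF E_in_D, of n n x] by simp
  then show ?thesis by (simp add: truncation_def)
qed

text \<open>The range of \<open>E n\<close> is invariant and orthogonal to its complement, so mixed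
  terms vanish; coercivity is \<open>form_ge\<close> on the first part and an equality on the
  second.\<close>

lemma truncation_form: "energy_form inner (truncation n) \<nu>"
proof
  have bl: "bounded_linear (truncation n)"
    unfolding truncation_def
    by (intro bounded_linear_add A_E_bounded_linear bounded_linear_const_scaleR bounded_linear_sub bounded_linear_ident linear) simp
  then show "\<And>x y. truncation n (x + y) = truncation n x + truncation n y"
    "\<And>r x. truncation n (r *\<^sub>R x) = r *\<^sub>R truncation n x"
    "\<exists>K. \<forall>x. norm (truncation n x) \<le> norm x * K"
    using linear_simps[OF bl] bounded_linear.bounded[OF bl] by auto
  have ran: "E n (A (E n x)) = A (E n x)" for x using E_A[OF E_in_D, of n n x] by simp
  have swap: "inner (A (E n x)) y = inner (A (E n x)) (E n y)" for x y
    using E_sym[of n "A (E n x)" y] ran[of x] by simp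
  show "inner (truncation n x) y = inner x (truncation n y)" for x y
    using swap[of x y] swap[of y x] A_sym[OF E_in_D E_in_D, of n n x y] E_sym[of n x y]
    by (simp add: truncation_def inner_simps inner_commute)
  show "\<nu> * inner x x \<le> inner (truncation n x) x" for x
  proof -
    have "\<nu> * inner x x = \<nu> * (norm (E n x))\<^sup>2 + \<nu> * inner (x - E n x) x"
      using E_sym[of n x x] E_sym[of n "E n x" x] by (simp add: power2_norm_eq_inner inner_simps algebra_simps inner_commute)
    also have "\<dots> \<le> inner (A (E n x)) (E n x) + \<nu> * inner (x - E n x) x"
      using form_ge[OF E_in_D, of n x] by simp
    finally show ?thesis using swap[of x x] by (simp add: truncation_def inner_simps)
  qed
  show "\<exists>K. \<forall>x y :: 'h. norm (inner x y) \<le> norm x * norm y * K"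
    by (rule bounded_bilinear.bounded[OF bounded_bilinear_inner])
qed (use \<nu>_pos in \<open>auto simp: inner_commute inner_simps\<close>)

text \<open>Membership in the domain of the square root comes out of the bound. This matters for
  \<open>r'\<close>, which is not placed there beforehand.\<close>

lemma power_half_bound:
  assumes E_def: "E = spectral_resolution D A" and K: "\<And>n::nat. inner (A (E n x)) (E n x) \<le> K"
  shows "(norm (power_operator D A (1/2) x))\<^sup>2 \<le> K"
proof -
  obtain y where y: "has_spectral_integral E (\<lambda>s. s powr (1/2)) x y" "(norm y)\<^sup>2 \<le> K"
    by (rule half_power[OF K])
  have "power_operator D A (1/2) x = y"
    unfolding power_operator_def E_def[symmetric]
  proof (rule the_equality[where P = "has_spectral_integral E (\<lambda>s. s powr (1/2)) x", OF y(1)])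
    fix z assume z: "has_spectral_integral E (\<lambda>s. s powr (1/2)) x z"
    show "z = y"
    proof (rule has_spectral_integral_unique[OF _ _ _ _ z y(1)])
      show "continuous_on {0..} (\<lambda>s::real. s powr (1/2))"
        by (intro continuous_on_powr' continuous_intros) auto
    qed (auto intro: powr_mono2)
  qed
  then show ?thesis using y(2) by simp
qed

end

text \<open>\<open>E n\<close> commutes with A on \<open>D\<close>, so both equations pass to a
  bounded operator. The choice of \<open>w\<close> is what makes \<open>s\<close> vanish at 0, while
  \<open>v\<close> vanishes there because the two solutions start at the same point.\<close>

lemma (in positive_self_adjoint) truncated_band_problem:
  fixes u u' ue ue' ue'' :: "real \<Rightarrow> 'h" and n :: nat
  assumes p: "0 \<le> p" "p \<le> 1" and \<epsilon>: "0 < \<epsilon>" and \<mu>: "0 < \<mu>"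
    and c: "\<And>t. 0 \<le> t \<Longrightarrow> (c has_vector_derivative c' t) (at t within {0..})"
      "\<And>t. 0 \<le> t \<Longrightarrow> \<mu> \<le> c t \<and> c t \<le> M1" "\<And>t. 0 \<le> t \<Longrightarrow> \<bar>c' t\<bar> \<le> M2"
    and k: "\<And>t. 0 \<le> t \<Longrightarrow> (k has_vector_derivative k' t) (at t within {0..})"
      "\<And>t. 0 \<le> t \<Longrightarrow> \<mu> \<le> k t \<and> k t \<le> M3" "\<And>t. 0 \<le> t \<Longrightarrow> \<bar>k' t\<bar> \<le> M4 / (1 + t) powr p"
      "\<And>t. 0 \<le> t \<Longrightarrow> \<bar>k t - c t\<bar> \<le> M5 * \<epsilon>"
    and u: "\<And>t. 0 \<le> t \<Longrightarrow> (u has_vector_derivative u' t) (at t within {0..})" "\<And>t. 0 \<le> t \<Longrightarrow> u t \<in> D"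
      "\<And>t. 0 \<le> t \<Longrightarrow> (1 / (1 + t) powr p) *\<^sub>R u' t + c t *\<^sub>R A (u t) = 0"
    and ue: "\<And>t. 0 \<le> t \<Longrightarrow> (ue has_vector_derivative ue' t) (at t within {0..})"
      "\<And>t. 0 \<le> t \<Longrightarrow> (ue' has_vector_derivative ue'' t) (at t within {0..})" "\<And>t. 0 \<le> t \<Longrightarrow> ue t \<in> D"
      "\<And>t. 0 \<le> t \<Longrightarrow> \<epsilon> *\<^sub>R ue'' t + (1 / (1 + t) powr p) *\<^sub>R ue' t + k t *\<^sub>R A (ue t) = 0"
    and init: "ue 0 = u 0" and w: "w = ue' 0 + c 0 *\<^sub>R A (u 0)"
  obtains s s' where
    "band_problem inner (truncation n) \<nu> p \<mu> M1 M2 M3 M4 M5 \<epsilon> c c' k k'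
       (\<lambda>t. E n (u t)) (\<lambda>t. E n (ue t - u t)) s s' (E n w)"
    "\<forall>t\<ge>0. s t = E n (ue' t - u' t - exp (- damping_primitive p t / \<epsilon>) *\<^sub>R w)"
proof -
  interpret tr: energy_form inner "truncation n" \<nu> by (rule truncation_form)
  define R where "R t = (1 + t) powr p" for t
  define b where "b t = (1 + t) powr (- p)" for t
  define a where "a t = p * (1 + t) powr (p - 1) * c t + R t * c' t" for t
  define e where "e t = exp (- damping_primitive p t / \<epsilon>)" for t
  define U where "U t = E n (u t)" for t
  define v where "v t = E n (ue t - u t)" for t
  \<comment> \<open>The derivative of u is replaced by its expression from the compressed equation,
    since this expression can be differentiated once more while u' is only known to exist.\<close>
  define s where "s t = E n (ue' t) + (R t * c t) *\<^sub>R truncation n (U t) - e t *\<^sub>R E n w" for t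
  define s' where "s' t = E n (ue'' t) + ((R t * c t) *\<^sub>R truncation n (- (R t * c t) *\<^sub>R truncation n (U t))
      + a t *\<^sub>R truncation n (U t)) - (e t * (- b t / \<epsilon>)) *\<^sub>R E n w" for t
  have AE: "E n (A x) = truncation n (E n x)" if "x \<in> D" for x
    using E_A[OF that, of n] by (simp add: truncation_E)
  have Rb: "R t * b t = 1" "1 / R t = b t" "0 < R t" if "0 \<le> t" for t
    using that by (auto simp: R_def b_def powr_minus field_simps)
  have u'_eq: "u' t = - (R t * c t) *\<^sub>R A (u t)" if t: "0 \<le> t" for t
  proof -
    have "R t *\<^sub>R (b t *\<^sub>R u' t + c t *\<^sub>R A (u t)) = 0" using u(3)[OF t] Rb(2)[OF t] by (simp add: R_def)
    then have "u' t + (R t * c t) *\<^sub>R A (u t) = 0" using Rb(1)[OF t] by (simp add: scaleR_add_right)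
    then show ?thesis by (simp add: add_eq_0_iff)
  qed
  have Eu': "E n (u' t) = - (R t * c t) *\<^sub>R truncation n (U t)" if t: "0 \<le> t" for t
    unfolding u'_eq[OF t] U_def by (simp add: E_simps AE u t)
  have U': "(U has_vector_derivative - (R t * c t) *\<^sub>R truncation n (U t)) (at t within {0..})" if t: "0 \<le> t" for t
    unfolding Eu'[OF t, symmetric] unfolding U_def by (rule bounded_linear.has_vector_derivative[OF linear u(1)[OF t]])
  have e': "(e has_real_derivative e t * (- b t / \<epsilon>)) (at t within {0..})" if t: "0 \<le> t" for t
    unfolding e_def b_def
    by (intro DERIV_chain2[OF DERIV_exp] DERIV_cdivide DERIV_minus damping_primitive_deriv t)
  have s_eq: "s t = E n (ue' t - u' t - e t *\<^sub>R w)" if t: "0 \<le> t" for t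
    unfolding s_def by (simp add: E_simps Eu'[OF t])
  have "band_problem inner (truncation n) \<nu> p \<mu> M1 M2 M3 M4 M5 \<epsilon> c c' k k' U v s s' (E n w)"
  proof (intro band_problem.intro band_problem_axioms.intro truncation_form)
    fix t :: real assume t: "0 \<le> t"
    show "(c has_real_derivative c' t) (at t within {0..})" "(k has_real_derivative k' t) (at t within {0..})"
      using c(1)[OF t] k(1)[OF t] by (simp_all add: has_real_derivative_iff_has_vector_derivative)
    show "\<bar>k' t\<bar> \<le> M4 * (1 + t) powr - p" using k(3)[OF t] t by (simp add: powr_minus divide_inverse)
    show "(U has_vector_derivative - ((1 + t) powr p * c t) *\<^sub>R truncation n (U t)) (at t within {0..})"
      using U'[OF t] by (simp add: R_def)
    have "(v has_vector_derivative E n (ue' t - u' t)) (at t within {0..})"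
      unfolding v_def
      by (intro bounded_linear.has_vector_derivative[OF linear] has_vector_derivative_diff u(1) ue(1) t)
    then show "(v has_vector_derivative s t + exp (- damping_primitive p t / \<epsilon>) *\<^sub>R E n w) (at t within {0..})"
      using s_eq[OF t] by (simp add: E_simps e_def)
    have "((\<lambda>t. R t * c t) has_real_derivative p * (1 + t) powr (p - 1) * c t + c' t * R t) (at t within {0..})"
      unfolding R_def using c(1)[OF t]
      by (intro DERIV_mult powr_half_line_deriv t) (simp add: has_real_derivative_iff_has_vector_derivative)
    then have Rc': "((\<lambda>t. R t * c t) has_real_derivative a t) (at t within {0..})"
      by (simp add: a_def mult.commute)
    have ew: "((\<lambda>t. e t *\<^sub>R E n w) has_vector_derivative (e t * (- b t / \<epsilon>)) *\<^sub>R E n w) (at t within {0..})"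
      using has_vector_derivative_scaleR[OF e'[OF t] has_vector_derivative_const[of "E n w"]] by simp
    show "(s has_vector_derivative s' t) (at t within {0..})"
      unfolding s_def s'_def
      by (intro has_vector_derivative_diff has_vector_derivative_add bounded_linear.has_vector_derivative[OF linear]
          has_vector_derivative_scaleR[OF Rc'] bounded_linear.has_vector_derivative[OF tr.linear] U' ue(2) t ew)
    have "E n (\<epsilon> *\<^sub>R ue'' t + b t *\<^sub>R ue' t + k t *\<^sub>R A (ue t)) = 0"
      using ue(4)[OF t] Rb(2)[OF t] E_simps by (simp add: R_def)
    then have ode: "\<epsilon> *\<^sub>R E n (ue'' t) = - (b t *\<^sub>R E n (ue' t)) - k t *\<^sub>R truncation n (v t + U t)"
      using AE[OF ue(3)[OF t]] by (simp add: E_simps v_def U_def eq_neg_iff_add_eq_0 algebra_simps)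
    have bR: "b t * (R t * c t) = c t" using Rb(1)[OF t] by (metis mult.assoc mult.commute mult_1)
    have "\<epsilon> *\<^sub>R s' t = \<epsilon> *\<^sub>R E n (ue'' t) - \<epsilon> *\<^sub>R ((R t * c t)\<^sup>2 *\<^sub>R truncation n (truncation n (U t)) - a t *\<^sub>R truncation n (U t))
        + (b t * e t) *\<^sub>R E n w"
      using \<epsilon> by (simp add: s'_def tr.B_simps power2_eq_square algebra_simps)
    \<comment> \<open>The layer term b e w is absorbed by - b s, as the corrector solves the
      equation without A, and b R c = c combines the two terms in B U into the mismatch k -
      c.\<close>
    also have "\<dots> = - (b t *\<^sub>R s t) - k t *\<^sub>R truncation n (v t) - (k t - c t) *\<^sub>R truncation n (U t)
        - \<epsilon> *\<^sub>R ((R t * c t)\<^sup>2 *\<^sub>R truncation n (truncation n (U t)) - a t *\<^sub>R truncation n (U t))"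
      unfolding ode s_def scaleR_add_right scaleR_diff_right scaleR_scaleR bR tr.B_simps
      by (simp add: algebra_simps)
    finally show "\<epsilon> *\<^sub>R s' t = - ((1 + t) powr - p *\<^sub>R s t) - k t *\<^sub>R truncation n (v t) - (k t - c t) *\<^sub>R truncation n (U t)
      - \<epsilon> *\<^sub>R (((1 + t) powr p * c t)\<^sup>2 *\<^sub>R truncation n (truncation n (U t))
        - (p * (1 + t) powr (p - 1) * c t + (1 + t) powr p * c' t) *\<^sub>R truncation n (U t))"
      by (simp add: a_def R_def b_def)
  next
    show "v 0 = 0" by (simp add: v_def init E_simps)
    have "u 0 \<in> D" using u(2) by simp
    then show "s 0 = 0" by (simp add: s_def e_def R_def U_def w E_simps AE)
  qed (use p \<epsilon> \<mu> c k in auto)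
  then show ?thesis using that s_eq unfolding U_def v_def e_def by blast
qed

lemma (in resolution) norm_E_le: "norm (E s x) \<le> norm x"
proof -
  have "norm (E s x) * norm (E s x) = inner (E s x) x"
    using E_sym[of s "E s x" x] by (simp add: power2_norm_eq_inner[symmetric] power2_eq_square[symmetric] inner_commute)
  also have "\<dots> \<le> norm (E s x) * norm x" by (rule norm_cauchy_schwarz)
  finally show ?thesis by (cases "norm (E s x) = 0") auto
qed

section \<open>Bounds of the compressed data, uniform in the compression\<close>

context positive_self_adjoint
begin

lemma truncated_form_add_le:
  fixes n :: nat
  shows "inner (A (E n (x + a *\<^sub>R y))) (E n (x + a *\<^sub>R y)) \<le> 2 * inner (A (E n x)) (E n x) + 2 * a\<^sup>2 * inner (A (E n y)) (E n y)"
proof -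
  interpret tr: energy_form "\<lambda>x y. inner (truncation n x) y" "truncation n" \<nu>
    by (rule energy_form.derived_form[OF truncation_form])
  show ?thesis
    unfolding truncation_E[symmetric] unfolding E_simps
    using tr.I_add_le[of "E n x" "a *\<^sub>R E n y"]
    by (simp add: tr.B_simps power2_eq_square mult.assoc)
qed

text \<open>The inputs of the energy estimate for the inner product. As \<open>w\<close> contains A
  u0, its form needs A^(3/2) u0, the same quantity as the initial parabolic energy.\<close>

lemma strong_data_bounds:
  fixes n :: nat and a :: real and u0 u1 :: 'h
  assumes u0: "u0 \<in> D" "u0 \<in> spectral_domain E (\<lambda>s. s powr (3/2))" and u1: "u1 \<in> spectral_domain E (\<lambda>s. s powr (1/2))"
  defines "w \<equiv> E n (u1 + a *\<^sub>R A u0)" and "K \<equiv> LINT s|\<sigma> u0. (s powr (3/2))\<^sup>2"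
  shows "inner w w \<le> (norm (u1 + a *\<^sub>R A u0))\<^sup>2"
    and "inner (truncation n w) w \<le> 2 * (LINT s|\<sigma> u1. (s powr (1/2))\<^sup>2) + 2 * a\<^sup>2 * K"
    and "inner (truncation n (truncation n (E n u0))) (truncation n (E n u0)) \<le> K"
proof -
  have K: "inner (A (A (E n u0))) (A (E n u0)) \<le> K"
    unfolding K_def inner_AAA_E[OF of_nat_0_le_iff] by (rule integral_indicator_le[OF u0(2)]) simp
  then show "inner (truncation n (truncation n (E n u0))) (truncation n (E n u0)) \<le> K"
    by (simp add: truncation_E truncation_A_E)
  show "inner w w \<le> (norm (u1 + a *\<^sub>R A u0))\<^sup>2"
    unfolding w_def power2_norm_eq_inner[symmetric] by (intro power_mono norm_E_le) auto
  have 1: "inner (A (E n u1)) (E n u1) \<le> (LINT s|\<sigma> u1. (s powr (1/2))\<^sup>2)"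
    unfolding inner_A_E[OF of_nat_0_le_iff] using integral_indicator_le[OF u1, of 1] by simp
  have "inner (truncation n w) w \<le> 2 * inner (A (E n u1)) (E n u1) + 2 * a\<^sup>2 * inner (A (E n (A u0))) (E n (A u0))"
    unfolding w_def truncation_E by (rule truncated_form_add_le)
  also have "\<dots> \<le> 2 * (LINT s|\<sigma> u1. (s powr (1/2))\<^sup>2) + 2 * a\<^sup>2 * K"
    using K 1 by (intro add_mono mult_left_mono) (auto simp: E_A[OF u0(1)])
  finally show "inner (truncation n w) w \<le> 2 * (LINT s|\<sigma> u1. (s powr (1/2))\<^sup>2) + 2 * a\<^sup>2 * K" .
qed

text \<open>The inputs for the derived form, one half power of A higher: A w now involves A^2 u0 and
  A u1.\<close>

lemma smooth_data_bounds:
  fixes n :: nat and a :: real and u0 u1 :: 'h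
  assumes u0: "u0 \<in> D" "u0 \<in> spectral_domain E (\<lambda>s. s powr 2)" and u1: "u1 \<in> D"
  defines "w \<equiv> E n (u1 + a *\<^sub>R A u0)" and "K \<equiv> LINT s|\<sigma> u0. (s powr 2)\<^sup>2"
  shows "inner (truncation n w) (truncation n w) \<le> 2 * (norm (A u1))\<^sup>2 + 2 * a\<^sup>2 * K"
    and "inner (truncation n (truncation n (E n u0))) (truncation n (truncation n (E n u0))) \<le> K"
proof -
  interpret tr: energy_form inner "truncation n" \<nu> by (rule truncation_form)
  have K: "(norm (A (A (E n u0))))\<^sup>2 \<le> K"
    unfolding K_def norm_AA_E[OF of_nat_0_le_iff] by (rule integral_indicator_le[OF u0(2)]) simp
  then show "inner (truncation n (truncation n (E n u0))) (truncation n (truncation n (E n u0))) \<le> K"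
    by (simp add: truncation_E truncation_A_E power2_norm_eq_inner)
  have w: "truncation n w = A (E n u1) + a *\<^sub>R A (A (E n u0))"
    by (simp add: w_def E_simps tr.B_simps truncation_E E_A[OF u0(1)] truncation_A_E)
  have "norm (A (E n u1)) \<le> norm (A u1)" using norm_E_le[of n "A u1"] E_A[OF u1, of n] by simp
  then have "(norm (A (E n u1)))\<^sup>2 \<le> (norm (A u1))\<^sup>2" by (intro power_mono) auto
  moreover have "a\<^sup>2 * (norm (A (A (E n u0))))\<^sup>2 \<le> a\<^sup>2 * K" using K by (intro mult_left_mono) auto
  moreover have "inner (truncation n w) (truncation n w) \<le> 2 * (norm (A (E n u1)))\<^sup>2 + 2 * (a\<^sup>2 * (norm (A (A (E n u0))))\<^sup>2)"
    unfolding w power2_norm_eq_inner using tr.I_add_le[of "A (E n u1)" "a *\<^sub>R A (A (E n u0))"]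
    by (simp add: power2_eq_square mult.assoc)
  ultimately show "inner (truncation n w) (truncation n w) \<le> 2 * (norm (A u1))\<^sup>2 + 2 * a\<^sup>2 * K" by linarith
qed

end

theorem theorem2p10:
  fixes D :: "'h::{real_inner, complete_space} set"
    and A :: "'h \<Rightarrow> 'h"
    and p \<epsilon>0 \<mu> M1 M2 M3 M4 M5 :: real
    and \<nu> :: ereal
    and c c' :: "real \<Rightarrow> real"
    and ce ce' :: "real \<Rightarrow> real \<Rightarrow> real"
    and u0 u1 :: 'h
    and u :: "real \<Rightarrow> 'h"
    and ue \<theta> r \<rho> :: "real \<Rightarrow> real \<Rightarrow> 'h"
  assumes A: "self_adjoint_operator D A"
    and \<nu>: "\<nu> = form_infimum D A" "\<nu> > 0"
    and p: "0 \<le> p" "p \<le> 1"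
    and u0: "u0 \<in> D"
    and u1: "u1 \<in> power_domain D A (1/2)"
    and \<epsilon>0: "\<epsilon>0 > 0"
    and \<mu>: "\<mu> > 0"
    and c_C1: "C1_half_line c c'"
    and c_bounds: "\<And>t. 0 \<le> t \<Longrightarrow> \<mu> \<le> c t \<and> c t \<le> M1"
    and c'_bound: "\<And>t. 0 \<le> t \<Longrightarrow> \<bar>c' t\<bar> \<le> M2"
    and ce_C1: "\<And>\<epsilon>. 0 < \<epsilon> \<Longrightarrow> \<epsilon> < \<epsilon>0 \<Longrightarrow> C1_half_line (ce \<epsilon>) (ce' \<epsilon>)"
    and ce_bounds: "\<And>\<epsilon> t. 0 < \<epsilon> \<Longrightarrow> \<epsilon> < \<epsilon>0 \<Longrightarrow> 0 \<le> t \<Longrightarrow> \<mu> \<le> ce \<epsilon> t \<and> ce \<epsilon> t \<le> M3"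
    and ce'_bound: "\<And>\<epsilon> t. 0 < \<epsilon> \<Longrightarrow> \<epsilon> < \<epsilon>0 \<Longrightarrow> 0 \<le> t \<Longrightarrow> \<bar>ce' \<epsilon> t\<bar> \<le> M4 / (1 + t) powr p"
    and ce_c: "\<And>\<epsilon> t. 0 < \<epsilon> \<Longrightarrow> \<epsilon> < \<epsilon>0 \<Longrightarrow> 0 \<le> t \<Longrightarrow> \<bar>ce \<epsilon> t - c t\<bar> \<le> M5 * \<epsilon>"
    and u: "parabolic_solution D A p c u0 u"
    and ue: "\<And>\<epsilon>. 0 < \<epsilon> \<Longrightarrow> \<epsilon> < \<epsilon>0 \<Longrightarrow> hyperbolic_solution D A p \<epsilon> (ce \<epsilon>) u0 u1 (ue \<epsilon>)"
    and \<theta>: "\<And>\<epsilon>. 0 < \<epsilon> \<Longrightarrow> \<epsilon> < \<epsilon>0 \<Longrightarrow> corrector p \<epsilon> (u1 + c 0 *\<^sub>R A u0) (\<theta> \<epsilon>)"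
    and r: "\<And>\<epsilon> t. 0 < \<epsilon> \<Longrightarrow> \<epsilon> < \<epsilon>0 \<Longrightarrow> 0 \<le> t \<Longrightarrow> ue \<epsilon> t = u t + \<theta> \<epsilon> t + r \<epsilon> t"
    and \<rho>: "\<And>\<epsilon> t. 0 < \<epsilon> \<Longrightarrow> \<epsilon> < \<epsilon>0 \<Longrightarrow> 0 \<le> t \<Longrightarrow> ue \<epsilon> t = u t + \<rho> \<epsilon> t"
  shows "(u0 \<in> power_domain D A (3/2) \<and> u1 \<in> power_domain D A (1/2) \<longrightarrow>
            decay_error_estimates p (ereal (2 * \<mu>) * \<nu>) \<epsilon>0
              (\<lambda>\<epsilon>. Gamma_r D A \<epsilon> (\<rho> \<epsilon>) (r \<epsilon>))) \<and>
         (u0 \<in> power_domain D A 2 \<and> u1 \<in> D \<longrightarrow>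
            decay_error_estimates p (ereal (2 * \<mu>) * \<nu>) \<epsilon>0
              (\<lambda>\<epsilon>. Gamma_c D A \<epsilon> (\<rho> \<epsilon>) (r \<epsilon>)))"
proof -
  define E where "E = spectral_resolution D A"
  define \<kappa> where "\<kappa> = ereal (2 * \<mu>) * \<nu>"
  define w where "w = u1 + c 0 *\<^sub>R A u0"
  \<comment> \<open>The hypothesis on \<open>u1\<close> carries the existence of a spectral
    resolution in the first conjunct of \<open>power_domain\<close>.\<close>
  have spectral: "is_spectral_resolution D A E" using u1 by (simp add: power_domain_def E_def)
  have domain: "x \<in> spectral_domain E (\<lambda>s. s powr \<alpha>)" if "x \<in> power_domain D A \<alpha>" for x \<alpha>
    using that by (simp add: power_domain_def E_def)
  have \<kappa>: "0 < \<kappa>" using \<nu>(2) \<mu> by (simp add: \<kappa>_def ereal_zero_less_0_iff)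
  obtain u' where u': "\<And>t. 0 \<le> t \<Longrightarrow> (u has_vector_derivative u' t) (at t within {0..})"
      "\<And>t. 0 \<le> t \<Longrightarrow> u t \<in> D" "\<And>t. 0 \<le> t \<Longrightarrow> (1 / (1 + t) powr p) *\<^sub>R u' t + c t *\<^sub>R A (u t) = 0" "u 0 = u0"
    using u by (auto simp: parabolic_solution_def C1_half_line_def C0_into_domain_def)
  \<comment> \<open>The estimates need a real coercivity constant for which \<beta> is below the
    threshold when p = 0. A finite infimum is taken itself; an infinite one allows any constant, and
    \<beta> / (2 \<mu>) + 1 suffices.\<close>
  have rate: "\<exists>\<nu>'. 0 < \<nu>' \<and> (p = 0 \<longrightarrow> \<beta> < 2 * \<mu> * \<nu>') \<and> positive_self_adjoint D A E \<nu>'"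
    if \<beta>: "0 \<le> \<beta>" "p = 0 \<Longrightarrow> ereal \<beta> < \<kappa>" for \<beta>
  proof -
    have "\<exists>\<nu>'. 0 < \<nu>' \<and> (p = 0 \<longrightarrow> \<beta> < 2 * \<mu> * \<nu>') \<and> ereal \<nu>' \<le> \<nu>"
    proof (cases \<nu>)
      case (real x)
      then show ?thesis using \<nu>(2) \<beta>(2) by (intro exI[of _ x]) (auto simp: \<kappa>_def)
    next
      case PInf
      have "\<beta> < 2 * \<mu> * (\<beta> / (2 * \<mu>) + 1)" using \<mu> by (simp add: field_simps)
      then show ?thesis using PInf \<mu> \<beta>(1) by (intro exI[of _ "\<beta> / (2 * \<mu>) + 1"]) (auto intro: add_nonneg_pos)
    qed (use \<nu>(2) in auto)
    then obtain \<nu>' where n: "0 < \<nu>'" "p = 0 \<longrightarrow> \<beta> < 2 * \<mu> * \<nu>'" "ereal \<nu>' \<le> \<nu>" by blast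
    have "positive_self_adjoint D A E \<nu>'"
      by unfold_locales (use A spectral n form_infimum_bound[OF A] \<nu>(1) in auto)
    with n show ?thesis by blast
  qed
  have problem: "\<exists>s s'. band_problem inner (positive_self_adjoint.truncation A E \<nu>' n) \<nu>' p \<mu> M1 M2 M3 M4 M5 \<epsilon> c c' (ce \<epsilon>) (ce' \<epsilon>)
       (\<lambda>t. E n (u t)) (\<lambda>t. E n (ue \<epsilon> t - u t)) s s' (E n w)
     \<and> (\<forall>t\<ge>0. s t = E n (half_line_deriv (r \<epsilon>) t)) \<and> (\<forall>t\<ge>0. \<rho> \<epsilon> t = ue \<epsilon> t - u t \<and> \<rho> \<epsilon> t \<in> D)"
    if psa: "positive_self_adjoint D A E \<nu>'" and \<epsilon>: "0 < \<epsilon>" "\<epsilon> < \<epsilon>0" for \<nu>' \<epsilon> and n :: nat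
  proof -
    interpret positive_self_adjoint D A E \<nu>' by (rule psa)
    obtain ue' ue'' where ue': "\<And>t. 0 \<le> t \<Longrightarrow> (ue \<epsilon> has_vector_derivative ue' t) (at t within {0..})"
      "\<And>t. 0 \<le> t \<Longrightarrow> (ue' has_vector_derivative ue'' t) (at t within {0..})" "\<And>t. 0 \<le> t \<Longrightarrow> ue \<epsilon> t \<in> D"
      "\<And>t. 0 \<le> t \<Longrightarrow> \<epsilon> *\<^sub>R ue'' t + (1 / (1 + t) powr p) *\<^sub>R ue' t + ce \<epsilon> t *\<^sub>R A (ue \<epsilon> t) = 0"
      "ue \<epsilon> 0 = u0" "ue' 0 = u1"
      using ue[OF \<epsilon>] unfolding hyperbolic_solution_def C1_half_line_def C0_into_domain_def by blast
    have c_deriv: "(c has_vector_derivative c' t) (at t within {0..})" if "0 \<le> t" for t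
      using c_C1 that by (simp add: C1_half_line_def)
    have k_deriv: "(ce \<epsilon> has_vector_derivative ce' \<epsilon> t) (at t within {0..})" if "0 \<le> t" for t
      using ce_C1[OF \<epsilon>] that by (simp add: C1_half_line_def)
    obtain s s' where bp: "band_problem inner (truncation n) \<nu>' p \<mu> M1 M2 M3 M4 M5 \<epsilon> c c' (ce \<epsilon>) (ce' \<epsilon>)
       (\<lambda>t. E n (u t)) (\<lambda>t. E n (ue \<epsilon> t - u t)) s s' (E n w)"
      and s: "\<forall>t\<ge>0. s t = E n (ue' t - u' t - exp (- damping_primitive p t / \<epsilon>) *\<^sub>R w)"
    proof (rule truncated_band_problem[where n = n, OF p \<epsilon>(1) \<mu> c_deriv c_bounds c'_bound k_deriv ce_bounds[OF \<epsilon>] ce'_bound[OF \<epsilon>] ce_c[OF \<epsilon>]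
        u'(1-3) ue'(1-4)])
      show "ue \<epsilon> 0 = u 0" "w = ue' 0 + c 0 *\<^sub>R A (u 0)" using ue' u' by (auto simp: w_def)
    qed
    have r': "half_line_deriv (r \<epsilon>) t = ue' t - u' t - exp (- damping_primitive p t / \<epsilon>) *\<^sub>R w" if t: "0 \<le> t" for t
    proof (rule vector_derivative_within[OF at_within_half_line_neq_bot[OF t]])
      have "((\<lambda>t. ue \<epsilon> t - u t - \<theta> \<epsilon> t) has_vector_derivative
          ue' t - u' t - exp (- damping_primitive p t / \<epsilon>) *\<^sub>R w) (at t within {0..})"
        using corrector_deriv(2)[OF \<theta>[OF \<epsilon>] \<epsilon>(1) t] unfolding w_def
        by (intro has_vector_derivative_diff ue'(1) u'(1) t)
      then show "(r \<epsilon> has_vector_derivative ue' t - u' t - exp (- damping_primitive p t / \<epsilon>) *\<^sub>R w) (at t within {0..})"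
        by (rule has_vector_derivative_transform[rotated 2]) (use t r[OF \<epsilon>] in auto)
    qed
    have \<rho>': "\<rho> \<epsilon> t = ue \<epsilon> t - u t \<and> \<rho> \<epsilon> t \<in> D" if "0 \<le> t" for t
      using \<rho>[OF \<epsilon> that] ue'(3)[OF that] u'(2)[OF that] subspace_diff[OF D_subspace] by force
    have "\<forall>t\<ge>0. s t = E n (half_line_deriv (r \<epsilon>) t)" using s r' by simp
    with bp \<rho>' show ?thesis by blast
  qed
  show ?thesis
    unfolding \<kappa>_def[symmetric]
  proof (intro conjI impI)
    assume data: "u0 \<in> power_domain D A (3/2) \<and> u1 \<in> power_domain D A (1/2)"
    show "decay_error_estimates p \<kappa> \<epsilon>0 (\<lambda>\<epsilon>. Gamma_r D A \<epsilon> (\<rho> \<epsilon>) (r \<epsilon>))"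
    proof (rule decay_error_estimatesI[OF p \<kappa>])
      fix \<beta> :: real assume \<beta>: "0 \<le> \<beta>" "p = 0 \<Longrightarrow> ereal \<beta> < \<kappa>"
      obtain \<nu>' where \<nu>': "0 < \<nu>'" "p = 0 \<Longrightarrow> \<beta> < 2 * \<mu> * \<nu>'" and psa: "positive_self_adjoint D A E \<nu>'"
        using rate[OF \<beta>] by blast
      interpret positive_self_adjoint D A E \<nu>' by (rule psa)
      note bounds = strong_data_bounds(1,2)[OF u0 domain[OF conjunct1[OF data]] domain[OF u1], where a = "c 0", folded w_def]
        strong_data_bounds(3)[OF u0 domain[OF conjunct1[OF data]] domain[OF u1]]
      define KY where "KY = (LINT s|\<sigma> u0. (s powr (3/2))\<^sup>2)"
      define Kw where "Kw = max ((norm w)\<^sup>2) (2 * (LINT s|\<sigma> u1. (s powr (1/2))\<^sup>2) + 2 * (c 0)\<^sup>2 * KY)"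
      obtain \<epsilon>1 C where \<epsilon>1: "0 < \<epsilon>1" and C:
        "\<And>I :: 'h \<Rightarrow> 'h \<Rightarrow> real. \<And>B \<epsilon> c c' k k' U v s s' w t.
          \<lbrakk>band_problem I B \<nu>' p \<mu> M1 M2 M3 M4 M5 \<epsilon> c c' k k' U v s s' w; \<epsilon> < \<epsilon>1;
           I w w \<le> Kw; I (B w) w \<le> Kw; I (B (B (U 0))) (B (U 0)) \<le> KY; 0 \<le> t\<rbrakk>
          \<Longrightarrow> \<epsilon> * I (s t) (s t) / 2 + \<mu> * I (B (v t)) (v t) \<le> C * \<epsilon>\<^sup>2 * exp (- \<beta> * damping_primitive p t)"
        by (rule uniform_energy_decay[OF p \<beta>(1) \<mu> \<nu>']) blast+
      define C' where "C' = (1 / (\<mu> * \<nu>') + 1 / \<mu> + 2) * C"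
      have "Gamma_r D A \<epsilon> (\<rho> \<epsilon>) (r \<epsilon>) t \<le> C' * \<epsilon>\<^sup>2 * exp (- \<beta> * damping_primitive p t)"
        if \<epsilon>: "0 < \<epsilon>" "\<epsilon> < \<epsilon>0" "\<epsilon> < \<epsilon>1" and t: "0 \<le> t" for \<epsilon> t
      proof -
        define Q where "Q = C * \<epsilon>\<^sup>2 * exp (- \<beta> * damping_primitive p t)"
        let ?\<rho> = "\<rho> \<epsilon> t" and ?r' = "half_line_deriv (r \<epsilon>) t"
        \<comment> \<open>The right-hand sides are free of n, so the projections can be removed
          afterwards; the middle bound has the form that \<open>power_half_bound\<close>
          takes.\<close>
        have "\<epsilon> * (norm (E n ?r'))\<^sup>2 \<le> 2 * Q \<and> inner (A (E n ?\<rho>)) (E n ?\<rho>) \<le> Q / \<mu> \<and> (norm (E n ?\<rho>))\<^sup>2 \<le> Q / \<mu> / \<nu>'" for n :: nat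
        proof -
          interpret tr: energy_form inner "truncation n" \<nu>' by (rule truncation_form)
          obtain s s' where bp: "band_problem inner (truncation n) \<nu>' p \<mu> M1 M2 M3 M4 M5 \<epsilon> c c' (ce \<epsilon>) (ce' \<epsilon>)
             (\<lambda>t. E n (u t)) (\<lambda>t. E n (ue \<epsilon> t - u t)) s s' (E n w)"
            and s: "\<forall>t\<ge>0. s t = E n (half_line_deriv (r \<epsilon>) t)" and v: "\<forall>t\<ge>0. \<rho> \<epsilon> t = ue \<epsilon> t - u t \<and> \<rho> \<epsilon> t \<in> D"
            using problem[OF psa \<epsilon>(1,2), of n] by (elim exE conjE) (rule that)
          note st = s[rule_format, OF t] and vt = conjunct1[OF v[rule_format, OF t], symmetric]
          have "\<epsilon> * inner (s t) (s t) / 2 + \<mu> * inner (truncation n (E n (ue \<epsilon> t - u t))) (E n (ue \<epsilon> t - u t)) \<le> Q"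
            unfolding Q_def
            by (rule C[OF bp \<epsilon>(3) _ _ _ t]) (use bounds[of n] u'(4) in \<open>auto simp: Kw_def KY_def\<close>)
          then have le: "\<epsilon> * inner (E n ?r') (E n ?r') / 2 + \<mu> * inner (truncation n (E n ?\<rho>)) (E n ?\<rho>) \<le> Q"
            unfolding st vt .
          have "0 \<le> \<epsilon> * inner (E n ?r') (E n ?r')" "0 \<le> \<mu> * inner (truncation n (E n ?\<rho>)) (E n ?\<rho>)"
            by (intro mult_nonneg_nonneg tr.I_nonneg tr.B_nonneg less_imp_le[OF \<epsilon>(1)] less_imp_le[OF \<mu>])+
          then have 1: "\<epsilon> * inner (E n ?r') (E n ?r') \<le> 2 * Q" and "\<mu> * inner (truncation n (E n ?\<rho>)) (E n ?\<rho>) \<le> Q"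
            using le by linarith+
          then have 2: "inner (truncation n (E n ?\<rho>)) (E n ?\<rho>) \<le> Q / \<mu>"
            using \<mu> by (simp add: field_simps)
          have "inner (E n ?\<rho>) (E n ?\<rho>) \<le> Q / \<mu> / \<nu>'"
            using order_trans[OF tr.I_le_B divide_right_mono[OF 2]] \<nu>'(1) by simp
          with 1 2 show ?thesis unfolding truncation_E power2_norm_eq_inner by (intro conjI)
        qed
        note le = this
        have "(norm (E n ?r'))\<^sup>2 \<le> 2 * Q / \<epsilon>" for n :: nat
          using conjunct1[OF le[of n]] \<epsilon>(1) by (simp add: pos_le_divide_eq mult.commute)
        then have "(norm ?r')\<^sup>2 \<le> 2 * Q / \<epsilon>" by (rule norm_le_of_E)
        then have 1: "\<epsilon> * (norm ?r')\<^sup>2 \<le> 2 * Q" using \<epsilon>(1) by (simp add: field_simps)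
        have 2: "(norm ?\<rho>)\<^sup>2 \<le> Q / \<mu> / \<nu>'" by (rule norm_le_of_E[OF conjunct2[OF conjunct2[OF le]]])
        have 3: "(norm (power_operator D A (1/2) ?\<rho>))\<^sup>2 \<le> Q / \<mu>"
          by (rule power_half_bound[OF E_def conjunct1[OF conjunct2[OF le]]])
        have "Gamma_r D A \<epsilon> (\<rho> \<epsilon>) (r \<epsilon>) t \<le> Q / \<mu> / \<nu>' + Q / \<mu> + 2 * Q"
          unfolding Gamma_r_def by (intro add_mono 1 2 3)
        also have "\<dots> = C' * \<epsilon>\<^sup>2 * exp (- \<beta> * damping_primitive p t)"
          by (simp add: C'_def Q_def algebra_simps)
        finally show ?thesis .
      qed
      then show "\<exists>\<epsilon>1 C. 0 < \<epsilon>1 \<and> \<epsilon>1 \<le> \<epsilon>0 \<and> (\<forall>\<epsilon> t. 0 < \<epsilon> \<longrightarrow> \<epsilon> < \<epsilon>1 \<longrightarrow> 0 \<le> t \<longrightarrow>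
        Gamma_r D A \<epsilon> (\<rho> \<epsilon>) (r \<epsilon>) t \<le> C * \<epsilon>\<^sup>2 * exp (- \<beta> * damping_primitive p t))"
        using \<epsilon>1 \<epsilon>0 by (intro exI[of _ "min \<epsilon>1 \<epsilon>0"] exI[of _ C']) auto
    qed
  next
    assume data: "u0 \<in> power_domain D A 2 \<and> u1 \<in> D"
    show "decay_error_estimates p \<kappa> \<epsilon>0 (\<lambda>\<epsilon>. Gamma_c D A \<epsilon> (\<rho> \<epsilon>) (r \<epsilon>))"
    proof (rule decay_error_estimatesI[OF p \<kappa>])
      fix \<beta> :: real assume \<beta>: "0 \<le> \<beta>" "p = 0 \<Longrightarrow> ereal \<beta> < \<kappa>"
      obtain \<nu>' where \<nu>': "0 < \<nu>'" "p = 0 \<Longrightarrow> \<beta> < 2 * \<mu> * \<nu>'" and psa: "positive_self_adjoint D A E \<nu>'"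
        using rate[OF \<beta>] by blast
      interpret positive_self_adjoint D A E \<nu>' by (rule psa)
      note bounds = smooth_data_bounds(1)[OF u0 domain[OF conjunct1[OF data]] conjunct2[OF data], where a = "c 0", folded w_def]
        smooth_data_bounds(2)[OF u0 domain[OF conjunct1[OF data]] conjunct2[OF data]]
      define KY where "KY = (LINT s|\<sigma> u0. (s powr 2)\<^sup>2)"
      define K where "K = 2 * (norm (A u1))\<^sup>2 + 2 * (c 0)\<^sup>2 * KY"
      \<comment> \<open>The bound K controls |A w|^2; dividing by \<open>\<nu>'\<close> gives the
        bound for the form <A w, w>.\<close>
      define Kw where "Kw = max K (K / \<nu>')"
      obtain \<epsilon>1 C where \<epsilon>1: "0 < \<epsilon>1" and C:
        "\<And>I :: 'h \<Rightarrow> 'h \<Rightarrow> real. \<And>B \<epsilon> c c' k k' U v s s' w t.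
          \<lbrakk>band_problem I B \<nu>' p \<mu> M1 M2 M3 M4 M5 \<epsilon> c c' k k' U v s s' w; \<epsilon> < \<epsilon>1;
           I w w \<le> Kw; I (B w) w \<le> Kw; I (B (B (U 0))) (B (U 0)) \<le> KY; 0 \<le> t\<rbrakk>
          \<Longrightarrow> \<epsilon> * I (s t) (s t) / 2 + \<mu> * I (B (v t)) (v t) \<le> C * \<epsilon>\<^sup>2 * exp (- \<beta> * damping_primitive p t)"
        by (rule uniform_energy_decay[OF p \<beta>(1) \<mu> \<nu>']) blast+
      obtain \<epsilon>2 C2 where \<epsilon>2: "0 < \<epsilon>2" and C2:
        "\<And>I :: 'h \<Rightarrow> 'h \<Rightarrow> real. \<And>B \<epsilon> c c' k k' U v s s' w t.
          \<lbrakk>band_problem I B \<nu>' p \<mu> M1 M2 M3 M4 M5 \<epsilon> c c' k k' U v s s' w; \<epsilon> < \<epsilon>2;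
           I (B w) w \<le> Kw; I (B w) (B w) \<le> Kw; I (B (B (U 0))) (B (B (U 0))) \<le> KY; 0 \<le> t\<rbrakk>
          \<Longrightarrow> I (s t) (s t) \<le> C2 * \<epsilon>\<^sup>2 * exp (- \<beta> * damping_primitive p t)"
        by (rule uniform_velocity_decay[OF p \<beta>(1) \<mu> \<nu>']) blast+
      define C' where "C' = (1 / (\<mu> * \<nu>'\<^sup>2) + 1 / (\<mu> * \<nu>') + 1 / \<mu> + 2) * C + C2"
      have "Gamma_c D A \<epsilon> (\<rho> \<epsilon>) (r \<epsilon>) t \<le> C' * \<epsilon>\<^sup>2 * exp (- \<beta> * damping_primitive p t)"
        if \<epsilon>: "0 < \<epsilon>" "\<epsilon> < \<epsilon>0" "\<epsilon> < \<epsilon>1" "\<epsilon> < \<epsilon>2" and t: "0 \<le> t" for \<epsilon> t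
      proof -
        define Q where "Q = C * \<epsilon>\<^sup>2 * exp (- \<beta> * damping_primitive p t)"
        define Q2 where "Q2 = C2 * \<epsilon>\<^sup>2 * exp (- \<beta> * damping_primitive p t)"
        let ?\<rho> = "\<rho> \<epsilon> t" and ?r' = "half_line_deriv (r \<epsilon>) t"
        have "\<forall>t\<ge>0. \<rho> \<epsilon> t = ue \<epsilon> t - u t \<and> \<rho> \<epsilon> t \<in> D"
          using problem[OF psa \<epsilon>(1,2), of 0] by (elim exE conjE)
        then have \<rho>_D: "?\<rho> \<in> D" using t by blast
        have "inner (A (E n ?r')) (E n ?r') \<le> 2 * Q / \<epsilon> \<and> (norm (E n (A ?\<rho>)))\<^sup>2 \<le> Q / \<mu>
          \<and> inner (A (E n ?\<rho>)) (E n ?\<rho>) \<le> Q / \<mu> / \<nu>' \<and> (norm (E n ?\<rho>))\<^sup>2 \<le> Q / \<mu> / \<nu>'\<^sup>2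
          \<and> (norm (E n ?r'))\<^sup>2 \<le> Q2" for n :: nat
        proof -
          interpret tr: energy_form inner "truncation n" \<nu>' by (rule truncation_form)
          obtain s s' where bp: "band_problem inner (truncation n) \<nu>' p \<mu> M1 M2 M3 M4 M5 \<epsilon> c c' (ce \<epsilon>) (ce' \<epsilon>)
             (\<lambda>t. E n (u t)) (\<lambda>t. E n (ue \<epsilon> t - u t)) s s' (E n w)"
            and s: "\<forall>t\<ge>0. s t = E n (half_line_deriv (r \<epsilon>) t)" and v: "\<forall>t\<ge>0. \<rho> \<epsilon> t = ue \<epsilon> t - u t \<and> \<rho> \<epsilon> t \<in> D"
            using problem[OF psa \<epsilon>(1,2), of n] by (elim exE conjE) (rule that)
          note st = s[rule_format, OF t] and vt = conjunct1[OF v[rule_format, OF t], symmetric]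
          have sym: "inner (truncation n (truncation n x)) y = inner (truncation n x) (truncation n y)" for x y
            by (rule tr.I_sym)
          have Tw: "inner (truncation n (E n w)) (truncation n (E n w)) \<le> K"
            unfolding K_def KY_def by (rule bounds(1))
          moreover have "inner (truncation n (E n w)) (E n w) \<le> K / \<nu>'"
            unfolding pos_le_divide_eq[OF \<nu>'(1)]
            using order_trans[OF tr.B_norm_ge Tw] by (simp only: mult.commute)
          ultimately have Kw: "inner (truncation n (E n w)) (truncation n (E n w)) \<le> Kw"
            "inner (truncation n (E n w)) (E n w) \<le> Kw" by (auto simp: Kw_def)
          have KY: "inner (truncation n (truncation n (E n (u 0)))) (truncation n (truncation n (E n (u 0)))) \<le> KY"
            unfolding KY_def u'(4) by (rule bounds(2))
          have "\<epsilon> * inner (truncation n (s t)) (s t) / 2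
              + \<mu> * inner (truncation n (truncation n (E n (ue \<epsilon> t - u t)))) (E n (ue \<epsilon> t - u t)) \<le> Q"
            unfolding Q_def
          \<comment> \<open>In the derived form the kinetic part is <A r', r'> and the potential
            part is |A \<rho>|^2, both for the compressed quantities.\<close>
          proof (rule C[OF band_problem.derived_band_problem[OF bp] \<epsilon>(3) _ _ _ t])
            show "inner (truncation n (E n w)) (E n w) \<le> Kw" by (rule Kw)
            show "inner (truncation n (truncation n (E n w))) (E n w) \<le> Kw"
              unfolding sym[of "E n w"] by (rule Kw)
            show "inner (truncation n (truncation n (truncation n (E n (u 0))))) (truncation n (E n (u 0))) \<le> KY"
              unfolding sym[of "truncation n (E n (u 0))"] by (rule KY)
          qed
          then have le: "\<epsilon> * inner (truncation n (E n ?r')) (E n ?r') / 2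
              + \<mu> * inner (truncation n (E n ?\<rho>)) (truncation n (E n ?\<rho>)) \<le> Q"
            unfolding st vt sym .
          have "0 \<le> \<epsilon> * inner (truncation n (E n ?r')) (E n ?r')"
              "0 \<le> \<mu> * inner (truncation n (E n ?\<rho>)) (truncation n (E n ?\<rho>))"
            by (intro mult_nonneg_nonneg tr.I_nonneg tr.B_nonneg less_imp_le[OF \<epsilon>(1)] less_imp_le[OF \<mu>])+
          then have "\<epsilon> * inner (truncation n (E n ?r')) (E n ?r') \<le> 2 * Q"
            and "\<mu> * inner (truncation n (E n ?\<rho>)) (truncation n (E n ?\<rho>)) \<le> Q"
            using le by linarith+
          then have 1: "inner (truncation n (E n ?r')) (E n ?r') \<le> 2 * Q / \<epsilon>"
            and 2: "inner (truncation n (E n ?\<rho>)) (truncation n (E n ?\<rho>)) \<le> Q / \<mu>"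
            using \<mu> \<epsilon>(1) by (simp_all add: field_simps)
          have "\<nu>' * inner (truncation n (E n ?\<rho>)) (E n ?\<rho>) \<le> Q / \<mu>"
            using order_trans[OF tr.B_norm_ge 2] .
          then have 3: "inner (truncation n (E n ?\<rho>)) (E n ?\<rho>) \<le> Q / \<mu> / \<nu>'"
            unfolding pos_le_divide_eq[OF \<nu>'(1)] by (simp only: mult.commute)
          have 4: "inner (E n ?\<rho>) (E n ?\<rho>) \<le> Q / \<mu> / \<nu>'\<^sup>2"
            by (rule order_trans[OF tr.I_le_BB divide_right_mono[OF 2 zero_le_power2]])
          \<comment> \<open>Applied to the original problem: the velocity estimate passes to the
            derived form internally, yet its conclusion concerns the inner product.\<close>
          have "inner (s t) (s t) \<le> Q2"
            unfolding Q2_def by (rule C2[OF bp \<epsilon>(4) _ _ _ t]) (rule Kw(2), rule Kw(1), rule KY)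
          then have 5: "inner (E n ?r') (E n ?r') \<le> Q2" unfolding st .
          have EA: "E n (A ?\<rho>) = A (E n ?\<rho>)" by (rule E_A[OF \<rho>_D]) simp
          show ?thesis
            using 1 2 3 4 5 unfolding EA truncation_E power2_norm_eq_inner by (intro conjI)
        qed
        note le = this
        have 1: "(norm ?\<rho>)\<^sup>2 \<le> Q / \<mu> / \<nu>'\<^sup>2" by (rule norm_le_of_E[OF conjunct1[OF conjunct2[OF conjunct2[OF conjunct2[OF le]]]]])
        have 2: "(norm (power_operator D A (1/2) ?\<rho>))\<^sup>2 \<le> Q / \<mu> / \<nu>'"
          by (rule power_half_bound[OF E_def conjunct1[OF conjunct2[OF conjunct2[OF le]]]])
        have 3: "(norm (A ?\<rho>))\<^sup>2 \<le> Q / \<mu>" by (rule norm_le_of_E[OF conjunct1[OF conjunct2[OF le]]])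
        have 4: "(norm ?r')\<^sup>2 \<le> Q2" by (rule norm_le_of_E[OF conjunct2[OF conjunct2[OF conjunct2[OF conjunct2[OF le]]]]])
        have "(norm (power_operator D A (1/2) ?r'))\<^sup>2 \<le> 2 * Q / \<epsilon>"
          by (rule power_half_bound[OF E_def conjunct1[OF le]])
        then have 5: "\<epsilon> * (norm (power_operator D A (1/2) ?r'))\<^sup>2 \<le> 2 * Q" using \<epsilon>(1) by (simp add: field_simps)
        have "Gamma_c D A \<epsilon> (\<rho> \<epsilon>) (r \<epsilon>) t \<le> Q / \<mu> / \<nu>'\<^sup>2 + Q / \<mu> / \<nu>' + Q / \<mu> + Q2 + 2 * Q"
          unfolding Gamma_c_def by (intro add_mono 1 2 3 4 5)
        also have "\<dots> = C' * \<epsilon>\<^sup>2 * exp (- \<beta> * damping_primitive p t)"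
          by (simp add: C'_def Q_def Q2_def algebra_simps)
        finally show ?thesis .
      qed
      then show "\<exists>\<epsilon>1 C. 0 < \<epsilon>1 \<and> \<epsilon>1 \<le> \<epsilon>0 \<and> (\<forall>\<epsilon> t. 0 < \<epsilon> \<longrightarrow> \<epsilon> < \<epsilon>1 \<longrightarrow> 0 \<le> t \<longrightarrow>
        Gamma_c D A \<epsilon> (\<rho> \<epsilon>) (r \<epsilon>) t \<le> C * \<epsilon>\<^sup>2 * exp (- \<beta> * damping_primitive p t))"
        using \<epsilon>1 \<epsilon>2 \<epsilon>0 by (intro exI[of _ "min (min \<epsilon>1 \<epsilon>2) \<epsilon>0"] exI[of _ C']) auto
    qed
  qed
qed

end
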